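(* Let $R$ be a non-discrete irreducible, continuous ring and let $E$ be a maximal nest in $R$. If a topological subgroup $G\le\mathrm{GL}(R_E)$ is amenable, then the $E$-envelope $[G]_E$ is extremely amenable. Here $\mathrm{GL}(R_E)$ and all its subgroups carry the topology generated by (the restriction of) the rank metric $d_R$.
   Context: Rings. A unital ring $R$ is (von Neumann) regular if for every $a\in R$ there is $b\in R$ with $aba=a$. For such $R$, the set $\mathrm{L}(R)=\{aR\mid a\in R\}$ ordered by inclusion is a complemented modular lattice. A continuous ring is a regular ring $R$ such that $\mathrm{L}(R)$ is a continuous geometry, i.e., additionally a complete lattice such that for every chain $C\subseteq \mathrm{L}(R)$ and every $x\in\mathrm{L}(R)$ one has $x\wedge\bigvee C=\bigvee\{x\wedge y\mid y\in C\}$ and $x\vee\bigwedge C=\bigwedge\{x\vee y\mid y\in C\}$. A ring is irreducible if it is non-zero and not isomorphic to a direct product of two non-zero rings. A rank function on a regular ring $R$ is a map $\rho\colon R\to[0,1]$ with $\rho(1)=1$, $\rho(ab)\le\min\{\rho(a),\rho(b)\}$ for all $a,b\in R$, $\rho(e+f)=\rho(e)+\rho(f)$ for all idempotents $e,f$ with $ef=fe=0$, and $\rho(a)>0$ for $a\ne0$. Every irreducible, continuous ring $R$ has a unique rank function $\rho_R$ (von Neumann), and $d_R(a,b):=\rho_R(a-b)$ is a complete metric on $R$; $R$ is non-discrete if the topology generated by $d_R$ is not discrete. $\mathrm{GL}(R)$ is the group of units of $R$; with the topology generated by $d_R$ it is a topological group. Nests. $\mathrm{E}(R)$ is the set of idempotents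 of $R$, ordered by $e\le f:\Leftrightarrow ef=fe=e$. A nest in $R$ is a chain in $(\mathrm{E}(R),\le)$; a maximal nest is a nest that is maximal with respect to inclusion. For a nest $E$, $R_E:=\{a\in R\mid eae=ae\text{ for all }e\in E\}$, a unital subring of $R$, and $\mathrm{GL}(R_E)$ is its unit group, a subgroup of $\mathrm{GL}(R)$. Envelope. For a subgroup $G\le\mathrm{GL}(R_E)$, the $E$-envelope $[G]_E$ is the set of all $a\in R_E$ for which there exist $n\in\mathbb{N}$ and $e_0,\dots,e_n\in E\cup\{0,1\}$ with $0=e_0\le\dots\le e_n=1$ such that, with $\bar e_i:=e_i-e_{i-1}$, one has $\bar e_ia\bar e_i\in\bar e_iG\bar e_i=\{\bar e_i g\bar e_i\mid g\in G\}$ for every $i\in\{1,\dots,n\}$. It is a subgroup of $\mathrm{GL}(R_E)$. Dynamics. A topological group is amenable if every (jointly) continuous action of it on a non-empty compact Hausdorff space admits an invariant regular Borel probability measure, and extremely amenable if every such action has a fixed point. *)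

theory Defs
  imports
    "HOL-Algebra.Chinese_Remainder"
    "HOL-Algebra.Complete_Lattice"
    "HOL-Algebra.Group_Action"
    "HOL-Analysis.Abstract_Metric_Spaces"
    "HOL-Probability.Probability_Measure"
begin

section \<open>Continuous rings\<close>

definition regular_ring :: "('a, 'm) ring_scheme \<Rightarrow> bool" where
  "regular_ring R \<longleftrightarrow> ring R \<and>
     (\<forall>a\<in>carrier R. \<exists>b\<in>carrier R. a \<otimes>\<^bsub>R\<^esub> b \<otimes>\<^bsub>R\<^esub> a = a)"

definition principal_right_ideal :: "('a, 'm) ring_scheme \<Rightarrow> 'a \<Rightarrow> 'a set" where
  "principal_right_ideal R a = {a \<otimes>\<^bsub>R\<^esub> x | x. x \<in> carrier R}"

definition right_ideal_lattice :: "('a, 'm) ring_scheme \<Rightarrow> 'a set gorder" where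
  "right_ideal_lattice R =
     \<lparr>carrier = principal_right_ideal R ` carrier R, eq = (=), le = (\<subseteq>)\<rparr>"

definition complemented_lattice :: "('b, 'm) gorder_scheme \<Rightarrow> bool" where
  "complemented_lattice L \<longleftrightarrow>
     (\<forall>x\<in>carrier L. \<exists>y\<in>carrier L. x \<squnion>\<^bsub>L\<^esub> y = \<top>\<^bsub>L\<^esub> \<and> x \<sqinter>\<^bsub>L\<^esub> y = \<bottom>\<^bsub>L\<^esub>)"

definition modular_lattice :: "('b, 'm) gorder_scheme \<Rightarrow> bool" where
  "modular_lattice L \<longleftrightarrow>
     (\<forall>x\<in>carrier L. \<forall>y\<in>carrier L. \<forall>z\<in>carrier L.
        x \<sqsubseteq>\<^bsub>L\<^esub> z \<longrightarrow> x \<squnion>\<^bsub>L\<^esub> (y \<sqinter>\<^bsub>L\<^esub> z) = (x \<squnion>\<^bsub>L\<^esub> y) \<sqinter>\<^bsub>L\<^esub> z)"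

definition continuous_geometry :: "('b, 'm) gorder_scheme \<Rightarrow> bool" where
  "continuous_geometry L \<longleftrightarrow>
     complete_lattice L \<and> complemented_lattice L \<and> modular_lattice L \<and>
     (\<forall>C. pred_on.chain (carrier L) (\<lambda>x y. x \<sqsubseteq>\<^bsub>L\<^esub> y) C \<longrightarrow>
        (\<forall>x\<in>carrier L.
           x \<sqinter>\<^bsub>L\<^esub> (\<Squnion>\<^bsub>L\<^esub> C) = \<Squnion>\<^bsub>L\<^esub> ((\<lambda>y. x \<sqinter>\<^bsub>L\<^esub> y) ` C) \<and>
           x \<squnion>\<^bsub>L\<^esub> (\<Sqinter>\<^bsub>L\<^esub> C) = \<Sqinter>\<^bsub>L\<^esub> ((\<lambda>y. x \<squnion>\<^bsub>L\<^esub> y) ` C)))"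

definition continuous_ring :: "('a, 'm) ring_scheme \<Rightarrow> bool" where
  "continuous_ring R \<longleftrightarrow> regular_ring R \<and> continuous_geometry (right_ideal_lattice R)"

text \<open>
  Rings of type \<^typ>\<open>'a ring\<close> suffice as factors in the following definition, because a factor
  of \<open>R\<close> embeds into \<open>R\<close>; see \<open>irreducible_ring_any_type\<close>.
\<close>

definition irreducible_ring :: "('a, 'm) ring_scheme \<Rightarrow> bool" where
  "irreducible_ring R \<longleftrightarrow> carrier R \<noteq> {\<zero>\<^bsub>R\<^esub>} \<and>
     \<not> (\<exists>(S :: 'a ring) (T :: 'a ring). ring S \<and> ring T \<and>
          carrier S \<noteq> {\<zero>\<^bsub>S\<^esub>} \<and> carrier T \<noteq> {\<zero>\<^bsub>T\<^esub>} \<and> R \<simeq> RDirProd S T)"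

lemma ring_copy:
  fixes S :: "('b, 'm) ring_scheme" and h :: "'b \<Rightarrow> 'a"
  assumes "ring S" and inj: "inj_on h (carrier S)"
  obtains S' :: "'a ring" where "ring S'" "carrier S' = h ` carrier S" "\<zero>\<^bsub>S'\<^esub> = h \<zero>\<^bsub>S\<^esub>"
    "h \<in> ring_iso S S'"
proof -
  interpret S: ring S by fact
  let ?k = "inv_into (carrier S) h"
  define S' :: "'a ring" where "S' = \<lparr>carrier = h ` carrier S,
     Group.monoid.mult = (\<lambda>a b. h (?k a \<otimes>\<^bsub>S\<^esub> ?k b)), one = h \<one>\<^bsub>S\<^esub>, zero = h \<zero>\<^bsub>S\<^esub>,
     add = (\<lambda>a b. h (?k a \<oplus>\<^bsub>S\<^esub> ?k b))\<rparr>"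
  have k [simp]: "?k (h a) = a" if "a \<in> carrier S" for a using inj that by simp
  have iso: "h \<in> ring_iso S S'"
    unfolding ring_iso_def ring_hom_def S'_def using inj by (auto simp: bij_betw_def)
  have "ring S'"
    using S.ring_iso_imp_img_ring[OF iso] by (simp add: S'_def)
  then show thesis using that iso by (simp add: S'_def)
qed

lemma irreducible_ring_any_type:
  fixes R :: "('a, 'm) ring_scheme" and S :: "('b, 'n) ring_scheme" and T :: "('c, 'k) ring_scheme"
  assumes "irreducible_ring R" "ring R" "ring S" "ring T"
    and "carrier S \<noteq> {\<zero>\<^bsub>S\<^esub>}" "carrier T \<noteq> {\<zero>\<^bsub>T\<^esub>}"
  shows "\<not> R \<simeq> RDirProd S T"
proof
  assume iso: "R \<simeq> RDirProd S T"
  interpret R: ring R by fact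
  interpret S: ring S by fact
  interpret T: ring T by fact
  have "RDirProd S T \<simeq> R" using ring_iso_sym[OF \<open>ring R\<close> iso] .
  then obtain f where f: "f \<in> ring_iso (RDirProd S T) R" by (auto simp: is_ring_iso_def)
  then have injf: "inj_on f (carrier S \<times> carrier T)"
    by (auto simp: ring_iso_def bij_betw_def RDirProd_carrier)
  have "inj_on (\<lambda>s. f (s, \<zero>\<^bsub>T\<^esub>)) (carrier S)" "inj_on (\<lambda>t. f (\<zero>\<^bsub>S\<^esub>, t)) (carrier T)"
    using injf S.zero_closed T.zero_closed unfolding inj_on_def by blast+
  then obtain S' T' :: "'a ring" and h k where S': "ring S'" "carrier S' = h ` carrier S"
      "\<zero>\<^bsub>S'\<^esub> = h \<zero>\<^bsub>S\<^esub>" "h \<in> ring_iso S S'" "inj_on h (carrier S)"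
    and T': "ring T'" "carrier T' = k ` carrier T"
      "\<zero>\<^bsub>T'\<^esub> = k \<zero>\<^bsub>T\<^esub>" "k \<in> ring_iso T T'" "inj_on k (carrier T)"
    using ring_copy[OF \<open>ring S\<close>] ring_copy[OF \<open>ring T\<close>] by metis
  have "carrier S' \<noteq> {\<zero>\<^bsub>S'\<^esub>}"
    using inj_on_image_eq_iff[OF S'(5), of "carrier S" "{\<zero>\<^bsub>S\<^esub>}"] S' assms(5) by simp
  moreover have "carrier T' \<noteq> {\<zero>\<^bsub>T'\<^esub>}"
    using inj_on_image_eq_iff[OF T'(5), of "carrier T" "{\<zero>\<^bsub>T\<^esub>}"] T' assms(6) by simp
  moreover have "map_prod h k \<in> ring_iso (RDirProd S T) (RDirProd S' T')"
  proof -
    have "bij_betw (map_prod h k) (carrier S \<times> carrier T) (carrier S' \<times> carrier T')"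
      using S' T' by (intro bij_betw_map_prod) (simp_all add: bij_betw_def)
    then show ?thesis
      using S'(4) T'(4)
      unfolding ring_iso_def ring_hom_def RDirProd_def DirProd_def monoid.defs by auto
  qed
  then have "R \<simeq> RDirProd S' T'"
    using ring_iso_trans[OF iso] by (auto simp: is_ring_iso_def)
  ultimately show False
    using assms(1) S'(1) T'(1) unfolding irreducible_ring_def by blast
qed

section \<open>Rank functions\<close>

definition idempotents :: "('a, 'm) ring_scheme \<Rightarrow> 'a set" where
  "idempotents R = {e \<in> carrier R. e \<otimes>\<^bsub>R\<^esub> e = e}"

definition rank_function :: "('a, 'm) ring_scheme \<Rightarrow> ('a \<Rightarrow> real) \<Rightarrow> bool" where
  "rank_function R \<rho> \<longleftrightarrow>
     \<rho> \<in> carrier R \<rightarrow> {0..1} \<and>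
     \<rho> \<one>\<^bsub>R\<^esub> = 1 \<and>
     (\<forall>a\<in>carrier R. \<forall>b\<in>carrier R. \<rho> (a \<otimes>\<^bsub>R\<^esub> b) \<le> min (\<rho> a) (\<rho> b)) \<and>
     (\<forall>e\<in>idempotents R. \<forall>f\<in>idempotents R.
        e \<otimes>\<^bsub>R\<^esub> f = \<zero>\<^bsub>R\<^esub> \<and> f \<otimes>\<^bsub>R\<^esub> e = \<zero>\<^bsub>R\<^esub> \<longrightarrow> \<rho> (e \<oplus>\<^bsub>R\<^esub> f) = \<rho> e + \<rho> f) \<and>
     (\<forall>a\<in>carrier R. a \<noteq> \<zero>\<^bsub>R\<^esub> \<longrightarrow> \<rho> a > 0)"

text \<open>
  The value 0 outside the carrier has no influence on the topology; it is there because
  \<^locale>\<open>Metric_space\<close> demands symmetry and non-negativity on the whole type.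
\<close>

definition rank_dist :: "('a, 'm) ring_scheme \<Rightarrow> ('a \<Rightarrow> real) \<Rightarrow> 'a \<Rightarrow> 'a \<Rightarrow> real" where
  "rank_dist R \<rho> a b =
     (if a \<in> carrier R \<and> b \<in> carrier R then \<rho> (a \<ominus>\<^bsub>R\<^esub> b) else 0)"

definition rank_topology :: "('a, 'm) ring_scheme \<Rightarrow> ('a \<Rightarrow> real) \<Rightarrow> 'a topology" where
  "rank_topology R \<rho> = Metric_space.mtopology (carrier R) (rank_dist R \<rho>)"

section \<open>Nests and envelopes\<close>

definition idem_le :: "('a, 'm) ring_scheme \<Rightarrow> 'a \<Rightarrow> 'a \<Rightarrow> bool" where
  "idem_le R e f \<longleftrightarrow> e \<otimes>\<^bsub>R\<^esub> f = e \<and> f \<otimes>\<^bsub>R\<^esub> e = e"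

abbreviation nest :: "('a, 'm) ring_scheme \<Rightarrow> 'a set \<Rightarrow> bool" where
  "nest R \<equiv> pred_on.chain (idempotents R) (idem_le R)"

abbreviation maximal_nest :: "('a, 'm) ring_scheme \<Rightarrow> 'a set \<Rightarrow> bool" where
  "maximal_nest R \<equiv> pred_on.maxchain (idempotents R) (idem_le R)"

definition nest_subring :: "('a, 'm) ring_scheme \<Rightarrow> 'a set \<Rightarrow> ('a, 'm) ring_scheme" where
  "nest_subring R E =
     R\<lparr>carrier := {a \<in> carrier R. \<forall>e\<in>E. e \<otimes>\<^bsub>R\<^esub> a \<otimes>\<^bsub>R\<^esub> e = a \<otimes>\<^bsub>R\<^esub> e}\<rparr>"

definition envelope :: "('a, 'm) ring_scheme \<Rightarrow> 'a set \<Rightarrow> 'a set \<Rightarrow> 'a set" where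
  "envelope R E G = {a \<in> carrier (nest_subring R E).
     \<exists>(n :: nat) (e :: nat \<Rightarrow> 'a).
       (\<forall>i\<le>n. e i \<in> E \<union> {\<zero>\<^bsub>R\<^esub>, \<one>\<^bsub>R\<^esub>}) \<and>
       e 0 = \<zero>\<^bsub>R\<^esub> \<and> e n = \<one>\<^bsub>R\<^esub> \<and> (\<forall>i<n. idem_le R (e i) (e (Suc i))) \<and>
       (\<forall>i\<in>{1..n}. let d = e i \<ominus>\<^bsub>R\<^esub> e (i - 1) in
          d \<otimes>\<^bsub>R\<^esub> a \<otimes>\<^bsub>R\<^esub> d \<in> (\<lambda>g. d \<otimes>\<^bsub>R\<^esub> g \<otimes>\<^bsub>R\<^esub> d) ` G)}"

section \<open>Amenability\<close>

definition topological_group :: "('g, 'm) monoid_scheme \<Rightarrow> 'g topology \<Rightarrow> bool" where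
  "topological_group G T \<longleftrightarrow> group G \<and> topspace T = carrier G \<and>
     continuous_map (prod_topology T T) T (\<lambda>(g, h). g \<otimes>\<^bsub>G\<^esub> h) \<and>
     continuous_map T T (\<lambda>g. inv\<^bsub>G\<^esub> g)"

definition continuous_action ::
    "('g, 'm) monoid_scheme \<Rightarrow> 'g topology \<Rightarrow> 'x topology \<Rightarrow> ('g \<Rightarrow> 'x \<Rightarrow> 'x) \<Rightarrow> bool" where
  "continuous_action G T X \<phi> \<longleftrightarrow> group_action G (topspace X) \<phi> \<and>
     continuous_map (prod_topology T X) X (\<lambda>(g, x). \<phi> g x)"

definition borel_of :: "'x topology \<Rightarrow> 'x measure" where
  "borel_of X = sigma (topspace X) {U. openin X U}"

definition regular_borel_probability :: "'x topology \<Rightarrow> 'x measure \<Rightarrow> bool" where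
  "regular_borel_probability X M \<longleftrightarrow> prob_space M \<and> sets M = sets (borel_of X) \<and>
     (\<forall>B\<in>sets M.
        emeasure M B = (INF U\<in>{U. openin X U \<and> B \<subseteq> U}. emeasure M U) \<and>
        emeasure M B = (SUP K\<in>{K. compactin X K \<and> K \<subseteq> B}. emeasure M K))"

text \<open>
  A quantifier over all compact Hausdorff spaces cannot range over all types, so the type of
  the points is a parameter of the next two definitions. For amenability of a group of elements
  of type \<^typ>\<open>'g\<close>, the type \<^typ>\<open>'g set set\<close> is large enough: amenability with respect to
  spaces of this type implies amenability with respect to spaces of any other type; see
  \<open>amenable_any_type\<close>.
\<close>

definition amenable :: "'x itself \<Rightarrow> ('g, 'm) monoid_scheme \<Rightarrow> 'g topology \<Rightarrow> bool" where
  "amenable _ G T \<longleftrightarrow> topological_group G T \<and>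
     (\<forall>(X :: 'x topology) \<phi>.
        topspace X \<noteq> {} \<and> compact_space X \<and> Hausdorff_space X \<and> continuous_action G T X \<phi> \<longrightarrow>
        (\<exists>M. regular_borel_probability X M \<and> (\<forall>g\<in>carrier G. distr M M (\<phi> g) = M)))"

definition extremely_amenable ::
    "'x itself \<Rightarrow> ('g, 'm) monoid_scheme \<Rightarrow> 'g topology \<Rightarrow> bool" where
  "extremely_amenable _ G T \<longleftrightarrow> topological_group G T \<and>
     (\<forall>(X :: 'x topology) \<phi>.
        topspace X \<noteq> {} \<and> compact_space X \<and> Hausdorff_space X \<and> continuous_action G T X \<phi> \<longrightarrow>
        (\<exists>x\<in>topspace X. \<forall>g\<in>carrier G. \<phi> g x = x))"

lemma space_borel_of [simp]: "space (borel_of X) = topspace X"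
  unfolding borel_of_def by (rule space_measure_of) (auto dest: openin_subset)

lemma sets_borel_of: "sets (borel_of X) = sigma_sets (topspace X) {U. openin X U}"
  unfolding borel_of_def by (rule sets_measure_of) (auto dest: openin_subset)

lemma openin_borel_of: "openin X U \<Longrightarrow> U \<in> sets (borel_of X)"
  by (simp add: sets_borel_of)

lemma closedin_borel_of:
  assumes "closedin X C" shows "C \<in> sets (borel_of X)"
proof -
  have "topspace X - (topspace X - C) = C" using closedin_subset[OF assms] by auto
  moreover have "topspace X - (topspace X - C) \<in> sets (borel_of X)"
    using assms sets.compl_sets[OF openin_borel_of, of X "topspace X - C"]
    by (simp add: closedin_def)
  ultimately show ?thesis by simp
qed

lemma continuous_map_measurable:
  assumes "continuous_map X Y f" shows "f \<in> borel_of X \<rightarrow>\<^sub>M borel_of Y"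
  unfolding borel_of_def[of Y]
proof (rule measurable_measure_of)
  show "{U. openin Y U} \<subseteq> Pow (topspace Y)" by (auto dest: openin_subset)
  show "f \<in> space (borel_of X) \<rightarrow> topspace Y"
    using assms by (auto simp: continuous_map_def)
next
  fix U assume "U \<in> {U. openin Y U}"
  then have "openin X {x \<in> topspace X. f x \<in> U}" using assms by (auto simp: continuous_map_def)
  moreover have "{x \<in> topspace X. f x \<in> U} = f -` U \<inter> space (borel_of X)" by auto
  ultimately show "f -` U \<inter> space (borel_of X) \<in> sets (borel_of X)"
    by (simp add: openin_borel_of)
qed

lemma closure_of_image_inj:
  assumes "Hausdorff_space X" and f: "\<And>g. g \<in> A \<Longrightarrow> f g \<in> topspace X"
  shows "inj_on (\<lambda>x. {B. B \<subseteq> A \<and> x \<in> X closure_of (f ` B)}) (X closure_of (f ` A))"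
proof (rule inj_onI, rule ccontr)
  fix x y assume x: "x \<in> X closure_of (f ` A)" and y: "y \<in> X closure_of (f ` A)"
    and eq: "{B. B \<subseteq> A \<and> x \<in> X closure_of (f ` B)} = {B. B \<subseteq> A \<and> y \<in> X closure_of (f ` B)}"
    and "x \<noteq> y"
  then obtain U V where UV: "openin X U" "openin X V" "x \<in> U" "y \<in> V" "disjnt U V"
    using assms(1) unfolding Hausdorff_space_def by (meson in_closure_of)
  define B where "B = {g \<in> A. f g \<in> U}"
  have "x \<in> X closure_of (f ` B)"
    unfolding in_closure_of
  proof (intro conjI allI impI)
    show "x \<in> topspace X" using x by (simp add: in_closure_of)
    fix W assume "x \<in> W \<and> openin X W"
    then have "x \<in> U \<inter> W" "openin X (U \<inter> W)" using UV by auto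
    then obtain z where "z \<in> f ` A" "z \<in> U \<inter> W" using x unfolding in_closure_of by blast
    then show "\<exists>y. y \<in> f ` B \<and> y \<in> W" unfolding B_def by auto
  qed
  moreover have "y \<notin> X closure_of (f ` B)"
    using UV unfolding in_closure_of B_def disjnt_def by blast
  moreover have "B \<subseteq> A" by (auto simp: B_def)
  ultimately show False using eq by blast
qed

lemma amenable_any_type:
  fixes G :: "('g, 'm) monoid_scheme"
  assumes am: "amenable TYPE('g set set) G T"
  shows "amenable TYPE('x) G T"
  unfolding amenable_def
proof (intro conjI allI impI)
  show tg: "topological_group G T" using am by (simp add: amenable_def)
  fix X :: "'x topology" and \<phi>
  assume asm: "topspace X \<noteq> {} \<and> compact_space X \<and> Hausdorff_space X \<and> continuous_action G T X \<phi>"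
  then have comp: "compact_space X" and haus: "Hausdorff_space X"
    and act: "group_action G (topspace X) \<phi>"
    and cont: "continuous_map (prod_topology T X) X (\<lambda>(g, x). \<phi> g x)"
    by (auto simp: continuous_action_def)
  interpret group_action G "topspace X" \<phi> by fact
  interpret group G using tg by (simp add: topological_group_def)
  have T: "topspace T = carrier G" using tg by (simp add: topological_group_def)
  obtain x0 where x0: "x0 \<in> topspace X" using asm by blast
  have \<phi>g: "continuous_map X X (\<phi> g)" if "g \<in> carrier G" for g
  proof -
    have "continuous_map X (prod_topology T X) (\<lambda>x. (g, x))"
      using that T by (intro continuous_map_pairedI) auto
    from continuous_map_compose[OF this cont] show ?thesis by (simp add: o_def)
  qed
  define Orb where "Orb = (\<lambda>g. \<phi> g x0) ` carrier G"
  define Y where "Y = X closure_of Orb"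
  have Orb: "Orb \<subseteq> topspace X" using element_image x0 by (auto simp: Orb_def)
  have "Orb \<noteq> {}" by (auto simp: Orb_def)
  then have Yne: "Y \<noteq> {}" using closure_of_subset[OF Orb] unfolding Y_def by auto
  have Ycl: "closedin X Y" by (simp add: Y_def)
  have YX: "Y \<subseteq> topspace X" using Ycl by (rule closedin_subset)
  have inv: "\<phi> g y \<in> Y" if g: "g \<in> carrier G" and "y \<in> Y" for g y
  proof -
    have "\<phi> g ` Orb \<subseteq> Orb"
    proof clarify
      fix z assume "z \<in> Orb"
      then obtain h where h: "h \<in> carrier G" "z = \<phi> h x0" by (auto simp: Orb_def)
      then have "\<phi> g z = \<phi> (g \<otimes>\<^bsub>G\<^esub> h) x0" using composition_rule[OF x0 g h(1)] by simp
      then show "\<phi> g z \<in> Orb" using g h(1) by (auto simp: Orb_def)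
    qed
    then have "\<phi> g ` Y \<subseteq> Y"
      using continuous_map_image_closure_subset[OF \<phi>g[OF g], of Orb] closure_of_mono[of "\<phi> g ` Orb" Orb X]
      unfolding Y_def by blast
    then show ?thesis using \<open>y \<in> Y\<close> by blast
  qed
  define \<iota> where "\<iota> = (\<lambda>x. {B. B \<subseteq> carrier G \<and> x \<in> X closure_of ((\<lambda>g. \<phi> g x0) ` B)})"
  have inj: "inj_on \<iota> Y"
    unfolding \<iota>_def Y_def Orb_def
    by (rule closure_of_image_inj[OF haus]) (use element_image x0 in auto)
  define Z where "Z = \<iota> ` Y"
  define j where "j = inv_into Y \<iota>"
  have ji [simp]: "j (\<iota> y) = y" if "y \<in> Y" for y using inj that by (simp add: j_def)
  have ij [simp]: "\<iota> (j z) = z" if "z \<in> Z" for z using that by (auto simp: Z_def)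
  have jY [simp]: "j z \<in> Y" if "z \<in> Z" for z using that by (auto simp: Z_def)
  have iZ [simp]: "\<iota> y \<in> Z" if "y \<in> Y" for y using that by (auto simp: Z_def)
  define X' where "X' = pullback_topology Z j X"
  have topX' [simp]: "topspace X' = Z"
    using subsetD[OF YX jY] by (auto simp: X'_def topspace_pullback_topology)
  have jcont: "continuous_map X' X j"
    unfolding X'_def using continuous_map_pullback[of X X id Z j] by simp
  have icont: "continuous_map (subtopology X Y) X' \<iota>"
    unfolding X'_def
  proof (rule continuous_map_pullback')
    show "continuous_map (subtopology X Y) X (j \<circ> \<iota>)"
      by (rule continuous_map_eq[of _ _ id]) auto
    show "topspace (subtopology X Y) \<subseteq> \<iota> -` Z" by auto
  qed
  have "homeomorphic_maps (subtopology X Y) X' \<iota> j"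
    unfolding homeomorphic_maps_def using icont jcont by (auto simp: continuous_map_in_subtopology)
  then have homeo: "subtopology X Y homeomorphic_space X'"
    by (auto simp: homeomorphic_space_def)
  have comp': "compact_space X'"
    using homeomorphic_compact_space[OF homeo] closedin_compact_space[OF comp Ycl]
    by (simp add: compact_space_subtopology)
  have haus': "Hausdorff_space X'"
    using homeomorphic_Hausdorff_space[OF homeo] haus by (simp add: Hausdorff_space_subtopology)
  define \<psi> where "\<psi> = (\<lambda>g. \<lambda>z\<in>Z. \<iota> (\<phi> g (j z)))"
  have mul: "\<psi> (g \<otimes>\<^bsub>G\<^esub> h) z = \<psi> g (\<psi> h z)" if "g \<in> carrier G" "h \<in> carrier G" "z \<in> Z" for g h z
  proof -
    have "j z \<in> topspace X" using subsetD[OF YX jY] that by blast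
    then show ?thesis using that composition_rule[of "j z" g h] inv by (simp add: \<psi>_def)
  qed
  have \<psi>Z: "\<psi> g z \<in> Z" if "g \<in> carrier G" "z \<in> Z" for g z
    using that inv by (simp add: \<psi>_def)
  have \<psi>1: "\<psi> \<one>\<^bsub>G\<^esub> z = z" if "z \<in> Z" for z
  proof -
    have "\<phi> \<one>\<^bsub>G\<^esub> (j z) = j z" using id_eq_one that YX jY[OF that] by (metis restrict_apply' subsetD)
    then show ?thesis using that by (simp add: \<psi>_def)
  qed
  have \<psi>Bij: "\<psi> g \<in> Bij Z" if g: "g \<in> carrier G" for g
  proof -
    have "bij_betw (\<psi> g) Z Z"
    proof (rule bij_betw_byWitness[where f' = "\<psi> (inv\<^bsub>G\<^esub> g)"])
      show "\<forall>a\<in>Z. \<psi> (inv\<^bsub>G\<^esub> g) (\<psi> g a) = a"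
        using g mul[of "inv\<^bsub>G\<^esub> g" g] \<psi>1 by auto
      show "\<forall>a\<in>Z. \<psi> g (\<psi> (inv\<^bsub>G\<^esub> g) a) = a"
        using g mul[of g "inv\<^bsub>G\<^esub> g"] \<psi>1 by auto
    qed (use \<psi>Z g in auto)
    then show ?thesis by (simp add: Bij_def \<psi>_def)
  qed
  have "\<psi> \<in> hom G (BijGroup Z)"
  proof (rule homI)
    show "\<psi> g \<in> carrier (BijGroup Z)" if "g \<in> carrier G" for g
      using \<psi>Bij[OF that] by (simp add: BijGroup_def)
    show "\<psi> (g \<otimes>\<^bsub>G\<^esub> h) = \<psi> g \<otimes>\<^bsub>BijGroup Z\<^esub> \<psi> h" if "g \<in> carrier G" "h \<in> carrier G" for g h
    proof -
      have "\<psi> (g \<otimes>\<^bsub>G\<^esub> h) = compose Z (\<psi> g) (\<psi> h)"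
      proof
        fix z show "\<psi> (g \<otimes>\<^bsub>G\<^esub> h) z = compose Z (\<psi> g) (\<psi> h) z"
        proof (cases "z \<in> Z")
          case True then show ?thesis using mul[OF that] by (simp add: compose_def)
        next
          case False then show ?thesis by (simp add: compose_def \<psi>_def)
        qed
      qed
      then show ?thesis using \<psi>Bij that by (simp add: BijGroup_def)
    qed
  qed
  then have gact: "group_action G (topspace X') \<psi>"
    unfolding group_action_def group_hom_def group_hom_axioms_def
    by (simp add: group_BijGroup is_group)
  have "continuous_map (prod_topology T X') X' (\<lambda>(g, z). \<psi> g z)"
    unfolding X'_def
  proof (rule continuous_map_pullback', fold X'_def)
    have *: "continuous_map (prod_topology T X') (prod_topology T X) (\<lambda>p. (fst p, j (snd p)))"
      using continuous_map_compose[OF continuous_map_snd jcont, of T]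
      by (intro continuous_map_pairedI continuous_map_fst) (simp add: o_def)
    show "continuous_map (prod_topology T X') X (j \<circ> (\<lambda>(g, z). \<psi> g z))"
      by (rule continuous_map_eq[OF continuous_map_compose[OF * cont]])
        (use T inv in \<open>auto simp: \<psi>_def\<close>)
    show "topspace (prod_topology T X') \<subseteq> (\<lambda>(g, z). \<psi> g z) -` Z" using T \<psi>Z by auto
  qed
  with gact have "continuous_action G T X' \<psi>" by (simp add: continuous_action_def)
  moreover have "topspace X' \<noteq> {}" using Yne by (simp add: Z_def)
  ultimately obtain M' where M': "regular_borel_probability X' M'"
    and M'inv: "\<And>g. g \<in> carrier G \<Longrightarrow> distr M' M' (\<psi> g) = M'"
    using am comp' haus' unfolding amenable_def by blast
  have setsM': "sets M' = sets (borel_of X')" and prob': "prob_space M'"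
    using M' by (auto simp: regular_borel_probability_def)
  have spM' [simp]: "space M' = Z" using sets_eq_imp_space_eq[OF setsM'] by simp
  have jm: "j \<in> M' \<rightarrow>\<^sub>M borel_of X"
    using continuous_map_measurable[OF jcont] measurable_cong_sets[OF setsM' refl] by blast
  define M where "M = distr M' (borel_of X) j"
  have setsM: "sets M = sets (borel_of X)" by (simp add: M_def)
  have spM [simp]: "space M = topspace X" by (simp add: M_def)
  have em: "emeasure M B = emeasure M' (j -` B \<inter> Z)" if "B \<in> sets (borel_of X)" for B
    unfolding M_def using emeasure_distr[OF jm that] by simp
  have probM: "prob_space M" unfolding M_def by (rule prob_space.prob_space_distr[OF prob' jm])
  have reg: "emeasure M B = (INF U\<in>{U. openin X U \<and> B \<subseteq> U}. emeasure M U) \<and>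
             emeasure M B = (SUP K\<in>{K. compactin X K \<and> K \<subseteq> B}. emeasure M K)"
    if B: "B \<in> sets M" for B
  proof
    have Bb: "B \<in> sets (borel_of X)" using B setsM by simp
    have B': "j -` B \<inter> Z \<in> sets M'" using measurable_sets[OF jm Bb] by simp
    have outer': "emeasure M' (j -` B \<inter> Z) =
        (INF U\<in>{U. openin X' U \<and> j -` B \<inter> Z \<subseteq> U}. emeasure M' U)"
      and inner': "emeasure M' (j -` B \<inter> Z) =
        (SUP K\<in>{K. compactin X' K \<and> K \<subseteq> j -` B \<inter> Z}. emeasure M' K)"
      using M' B' unfolding regular_borel_probability_def by blast+
    show "emeasure M B = (INF U\<in>{U. openin X U \<and> B \<subseteq> U}. emeasure M U)"
    proof (rule antisym)
      show "emeasure M B \<le> (INF U\<in>{U. openin X U \<and> B \<subseteq> U}. emeasure M U)"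
        by (rule INF_greatest) (auto intro!: emeasure_mono simp: setsM openin_borel_of)
      show "(INF U\<in>{U. openin X U \<and> B \<subseteq> U}. emeasure M U) \<le> emeasure M B"
        unfolding em[OF Bb] outer'
      proof (rule INF_greatest)
        fix U' assume "U' \<in> {U. openin X' U \<and> j -` B \<inter> Z \<subseteq> U}"
        then obtain U where U: "openin X U" "U' = j -` U \<inter> Z" "j -` B \<inter> Z \<subseteq> U'"
          by (auto simp: X'_def openin_pullback_topology)
        define V where "V = U \<union> (topspace X - Y)"
        have V: "openin X V" using U(1) Ycl by (auto simp: V_def closedin_def)
        have "B \<subseteq> V"
        proof
          fix b assume b: "b \<in> B"
          then have bX: "b \<in> topspace X" using sets.sets_into_space[OF B] by auto
          show "b \<in> V"
          proof (cases "b \<in> Y")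
            case True
            then have "\<iota> b \<in> j -` B \<inter> Z" using b by simp
            then have "\<iota> b \<in> U'" using U(3) by blast
            then have "b \<in> U" using True U(2) by simp
            then show ?thesis by (simp add: V_def)
          next
            case False then show ?thesis using bX by (simp add: V_def)
          qed
        qed
        moreover have "emeasure M V = emeasure M' U'"
        proof -
          have "j -` V \<inter> Z = U'" using U(2) by (auto simp: V_def)
          then show ?thesis using em[OF openin_borel_of[OF V]] by simp
        qed
        ultimately show "(INF U\<in>{U. openin X U \<and> B \<subseteq> U}. emeasure M U) \<le> emeasure M' U'"
          using V by (metis (mono_tags, lifting) INF_lower mem_Collect_eq)
      qed
    qed
    show "emeasure M B = (SUP K\<in>{K. compactin X K \<and> K \<subseteq> B}. emeasure M K)"
    proof (rule antisym)
      show "(SUP K\<in>{K. compactin X K \<and> K \<subseteq> B}. emeasure M K) \<le> emeasure M B"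
        by (rule SUP_least) (auto intro!: emeasure_mono simp: B)
      show "emeasure M B \<le> (SUP K\<in>{K. compactin X K \<and> K \<subseteq> B}. emeasure M K)"
        unfolding em[OF Bb] inner'
      proof (rule SUP_least)
        fix K' assume "K' \<in> {K. compactin X' K \<and> K \<subseteq> j -` B \<inter> Z}"
        then have K': "compactin X' K'" "K' \<subseteq> j -` B \<inter> Z" by auto
        have K: "compactin X (j ` K')" using image_compactin[OF K'(1) jcont] .
        then have Kb: "j ` K' \<in> sets (borel_of X)"
          using compactin_imp_closedin[OF haus] closedin_borel_of by blast
        have "j -` (j ` K') \<inter> Z = K'"
        proof (intro equalityI subsetI)
          fix z assume "z \<in> j -` (j ` K') \<inter> Z"
          then obtain k where "k \<in> K'" "j z = j k" "z \<in> Z" by auto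
          then have "z = k" using K'(2) ij by (metis IntD2 subsetD)
          then show "z \<in> K'" using \<open>k \<in> K'\<close> by simp
        qed (use K' in auto)
        then have "emeasure M (j ` K') = emeasure M' K'" using em[OF Kb] by simp
        moreover have "j ` K' \<in> {K. compactin X K \<and> K \<subseteq> B}" using K K'(2) by auto
        ultimately show "emeasure M' K' \<le> (SUP K\<in>{K. compactin X K \<and> K \<subseteq> B}. emeasure M K)"
          by (metis (no_types, lifting) SUP_upper)
      qed
    qed
  qed
  have "distr M M (\<phi> g) = M" if g: "g \<in> carrier G" for g
  proof -
    have m1: "\<phi> g \<in> borel_of X \<rightarrow>\<^sub>M borel_of X" by (rule continuous_map_measurable[OF \<phi>g[OF g]])
    have "continuous_map X' X' (\<psi> g)"
      unfolding X'_def
    proof (rule continuous_map_pullback', fold X'_def)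
      show "continuous_map X' X (j \<circ> \<psi> g)"
        by (rule continuous_map_eq[OF continuous_map_compose[OF jcont \<phi>g[OF g]]])
          (use g inv in \<open>auto simp: \<psi>_def\<close>)
      show "topspace X' \<subseteq> \<psi> g -` Z" using \<psi>Z g by auto
    qed
    from continuous_map_measurable[OF this]
    have m2: "\<psi> g \<in> M' \<rightarrow>\<^sub>M M'" using measurable_cong_sets[OF setsM' setsM'] by blast
    have "distr M M (\<phi> g) = distr M (borel_of X) (\<phi> g)"
      by (rule distr_cong) (auto simp: setsM)
    also have "\<dots> = distr M' (borel_of X) (\<phi> g \<circ> j)"
      unfolding M_def by (rule distr_distr[OF m1 jm])
    also have "\<dots> = distr M' (borel_of X) (j \<circ> \<psi> g)"
      by (rule distr_cong) (use g inv in \<open>auto simp: \<psi>_def\<close>)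
    also have "\<dots> = distr (distr M' M' (\<psi> g)) (borel_of X) j"
      by (rule distr_distr[OF jm m2, symmetric])
    also have "\<dots> = M" using M'inv[OF g] by (simp add: M_def)
    finally show ?thesis .
  qed
  moreover have "regular_borel_probability X M"
    unfolding regular_borel_probability_def using probM setsM reg by blast
  ultimately show "\<exists>M. regular_borel_probability X M \<and> (\<forall>g\<in>carrier G. distr M M (\<phi> g) = M)"
    by blast
qed

end

theory Submission
  imports Defs
begin

text \<open>
  A group with a bi-invariant metric is extremely amenable if every finite subset lies in a
  subgroup with an invariant mean for which 1-Lipschitz functions have arbitrarily small
  variance. Let \<open>0 = e\<^sub>0 \<le> \<dots> \<le> e\<^sub>n = 1\<close> be a partition in the nest with differences
  \<open>d\<^sub>k = e\<^sub>k\<^sub>+\<^sub>1 - e\<^sub>k\<close>. The elements of the envelope with all diagonal blocks in \<open>d\<^sub>k G d\<^sub>k\<close>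
  form an iterated semidirect product of the groups \<open>1 - d\<^sub>k + d\<^sub>k G d\<^sub>k\<close>, which are images of the
  amenable group \<open>G\<close>, and the commutative groups \<open>1 + e\<^sub>k R d\<^sub>k\<close>. Both kinds have invariant means and
  lie within distance \<open>\<rho>(d\<^sub>k)\<close> of the identity, so composing the means gives variance at most
  \<open>2 \<Sum>\<^sub>k \<rho>(d\<^sub>k)\<^sup>2 \<le> 2 max\<^sub>k \<rho>(d\<^sub>k)\<close>. This tends to zero along fine partitions, which exist
  because \<open>\<rho>\<close> maps a maximal nest onto \<open>[0, 1]\<close>: the rank is continuous along chains of idempotents,
  and a non-discrete, irreducible ring leaves no room for gaps in a maximal nest.
\<close>

section \<open>Concentration in groups with a bi-invariant metric\<close>

text \<open>Concentration is usually expressed by Haar measures on finite or compact subgroups.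
  Nothing of the kind is at hand: \<open>G\<close> is merely amenable, and the commutative groups
  carry no compact topology. Invariant means on bounded Lipschitz functions replace the measures;
  they compose along a normal series just as well. What matters is that variances add up under
  composition: the ranks of the blocks always sum to 1, so a bound by the sum of the distances would
  gain nothing from refinement, whereas the sum of their squares becomes small. The factor 2 counts
  the two groups met at each block. The other obstacle is the rank. It is assumed additive on
  orthogonal pairs of idempotents only, and that it does not jump at the supremum of an infinite
  chain has to be derived from the continuity of the lattice. This is done by comparing right ideals
  through graphs of isomorphisms, for which irreducibility supplies the maps.\<close>

locale biinvariant_metric_group = group G + Metric_space "carrier G" d
  for G (structure) and d :: "'a \<Rightarrow> 'a \<Rightarrow> real" +
  assumes dist_left: "\<lbrakk>x \<in> carrier G; y \<in> carrier G; z \<in> carrier G\<rbrakk> \<Longrightarrow> d (z \<otimes> x) (z \<otimes> y) = d x y"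
    and dist_right: "\<lbrakk>x \<in> carrier G; y \<in> carrier G; z \<in> carrier G\<rbrakk> \<Longrightarrow> d (x \<otimes> z) (y \<otimes> z) = d x y"
begin

definition lipschitz_bound :: "real \<Rightarrow> ('a \<Rightarrow> real) \<Rightarrow> bool" where
  "lipschitz_bound L v \<longleftrightarrow> L \<ge> 0 \<and> (\<forall>x\<in>carrier G. \<forall>y\<in>carrier G. \<bar>v x - v y\<bar> \<le> L * d x y)"

text \<open>The Lipschitz constant is left open so that squares stay in the class: variances have to
  be expressible inside it. Both conditions concern the carrier only, while the functions live on
  the whole type.\<close>

definition bounded_lipschitz :: "('a \<Rightarrow> real) set" where
  "bounded_lipschitz = {v. (\<exists>L. lipschitz_bound L v) \<and> (\<exists>b. \<forall>x\<in>carrier G. \<bar>v x\<bar> \<le> b)}"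

abbreviation "V \<equiv> bounded_lipschitz"

text \<open>The functional takes functions of the whole group, but positivity is tested on
  \<open>A\<close> alone. Thus the means for all subgroups live on one function space, and functions
  of \<open>V\<close> agreeing on \<open>A\<close> get the same value. Outside \<open>V\<close> the
  functional is arbitrary.\<close>

definition mean_on :: "'a set \<Rightarrow> (('a \<Rightarrow> real) \<Rightarrow> real) \<Rightarrow> bool" where
  "mean_on A m \<longleftrightarrow>
     (\<forall>v\<in>V. \<forall>w\<in>V. m (\<lambda>x. v x + w x) = m v + m w) \<and>
     (\<forall>v\<in>V. \<forall>c. m (\<lambda>x. c * v x) = c * m v) \<and>
     (\<forall>v\<in>V. (\<forall>x\<in>A. 0 \<le> v x) \<longrightarrow> 0 \<le> m v) \<and> m (\<lambda>_. 1) = 1"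

definition left_invariant :: "'a set \<Rightarrow> (('a \<Rightarrow> real) \<Rightarrow> real) \<Rightarrow> bool" where
  "left_invariant A m \<longleftrightarrow> (\<forall>a\<in>A. \<forall>v\<in>V. m (\<lambda>x. v (a \<otimes> x)) = m v)"

text \<open>The number \<open>s\<close> bounds the variance of 1-Lipschitz functions; the form with
  \<open>L\<close> spares a rescaling in every application.\<close>

definition concentrated :: "'a set \<Rightarrow> real \<Rightarrow> bool" where
  "concentrated A s \<longleftrightarrow> (\<exists>m. mean_on A m \<and> left_invariant A m \<and>
     (\<forall>L v. v \<in> V \<longrightarrow> lipschitz_bound L v \<longrightarrow> m (\<lambda>x. (v x)\<^sup>2) - (m v)\<^sup>2 \<le> L\<^sup>2 * s))"

section \<open>Closure properties of bounded Lipschitz functions\<close>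

lemma lipschitz_boundD:
  "\<lbrakk>lipschitz_bound L v; x \<in> carrier G; y \<in> carrier G\<rbrakk> \<Longrightarrow> \<bar>v x - v y\<bar> \<le> L * d x y"
  by (auto simp: lipschitz_bound_def)

lemma bounded_lipschitzE:
  assumes "v \<in> V"
  obtains L b where "lipschitz_bound L v" "b \<ge> 0" "\<forall>x\<in>carrier G. \<bar>v x\<bar> \<le> b"
proof -
  obtain L b where L: "lipschitz_bound L v" and b: "\<And>x. x \<in> carrier G \<Longrightarrow> \<bar>v x\<bar> \<le> b"
    using assms by (auto simp: bounded_lipschitz_def)
  have "b \<ge> 0" using b[OF one_closed] by linarith
  then show thesis using that L b by blast
qed

lemma bounded_lipschitzI:
  assumes "L \<ge> 0" "\<And>x y. \<lbrakk>x \<in> carrier G; y \<in> carrier G\<rbrakk> \<Longrightarrow> \<bar>v x - v y\<bar> \<le> L * d x y"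
    and "\<And>x. x \<in> carrier G \<Longrightarrow> \<bar>v x\<bar> \<le> b"
  shows "v \<in> V"
  using assms by (auto simp: bounded_lipschitz_def lipschitz_bound_def)

lemma bounded_lipschitz_const [simp]: "(\<lambda>_. c) \<in> V"
  by (rule bounded_lipschitzI[of 0 _ "\<bar>c\<bar>"]) auto

lemma bounded_lipschitz_add:
  assumes "v \<in> V" "w \<in> V" shows "(\<lambda>x. v x + w x) \<in> V"
proof -
  obtain L b where L: "lipschitz_bound L v" "b \<ge> 0" "\<forall>x\<in>carrier G. \<bar>v x\<bar> \<le> b"
    using bounded_lipschitzE[OF assms(1)] .
  obtain K c where K: "lipschitz_bound K w" "c \<ge> 0" "\<forall>x\<in>carrier G. \<bar>w x\<bar> \<le> c"
    using bounded_lipschitzE[OF assms(2)] .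
  show ?thesis
  proof (rule bounded_lipschitzI[of "L + K" _ "b + c"])
    show "0 \<le> L + K" using L(1) K(1) by (simp add: lipschitz_bound_def)
    fix x y assume xy: "x \<in> carrier G" "y \<in> carrier G"
    have "\<bar>v x - v y\<bar> \<le> L * d x y" "\<bar>w x - w y\<bar> \<le> K * d x y"
      using lipschitz_boundD xy L K by blast+
    then show "\<bar>v x + w x - (v y + w y)\<bar> \<le> (L + K) * d x y"
      unfolding distrib_right by linarith
  next
    fix x assume "x \<in> carrier G"
    then have "\<bar>v x\<bar> \<le> b" "\<bar>w x\<bar> \<le> c" using L K by blast+
    then show "\<bar>v x + w x\<bar> \<le> b + c" by linarith
  qed
qed

lemma bounded_lipschitz_mult:
  assumes "v \<in> V" "w \<in> V" shows "(\<lambda>x. v x * w x) \<in> V"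
proof -
  obtain L b where L: "lipschitz_bound L v" "b \<ge> 0" "\<forall>x\<in>carrier G. \<bar>v x\<bar> \<le> b"
    using bounded_lipschitzE[OF assms(1)] .
  obtain K c where K: "lipschitz_bound K w" "c \<ge> 0" "\<forall>x\<in>carrier G. \<bar>w x\<bar> \<le> c"
    using bounded_lipschitzE[OF assms(2)] .
  show ?thesis
  proof (rule bounded_lipschitzI[of "b * K + c * L" _ "b * c"])
    show "0 \<le> b * K + c * L" using L(1,2) K(1,2) by (simp add: lipschitz_bound_def)
    fix x y assume xy: "x \<in> carrier G" "y \<in> carrier G"
    have 1: "\<bar>v x - v y\<bar> \<le> L * d x y" "\<bar>w x - w y\<bar> \<le> K * d x y"
      using lipschitz_boundD xy L K by blast+
    have "v x * w x - v y * w y = v x * (w x - w y) + w y * (v x - v y)"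
      by (simp add: algebra_simps)
    then have "\<bar>v x * w x - v y * w y\<bar> \<le> \<bar>v x\<bar> * \<bar>w x - w y\<bar> + \<bar>w y\<bar> * \<bar>v x - v y\<bar>"
      by (metis abs_mult abs_triangle_ineq)
    also have "\<dots> \<le> b * (K * d x y) + c * (L * d x y)"
      using 1 L K xy by (intro add_mono mult_mono) auto
    finally show "\<bar>v x * w x - v y * w y\<bar> \<le> (b * K + c * L) * d x y"
      by (simp add: algebra_simps)
  next
    fix x assume "x \<in> carrier G"
    then show "\<bar>v x * w x\<bar> \<le> b * c" using L K by (simp add: abs_mult mult_mono)
  qed
qed

lemma bounded_lipschitz_scale: "v \<in> V \<Longrightarrow> (\<lambda>x. c * v x) \<in> V"
  by (rule bounded_lipschitz_mult) auto

lemma bounded_lipschitz_diff: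
  assumes "v \<in> V" "w \<in> V" shows "(\<lambda>x. v x - w x) \<in> V"
  using bounded_lipschitz_add[OF assms(1) bounded_lipschitz_scale[OF assms(2), of "-1"]] by simp

lemma bounded_lipschitz_power2: "v \<in> V \<Longrightarrow> (\<lambda>x. (v x)\<^sup>2) \<in> V"
  unfolding power2_eq_square by (rule bounded_lipschitz_mult)

lemma bounded_lipschitz_sum:
  assumes "finite I" "\<And>i. i \<in> I \<Longrightarrow> v i \<in> V" shows "(\<lambda>x. \<Sum>i\<in>I. v i x) \<in> V"
  using assms by (induction rule: finite_induct) (auto intro: bounded_lipschitz_add)

lemma lipschitz_bound_left:
  "\<lbrakk>lipschitz_bound L v; a \<in> carrier G\<rbrakk> \<Longrightarrow> lipschitz_bound L (\<lambda>x. v (a \<otimes> x))"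
  unfolding lipschitz_bound_def by (metis dist_left m_closed)

lemma bounded_lipschitz_left:
  assumes "v \<in> V" "a \<in> carrier G" shows "(\<lambda>x. v (a \<otimes> x)) \<in> V"
  using assms lipschitz_bound_left unfolding bounded_lipschitz_def
  by clarsimp (metis m_closed)

section \<open>Calculus of means\<close>

context
  fixes A m assumes m: "mean_on A m"
begin

lemma mean_add: "\<lbrakk>v \<in> V; w \<in> V\<rbrakk> \<Longrightarrow> m (\<lambda>x. v x + w x) = m v + m w"
  and mean_scale: "v \<in> V \<Longrightarrow> m (\<lambda>x. c * v x) = c * m v"
  and mean_nonneg: "\<lbrakk>v \<in> V; \<And>x. x \<in> A \<Longrightarrow> 0 \<le> v x\<rbrakk> \<Longrightarrow> 0 \<le> m v"
  and mean_one: "m (\<lambda>_. 1) = 1"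
  using m by (auto simp: mean_on_def)

lemma mean_const: "m (\<lambda>_. c) = c"
  using mean_scale[of "\<lambda>_. 1" c] mean_one by simp

lemma mean_diff: "\<lbrakk>v \<in> V; w \<in> V\<rbrakk> \<Longrightarrow> m (\<lambda>x. v x - w x) = m v - m w"
  using mean_add[of v "\<lambda>x. -1 * w x"] mean_scale[of w "-1"] bounded_lipschitz_scale[of w "-1"] by simp

lemma mean_mono:
  assumes "v \<in> V" "w \<in> V" "\<And>x. x \<in> A \<Longrightarrow> v x \<le> w x" shows "m v \<le> m w"
  using mean_nonneg[OF bounded_lipschitz_diff[OF assms(2,1)]] mean_diff[OF assms(2,1)] assms(3) by simp

lemma mean_cong:
  assumes "v \<in> V" "w \<in> V" "\<And>x. x \<in> A \<Longrightarrow> v x = w x" shows "m v = m w"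
  by (rule antisym; rule mean_mono) (use assms in auto)

lemma mean_abs_le:
  assumes "v \<in> V" "\<And>x. x \<in> A \<Longrightarrow> \<bar>v x\<bar> \<le> b" shows "\<bar>m v\<bar> \<le> b"
proof -
  have "m v \<le> m (\<lambda>_. b)" "m (\<lambda>_. -b) \<le> m v"
    by (rule mean_mono; use assms in \<open>force simp: abs_le_iff\<close>)+
  then show ?thesis by (simp add: mean_const abs_le_iff)
qed

lemma mean_sum:
  assumes "finite I" "\<And>i. i \<in> I \<Longrightarrow> v i \<in> V"
  shows "m (\<lambda>x. \<Sum>i\<in>I. v i x) = (\<Sum>i\<in>I. m (v i))"
  using assms
  by (induction rule: finite_induct) (simp_all add: mean_const mean_add bounded_lipschitz_sum)

text \<open>The shift identity for the variance. With \<open>c = m v\<close> it turns the variance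
  into a mean square deviation; with any other \<open>c\<close> it shows that the variance is at
  most the mean square deviation from \<open>c\<close>.\<close>

lemma mean_square_deviation:
  assumes "v \<in> V" shows "m (\<lambda>x. (v x - c)\<^sup>2) = m (\<lambda>x. (v x)\<^sup>2) - (m v)\<^sup>2 + (m v - c)\<^sup>2"
proof -
  have eq: "(\<lambda>x. (v x - c)\<^sup>2) = (\<lambda>x. ((v x)\<^sup>2 + (-2 * c) * v x) + c\<^sup>2)"
    by (auto simp: power2_eq_square algebra_simps)
  note sq = bounded_lipschitz_power2[OF assms]
  note lin = bounded_lipschitz_scale[OF assms, of "-2 * c"]
  have "m (\<lambda>x. (v x - c)\<^sup>2) = m (\<lambda>x. (v x)\<^sup>2) + (-2 * c) * m v + c\<^sup>2"
    unfolding eq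
    using mean_add[OF bounded_lipschitz_add[OF sq lin] bounded_lipschitz_const] mean_add[OF sq lin]
      mean_scale[OF assms] mean_const by metis
  then show ?thesis by (simp add: power2_eq_square algebra_simps)
qed

end

lemma mean_eval: "a \<in> A \<Longrightarrow> mean_on A (\<lambda>v. v a)"
  by (auto simp: mean_on_def)

section \<open>Composition of means\<close>

lemma concentrated_one: "concentrated {\<one>} 0"
  unfolding concentrated_def
  by (intro exI[of _ "\<lambda>v. v \<one>"]) (auto simp: mean_eval left_invariant_def)

text \<open>Averaging over \<open>B\<close> and then over \<open>A\<close>, the law of total variance bounds the variance by the
  one over \<open>B\<close> plus the squared oscillation on \<open>A\<close> of the averages over the cosets \<open>aB\<close>.\<close>

lemma concentrated_set_mult:
  assumes A: "A \<subseteq> carrier G" "\<one> \<in> A" and B: "B \<subseteq> carrier G"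
    and conj: "\<And>a b. \<lbrakk>a \<in> A; b \<in> B\<rbrakk> \<Longrightarrow> inv a \<otimes> b \<otimes> a \<in> B"
    and m: "mean_on A m" "left_invariant A m"
    and diam: "\<And>a. a \<in> A \<Longrightarrow> d a \<one> \<le> c"
    and conc: "concentrated B s"
  shows "concentrated (A <#> B) (s + c\<^sup>2)"
proof -
  obtain M where M: "mean_on B M" and Minv: "left_invariant B M"
    and Mvar: "\<And>L v. \<lbrakk>v \<in> V; lipschitz_bound L v\<rbrakk> \<Longrightarrow> M (\<lambda>x. (v x)\<^sup>2) - (M v)\<^sup>2 \<le> L\<^sup>2 * s"
    using conc unfolding concentrated_def by blast
  \<comment> \<open>\<open>T v x\<close> averages \<open>v\<close> over the coset of
    \<open>B\<close> at \<open>x\<close>, for every \<open>x\<close> of the group. Right invariance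
    of the metric lets \<open>T v\<close> inherit the Lipschitz bounds of \<open>v\<close>, so that
    \<open>m\<close> may be applied to it.\<close>
  define T where "T v x = M (\<lambda>b. v (x \<otimes> b))" for v x
  note left = bounded_lipschitz_left
  have T_lip: "lipschitz_bound L (T v)" if v: "v \<in> V" "lipschitz_bound L v" for L v
    unfolding lipschitz_bound_def
  proof (intro conjI ballI)
    show "0 \<le> L" using v(2) by (simp add: lipschitz_bound_def)
    fix x y assume xy: "x \<in> carrier G" "y \<in> carrier G"
    have "T v x - T v y = M (\<lambda>b. v (x \<otimes> b) - v (y \<otimes> b))"
      unfolding T_def using mean_diff[OF M] left v xy by simp
    moreover have "\<bar>M (\<lambda>b. v (x \<otimes> b) - v (y \<otimes> b))\<bar> \<le> L * d x y"
    proof (rule mean_abs_le[OF M])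
      show "(\<lambda>b. v (x \<otimes> b) - v (y \<otimes> b)) \<in> V"
        using bounded_lipschitz_diff left v(1) xy by simp
      fix b assume "b \<in> B"
      then have b: "b \<in> carrier G" using B by blast
      show "\<bar>v (x \<otimes> b) - v (y \<otimes> b)\<bar> \<le> L * d x y"
        using lipschitz_boundD[OF v(2), of "x \<otimes> b" "y \<otimes> b"] xy b by (simp add: dist_right)
    qed
    ultimately show "\<bar>T v x - T v y\<bar> \<le> L * d x y" by simp
  qed
  have T_V: "T v \<in> V" if v: "v \<in> V" for v
  proof -
    obtain L b where L: "lipschitz_bound L v" "b \<ge> 0" "\<forall>x\<in>carrier G. \<bar>v x\<bar> \<le> b"
      using bounded_lipschitzE[OF v] .
    have "\<bar>T v x\<bar> \<le> b" if "x \<in> carrier G" for x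
      unfolding T_def by (rule mean_abs_le[OF M]) (use left v that L(3) B in auto)
    then show ?thesis using T_lip[OF v L(1)] by (auto simp: bounded_lipschitz_def)
  qed
  define N where "N v = m (T v)" for v
  have N: "mean_on (A <#> B) N"
    unfolding mean_on_def
  proof (intro conjI ballI allI impI)
    fix v w assume vw: "v \<in> V" "w \<in> V"
    show "N (\<lambda>x. v x + w x) = N v + N w"
      unfolding N_def mean_add[OF m(1) T_V T_V, OF vw, symmetric]
    proof (rule mean_cong[OF m(1)])
      show "T (\<lambda>x. v x + w x) \<in> V" "(\<lambda>x. T v x + T w x) \<in> V"
        using vw by (auto intro!: T_V bounded_lipschitz_add)
      fix x assume "x \<in> A"
      then show "T (\<lambda>x. v x + w x) x = T v x + T w x"
        unfolding T_def using mean_add[OF M left left, OF vw(1) _ vw(2)] A by blast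
    qed
  next
    fix v c assume v: "v \<in> V"
    show "N (\<lambda>x. c * v x) = c * N v"
      unfolding N_def mean_scale[OF m(1) T_V, OF v, symmetric]
    proof (rule mean_cong[OF m(1)])
      show "T (\<lambda>x. c * v x) \<in> V" "(\<lambda>x. c * T v x) \<in> V"
        using v by (auto intro!: T_V bounded_lipschitz_scale)
      fix x assume "x \<in> A"
      then show "T (\<lambda>x. c * v x) x = c * T v x"
        unfolding T_def using mean_scale[OF M left, OF v] A by blast
    qed
  next
    fix v assume v: "v \<in> V" and pos: "\<forall>x\<in>A <#> B. 0 \<le> v x"
    show "0 \<le> N v"
      unfolding N_def
    proof (rule mean_nonneg[OF m(1) T_V[OF v]])
      fix a assume a: "a \<in> A"
      show "0 \<le> T v a"
        unfolding T_def
        by (rule mean_nonneg[OF M left[OF v]]) (use a A pos in \<open>auto simp: set_mult_def\<close>)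
    qed
  next
    show "N (\<lambda>_. 1) = 1" by (simp add: N_def T_def[abs_def] mean_const[OF M] mean_const[OF m(1)])
  qed
  have inv: "left_invariant (A <#> B) N"
    unfolding left_invariant_def
  proof (intro ballI)
    fix c v assume "c \<in> A <#> B" and v: "v \<in> V"
    then obtain a b where c: "c = a \<otimes> b" and a: "a \<in> A" and b: "b \<in> B" by (auto simp: set_mult_def)
    have aG: "a \<in> carrier G" and bG: "b \<in> carrier G" using a b A B by auto
    define v' where "v' = (\<lambda>x. v (a \<otimes> x))"
    have v': "v' \<in> V" unfolding v'_def by (rule left[OF v aG])
    have "N (\<lambda>x. v (c \<otimes> x)) = m (T v')"
      unfolding N_def
    proof (rule mean_cong[OF m(1) T_V T_V])
      show "(\<lambda>x. v (c \<otimes> x)) \<in> V" using left v aG bG c by simp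
      show "v' \<in> V" by fact
      fix x assume x: "x \<in> A"
      then have xG: "x \<in> carrier G" using A by auto
      \<comment> \<open>The factor \<open>b\<close> on the left of \<open>x\<close> becomes
        \<open>b'\<close> on its right, where the invariance of \<open>M\<close> under
        \<open>B\<close> absorbs it. The remaining factor \<open>a\<close> is absorbed by the
        invariance of \<open>m\<close>.\<close>
      define b' where "b' = inv x \<otimes> b \<otimes> x"
      have b': "b' \<in> B" unfolding b'_def by (rule conj[OF x b])
      then have b'G: "b' \<in> carrier G" using B by auto
      have xb: "x \<otimes> b' = b \<otimes> x" using xG bG by (simp add: b'_def m_assoc[symmetric])
      have "T (\<lambda>x. v (c \<otimes> x)) x = M (\<lambda>y. v' (x \<otimes> (b' \<otimes> y)))"
        unfolding T_def
      proof (rule mean_cong[OF M])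
        show "(\<lambda>y. v (c \<otimes> (x \<otimes> y))) \<in> V"
          using left[OF left[OF v], of c x] c aG bG xG by simp
        show "(\<lambda>y. v' (x \<otimes> (b' \<otimes> y))) \<in> V"
          using left[OF left[OF v'], of x b'] b'G xG by simp
        fix y assume "y \<in> B"
        then have yG: "y \<in> carrier G" using B by auto
        have "x \<otimes> (b' \<otimes> y) = b \<otimes> (x \<otimes> y)" using xb xG yG b'G bG by (metis m_assoc)
        then show "v (c \<otimes> (x \<otimes> y)) = v' (x \<otimes> (b' \<otimes> y))"
          using aG bG xG yG by (simp add: v'_def c m_assoc)
      qed
      also have "\<dots> = T v' x"
        unfolding T_def
        using bspec[OF bspec[OF Minv[unfolded left_invariant_def] b'] left[OF v' xG]] by simp
      finally show "T (\<lambda>x. v (c \<otimes> x)) x = T v' x" .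
    qed
    also have "\<dots> = m (\<lambda>x. T v (a \<otimes> x))"
    proof (rule mean_cong[OF m(1)])
      show "T v' \<in> V" by (rule T_V[OF v'])
      show "(\<lambda>x. T v (a \<otimes> x)) \<in> V" by (rule left[OF T_V[OF v] aG])
      fix x assume "x \<in> A"
      then have xG: "x \<in> carrier G" using A by auto
      show "T v' x = T v (a \<otimes> x)" unfolding T_def v'_def
      proof (rule mean_cong[OF M])
        show "(\<lambda>b. v (a \<otimes> (x \<otimes> b))) \<in> V" using left[OF left[OF v aG] xG] .
        show "(\<lambda>b. v (a \<otimes> x \<otimes> b)) \<in> V" using left[OF v, of "a \<otimes> x"] aG xG by simp
      qed (use aG xG B in \<open>auto simp: m_assoc\<close>)
    qed
    also have "\<dots> = N v"
      unfolding N_def using m(2) a T_V[OF v] by (simp add: left_invariant_def)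
    finally show "N (\<lambda>x. v (c \<otimes> x)) = N v" .
  qed
  have "N (\<lambda>x. (v x)\<^sup>2) - (N v)\<^sup>2 \<le> L\<^sup>2 * (s + c\<^sup>2)" if v: "v \<in> V" "lipschitz_bound L v" for L v
  proof -
    have L: "L \<ge> 0" using v(2) by (simp add: lipschitz_bound_def)
    note sq = bounded_lipschitz_power2
    have "N (\<lambda>x. (v x)\<^sup>2) \<le> m (\<lambda>x. L\<^sup>2 * s + (T v x)\<^sup>2)"
      unfolding N_def
    proof (rule mean_mono[OF m(1) T_V[OF sq[OF v(1)]]])
      show "(\<lambda>x. L\<^sup>2 * s + (T v x)\<^sup>2) \<in> V"
        by (intro bounded_lipschitz_add bounded_lipschitz_const sq T_V v)
      fix x assume "x \<in> A"
      then have x: "x \<in> carrier G" using A by auto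
      show "T (\<lambda>x. (v x)\<^sup>2) x \<le> L\<^sup>2 * s + (T v x)\<^sup>2"
        using Mvar[OF left[OF v(1) x] lipschitz_bound_left[OF v(2) x]] by (simp add: T_def)
    qed
    also have "\<dots> = L\<^sup>2 * s + m (\<lambda>x. (T v x)\<^sup>2)"
      using mean_add[OF m(1) bounded_lipschitz_const sq[OF T_V[OF v(1)]]] by (simp add: mean_const[OF m(1)])
    finally have 1: "N (\<lambda>x. (v x)\<^sup>2) \<le> L\<^sup>2 * s + m (\<lambda>x. (T v x)\<^sup>2)" .
    \<comment> \<open>Deviation from the value at \<open>\<one>\<close> rather than from the mean:
      \<open>A\<close> has radius \<open>c\<close> about \<open>\<one>\<close>, which gives the
      constant \<open>c\<^sup>2\<close>, whereas its diameter would cost a factor 4.\<close>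
    have "m (\<lambda>x. (T v x - T v \<one>)\<^sup>2) \<le> m (\<lambda>_. (L * c)\<^sup>2)"
    proof (rule mean_mono[OF m(1)])
      show "(\<lambda>x. (T v x - T v \<one>)\<^sup>2) \<in> V"
        by (intro sq bounded_lipschitz_diff T_V v bounded_lipschitz_const)
      fix x assume x: "x \<in> A"
      then have "\<bar>T v x - T v \<one>\<bar> \<le> L * d x \<one>" using lipschitz_boundD[OF T_lip[OF v]] A by auto
      also have "\<dots> \<le> L * c" using diam[OF x] L by (simp add: mult_left_mono)
      finally show "(T v x - T v \<one>)\<^sup>2 \<le> (L * c)\<^sup>2" by (rule power2_le_iff_abs_le[THEN iffD2, rotated]) (use L diam[OF A(2)] in auto)
    qed simp
    then have "m (\<lambda>x. (T v x)\<^sup>2) - (m (T v))\<^sup>2 + (m (T v) - T v \<one>)\<^sup>2 \<le> (L * c)\<^sup>2"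
      using mean_square_deviation[OF m(1) T_V[OF v(1)]] mean_const[OF m(1)] by metis
    then have "m (\<lambda>x. (T v x)\<^sup>2) - (m (T v))\<^sup>2 \<le> L\<^sup>2 * c\<^sup>2"
      by (smt (verit) power_mult_distrib zero_le_power2)
    with 1 show ?thesis by (simp add: N_def distrib_left)
  qed
  then show ?thesis unfolding concentrated_def using N inv by blast
qed

section \<open>Compactness of the space of means, and invariant means on commutative groups\<close>

definition mean_space :: "'a set \<Rightarrow> (('a \<Rightarrow> real) \<Rightarrow> real) topology" where
  "mean_space A = subtopology (product_topology (\<lambda>_. euclideanreal) V) {m. mean_on A m}"

lemma topspace_mean_space: "topspace (mean_space A) = {m \<in> extensional V. mean_on A m}"
  by (auto simp: mean_space_def PiE_def)

text \<open>Points of the product over \<open>V\<close> are extensional, so a mean enters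
  \<open>mean_space\<close> only after restriction to \<open>V\<close>.\<close>

lemma mean_on_restrict: "mean_on A m \<Longrightarrow> mean_on A (restrict m V)"
  by (auto simp: mean_on_def bounded_lipschitz_add bounded_lipschitz_scale)

lemma continuous_map_mean_space:
  "v \<in> V \<Longrightarrow> continuous_map (mean_space A) euclideanreal (\<lambda>m. m v)"
  unfolding mean_space_def
  by (intro continuous_map_from_subtopology continuous_map_product_projection)

lemma Hausdorff_mean_space: "Hausdorff_space (mean_space A)"
  unfolding mean_space_def
  by (intro Hausdorff_space_subtopology) (simp add: Hausdorff_space_product_topology)

lemma mean_space_nonempty:
  assumes "a \<in> A" shows "topspace (mean_space A) \<noteq> {}"
  using mean_on_restrict[OF mean_eval[OF assms]] by (auto simp: topspace_mean_space)

text \<open>As in the Banach--Alaoglu theorem: the bound of \<open>v\<close> confines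
  \<open>m v\<close> to a compact interval, Tychonoff makes the product of these intervals compact,
  and each condition on a mean involves finitely many coordinates, hence is closed.\<close>

lemma compact_mean_space:
  assumes "A \<subseteq> carrier G"
  shows "compact_space (mean_space A)"
proof -
  define P :: "(('a \<Rightarrow> real) \<Rightarrow> real) topology" where "P = product_topology (\<lambda>_. euclideanreal) V"
  have "\<exists>b. \<forall>x\<in>carrier G. \<bar>v x\<bar> \<le> b" if "v \<in> V" for v
    using that by (simp add: bounded_lipschitz_def)
  then obtain bnd where bnd: "\<bar>v x\<bar> \<le> bnd v" if "v \<in> V" "x \<in> carrier G" for v x
    by metis
  define K where "K = (\<Pi>\<^sub>E v\<in>V. {- bnd v..bnd v})"
  have proj: "continuous_map P euclideanreal (\<lambda>m. m v)" if "v \<in> V" for v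
    unfolding P_def using continuous_map_product_projection[OF that, of "\<lambda>_. euclideanreal"] .
  define S where "S = {m \<in> topspace P. mean_on A m}"
  have S: "S = (\<Inter>p\<in>V \<times> V. {m \<in> topspace P. m (\<lambda>x. fst p x + snd p x) - (m (fst p) + m (snd p)) \<in> {0}})
     \<inter> ((\<Inter>p\<in>V \<times> UNIV. {m \<in> topspace P. m (\<lambda>x. snd p * fst p x) - snd p * m (fst p) \<in> {0}})
     \<inter> ((\<Inter>v\<in>{v \<in> V. \<forall>x\<in>A. 0 \<le> v x}. {m \<in> topspace P. m v \<in> {0..}})
     \<inter> {m \<in> topspace P. m (\<lambda>_. 1) \<in> {1}}))" (is "S = ?A \<inter> (?B \<inter> (?C \<inter> ?D))")
  proof (rule Set.set_eqI)
    fix m show "m \<in> S \<longleftrightarrow> m \<in> ?A \<inter> (?B \<inter> (?C \<inter> ?D))"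
      unfolding S_def mean_on_def by auto
  qed
  have z: "(\<lambda>_. 0) \<in> {v \<in> V. \<forall>x\<in>A. 0 \<le> v x}" by simp
  have "closedin P S"
    unfolding S
  proof (intro closedin_Int closedin_INT)
    show "V \<times> V \<noteq> {}" "V \<times> (UNIV :: real set) \<noteq> {}" "{v \<in> V. \<forall>x\<in>A. 0 \<le> v x} \<noteq> {}"
      using z by blast+
  next
    fix p assume "p \<in> V \<times> V"
    then show "closedin P {m \<in> topspace P. m (\<lambda>x. fst p x + snd p x) - (m (fst p) + m (snd p)) \<in> {0}}"
      by (intro closedin_continuous_map_preimage[where Y = euclideanreal] continuous_map_diff
          continuous_map_add proj bounded_lipschitz_add) auto
  next
    fix p assume "p \<in> V \<times> (UNIV :: real set)"
    then show "closedin P {m \<in> topspace P. m (\<lambda>x. snd p * fst p x) - snd p * m (fst p) \<in> {0}}"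
      by (intro closedin_continuous_map_preimage[where Y = euclideanreal] continuous_map_diff
          continuous_map_real_mult_left proj bounded_lipschitz_scale) auto
  next
    fix v assume "v \<in> {v \<in> V. \<forall>x\<in>A. 0 \<le> v x}"
    then show "closedin P {m \<in> topspace P. m v \<in> {0..}}"
      by (intro closedin_continuous_map_preimage[where Y = euclideanreal] proj) auto
  next
    show "closedin P {m \<in> topspace P. m (\<lambda>_. 1) \<in> {1}}"
      by (intro closedin_continuous_map_preimage[where Y = euclideanreal] proj) auto
  qed
  moreover have "compactin P K"
    unfolding P_def K_def compactin_PiE by simp
  moreover have "S \<subseteq> K"
  proof
    fix m assume "m \<in> S"
    then have "m \<in> extensional V" "mean_on A m" by (auto simp: S_def P_def PiE_def)
    moreover have "\<bar>m v\<bar> \<le> bnd v" if "v \<in> V" for v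
      by (rule mean_abs_le[OF \<open>mean_on A m\<close> that]) (use assms bnd that in blast)
    ultimately show "m \<in> K" unfolding K_def by (force simp: PiE_def abs_le_iff)
  qed
  ultimately have "compactin P S" by (meson closed_compactin)
  then have "compact_space (subtopology P S)" by (rule compact_space_subtopology)
  moreover have "subtopology P S = mean_space A"
  proof -
    have "S = topspace P \<inter> {m. mean_on A m}" by (auto simp: S_def)
    then show ?thesis
      using subtopology_restrict[of P "{m. mean_on A m}"] by (simp only: mean_space_def P_def)
  qed
  ultimately show ?thesis by simp
qed

text \<open>As in the Markov--Kakutani theorem: replace \<open>m\<close> by its average over \<open>1, b, \<dots>, b^(N - 1)\<close> for
  each \<open>b\<close> in turn.\<close>

lemma commutative_finite_invariant_mean:
  assumes A: "subgroup A G" and comm: "\<And>a b. \<lbrakk>a \<in> A; b \<in> A\<rbrakk> \<Longrightarrow> a \<otimes> b = b \<otimes> a"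
    and F: "finite F" "F \<subseteq> A" and N: "N > (0::nat)"
  shows "\<exists>m. mean_on A m \<and> (\<forall>a\<in>F. \<forall>v\<in>V. \<forall>c. (\<forall>x\<in>carrier G. \<bar>v x\<bar> \<le> c) \<longrightarrow>
    \<bar>m (\<lambda>x. v (a \<otimes> x)) - m v\<bar> \<le> 2 * c / N)"
  using F
proof (induction rule: finite_induct)
  case empty
  then show ?case using mean_eval[OF subgroup.one_closed[OF A]] by blast
next
  case (insert b F)
  then obtain m where m: "mean_on A m"
    and minv: "\<And>a v c. \<lbrakk>a \<in> F; v \<in> V; \<forall>x\<in>carrier G. \<bar>v x\<bar> \<le> c\<rbrakk> \<Longrightarrow>
       \<bar>m (\<lambda>x. v (a \<otimes> x)) - m v\<bar> \<le> 2 * c / N" by blast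
  interpret A: subgroup A G by fact
  have AG: "a \<in> carrier G" if "a \<in> A" for a using that by simp
  have bA: "b \<in> A" using insert by simp
  have bG: "b \<in> carrier G" using AG[OF bA] .
  have pow: "b [^] k \<in> A" for k :: nat
    by (induction k) (use bA in auto)
  have powG: "b [^] k \<in> carrier G" for k :: nat using bG by simp
  have V: "(\<lambda>x. v (b [^] k \<otimes> x)) \<in> V" if "v \<in> V" for v and k :: nat
    by (rule bounded_lipschitz_left[OF that powG])
  define m' where "m' v = (\<Sum>k<N. m (\<lambda>x. v (b [^] k \<otimes> x))) / N" for v
  have "mean_on A m'"
    unfolding mean_on_def
  proof (intro conjI ballI allI impI)
    fix v w assume "v \<in> V" "w \<in> V"
    then show "m' (\<lambda>x. v x + w x) = m' v + m' w"
      using mean_add[OF m V V] by (simp add: m'_def sum.distrib add_divide_distrib)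
  next
    fix v c assume "v \<in> V"
    then show "m' (\<lambda>x. c * v x) = c * m' v"
      using mean_scale[OF m V] by (simp add: m'_def sum_distrib_left)
  next
    fix v assume v: "v \<in> V" "\<forall>x\<in>A. 0 \<le> v x"
    have "0 \<le> m (\<lambda>x. v (b [^] k \<otimes> x))" for k :: nat
      by (rule mean_nonneg[OF m V]) (use v pow in auto)
    then show "0 \<le> m' v" by (simp add: m'_def sum_nonneg)
  next
    show "m' (\<lambda>_. 1) = 1" using N by (simp add: m'_def mean_const[OF m])
  qed
  moreover have "\<bar>m' (\<lambda>x. v (a \<otimes> x)) - m' v\<bar> \<le> 2 * c / N"
    if a: "a \<in> insert b F" and v: "v \<in> V" and c: "\<forall>x\<in>carrier G. \<bar>v x\<bar> \<le> c" for a v c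
  proof -
    have aA: "a \<in> A" using a bA insert by auto
    \<comment> \<open>Commutativity lets the translation by \<open>a\<close> pass the powers of
      \<open>b\<close>. For \<open>a = b\<close> the sum then telescopes to two terms of size at
      most \<open>c\<close>; for \<open>a\<close> in \<open>F\<close> each of the \<open>N\<close>
      summands already has defect at most \<open>2 * c / N\<close>, which averaging
      preserves.\<close>
    have eq: "m (\<lambda>x. v (a \<otimes> (b [^] k \<otimes> x))) = m (\<lambda>x. v (b [^] k \<otimes> (a \<otimes> x)))" for k :: nat
    proof (rule mean_cong[OF m])
      show "(\<lambda>x. v (a \<otimes> (b [^] k \<otimes> x))) \<in> V"
        using bounded_lipschitz_left[OF bounded_lipschitz_left[OF v AG[OF aA]] powG] .
      show "(\<lambda>x. v (b [^] k \<otimes> (a \<otimes> x))) \<in> V"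
        using bounded_lipschitz_left[OF bounded_lipschitz_left[OF v powG] AG[OF aA]] .
      fix x assume "x \<in> A"
      then show "v (a \<otimes> (b [^] k \<otimes> x)) = v (b [^] k \<otimes> (a \<otimes> x))"
        using comm[OF aA pow] AG aA powG by (metis m_assoc)
    qed
    show ?thesis
    proof (cases "a = b")
      case True
      have "b [^] k \<otimes> (b \<otimes> x) = b [^] (Suc k) \<otimes> x" if "x \<in> carrier G" for x and k :: nat
        using that bG by (simp add: m_assoc)
      then have "m (\<lambda>x. v (b [^] k \<otimes> (b \<otimes> x))) = m (\<lambda>x. v (b [^] (Suc k) \<otimes> x))" for k :: nat
        by (intro mean_cong[OF m] V v bounded_lipschitz_left[OF V[OF v] bG]) (auto dest: AG)
      then have "m' (\<lambda>x. v (a \<otimes> x)) - m' v =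
          (\<Sum>k<N. m (\<lambda>x. v (b [^] (Suc k) \<otimes> x)) - m (\<lambda>x. v (b [^] k \<otimes> x))) / N"
        using eq True by (simp add: m'_def sum_subtractf diff_divide_distrib del: nat_pow_Suc)
      also have "\<dots> = (m (\<lambda>x. v (b [^] N \<otimes> x)) - m (\<lambda>x. v (b [^] (0::nat) \<otimes> x))) / N"
        by (subst sum_lessThan_telescope) simp
      finally have "\<bar>m' (\<lambda>x. v (a \<otimes> x)) - m' v\<bar> =
          \<bar>m (\<lambda>x. v (b [^] N \<otimes> x)) - m (\<lambda>x. v (b [^] (0::nat) \<otimes> x))\<bar> / N"
        by (simp add: abs_divide)
      moreover have "\<bar>m (\<lambda>x. v (b [^] k \<otimes> x))\<bar> \<le> c" for k :: nat
        by (rule mean_abs_le[OF m V[OF v]]) (use c AG powG in auto)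
      from this[of N] this[of 0]
      have "\<bar>m (\<lambda>x. v (b [^] N \<otimes> x)) - m (\<lambda>x. v (b [^] (0::nat) \<otimes> x))\<bar> \<le> 2 * c"
        by linarith
      ultimately show ?thesis by (simp add: divide_right_mono)
    next
      case False
      then have aF: "a \<in> F" using a by simp
      have "\<bar>m (\<lambda>x. v (b [^] k \<otimes> (a \<otimes> x))) - m (\<lambda>x. v (b [^] k \<otimes> x))\<bar> \<le> 2 * c / N" for k :: nat
        by (rule minv[OF aF V[OF v]]) (use c powG in auto)
      then have "\<bar>\<Sum>k<N. m (\<lambda>x. v (b [^] k \<otimes> (a \<otimes> x))) - m (\<lambda>x. v (b [^] k \<otimes> x))\<bar> \<le> (\<Sum>k<N. 2 * c / N)"
        by (intro order_trans[OF sum_abs] sum_mono)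
      also have "\<dots> = 2 * c" using N by simp
      finally have "\<bar>\<Sum>k<N. m (\<lambda>x. v (b [^] k \<otimes> (a \<otimes> x))) - m (\<lambda>x. v (b [^] k \<otimes> x))\<bar> / N \<le> 2 * c / N"
        by (simp add: divide_right_mono)
      then show ?thesis
        using eq by (simp add: m'_def sum_subtractf abs_divide flip: diff_divide_distrib)
    qed
  qed
  ultimately show ?case by blast
qed

text \<open>Compactness of the space of means turns approximate invariance under finite subsets into
  invariance: the closed sets \<open>C (a, N)\<close> have the finite intersection property.\<close>

lemma commutative_invariant_mean:
  assumes A: "subgroup A G" and comm: "\<And>a b. \<lbrakk>a \<in> A; b \<in> A\<rbrakk> \<Longrightarrow> a \<otimes> b = b \<otimes> a"
  shows "\<exists>m. mean_on A m \<and> left_invariant A m"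
proof -
  interpret A: subgroup A G by fact
  define X where "X = mean_space A"
  define Q where "Q = {(v, c). v \<in> V \<and> (\<forall>x\<in>carrier G. \<bar>v x\<bar> \<le> c)}"
  have q0: "(\<lambda>_. 0, 0) \<in> Q" by (simp add: Q_def)
  have iv: "x \<in> {- y..y} \<longleftrightarrow> \<bar>x\<bar> \<le> y" for x y :: real by auto
  \<comment> \<open>The denominator is \<open>Suc N\<close>, since division by 0 gives 0 and would
    demand exact invariance at the index 0.\<close>
  define C where "C = (\<lambda>(a, N::nat). \<Inter>q\<in>Q. {m \<in> topspace X. m (\<lambda>x. fst q (a \<otimes> x)) - m (fst q) \<in> {- (2 * snd q / Suc N)..2 * snd q / Suc N}})"
  have left: "(\<lambda>x. v (a \<otimes> x)) \<in> V" if "v \<in> V" "a \<in> A" for v a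
    using bounded_lipschitz_left that by simp
  have "closedin X (C p)" if p: "p \<in> A \<times> UNIV" for p
  proof -
    obtain a N where [simp]: "p = (a, N)" and a: "a \<in> A" using p by auto
    show ?thesis
      unfolding \<open>p = (a, N)\<close> C_def prod.case
    proof (rule closedin_INT)
      show "Q \<noteq> {}" using q0 by blast
      fix q assume "q \<in> Q"
      then have "fst q \<in> V" by (auto simp: Q_def)
      then show "closedin X {m \<in> topspace X. m (\<lambda>x. fst q (a \<otimes> x)) - m (fst q) \<in> {- (2 * snd q / Suc N)..2 * snd q / Suc N}}"
        unfolding X_def using left a
        by (intro closedin_continuous_map_preimage[where Y = euclideanreal] continuous_map_diff continuous_map_mean_space) auto
    qed
  qed
  moreover have "\<Inter>\<F> \<noteq> {}" if \<F>: "finite \<F>" "\<F> \<subseteq> C ` (A \<times> UNIV)" for \<F>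
  proof -
    obtain P where P: "finite P" "P \<subseteq> A \<times> UNIV" "\<F> = C ` P"
      using \<F> by (meson finite_subset_image)
    \<comment> \<open>One accuracy for all indices occurring in \<open>P\<close>: \<open>N\<close>
      is at least \<open>Suc n\<close> for each of them, and positive even if \<open>P\<close> is
      empty.\<close>
    define N where "N = Suc (Max (insert 0 (snd ` P)))"
    have fin: "finite (fst ` P)" and sub: "fst ` P \<subseteq> A" and Npos: "N > 0" using P by (auto simp: N_def)
    obtain m where m: "mean_on A m" and minv: "\<forall>a\<in>fst ` P. \<forall>v\<in>V. \<forall>c. (\<forall>x\<in>carrier G. \<bar>v x\<bar> \<le> c) \<longrightarrow>
        \<bar>m (\<lambda>x. v (a \<otimes> x)) - m v\<bar> \<le> 2 * c / N"
      using commutative_finite_invariant_mean[OF A comm fin sub Npos] by blast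
    have "restrict m V \<in> C p" if p: "p \<in> P" for p
    proof -
      obtain a n where [simp]: "p = (a, n)" by (cases p)
      have a: "a \<in> A" "a \<in> fst ` P" using p P(2) by force+
      have "n \<le> Max (insert 0 (snd ` P))" using p P(1) by (intro Max_ge) force+
      then have n: "Suc n \<le> N" by (simp add: N_def)
      have "\<bar>restrict m V (\<lambda>x. v (a \<otimes> x)) - restrict m V v\<bar> \<le> 2 * c / Suc n"
        if v: "v \<in> V" and c: "\<forall>x\<in>carrier G. \<bar>v x\<bar> \<le> c" for v c
      proof -
        have "0 \<le> c" using c one_closed by force
        have "\<bar>m (\<lambda>x. v (a \<otimes> x)) - m v\<bar> \<le> 2 * c / N" using minv a v c by blast
        also have "\<dots> \<le> 2 * c / Suc n" using n \<open>0 \<le> c\<close> by (intro divide_left_mono) auto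
        finally show ?thesis using left[OF v a(1)] v by simp
      qed
      then have "\<And>q. q \<in> Q \<Longrightarrow> restrict m V (\<lambda>x. fst q (a \<otimes> x)) - restrict m V (fst q) \<in> {- (2 * snd q / Suc n)..2 * snd q / Suc n}"
        unfolding iv by (force simp: Q_def)
      moreover have "restrict m V \<in> topspace X"
        using mean_on_restrict[OF m] by (simp add: X_def topspace_mean_space)
      ultimately show ?thesis unfolding C_def \<open>p = (a, n)\<close> prod.case by blast
    qed
    then show ?thesis unfolding P(3) by blast
  qed
  ultimately have "\<Inter>(C ` (A \<times> UNIV)) \<noteq> {}"
    using compact_mean_space[of A] A.subset unfolding compact_space_fip X_def[symmetric] by blast
  then obtain m where m: "\<And>a N. a \<in> A \<Longrightarrow> m \<in> C (a, N)" by blast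
  have "mean_on A m" using m[OF A.one_closed] q0 by (auto simp: C_def X_def topspace_mean_space)
  moreover have "m (\<lambda>x. v (a \<otimes> x)) = m v" if a: "a \<in> A" and v: "v \<in> V" for a v
  proof -
    obtain c where c: "\<forall>x\<in>carrier G. \<bar>v x\<bar> \<le> c" using v by (auto simp: bounded_lipschitz_def)
    then have vc: "(v, c) \<in> Q" using v by (simp add: Q_def)
    have "m (\<lambda>x. v (a \<otimes> x)) - m v \<in> {- (2 * c / Suc N)..2 * c / Suc N}" for N
      using m[OF a, of N] vc unfolding C_def prod.case by force
    then have "\<bar>m (\<lambda>x. v (a \<otimes> x)) - m v\<bar> \<le> 2 * c / Suc N" for N
      unfolding iv .
    moreover have "(\<lambda>N. 2 * c / Suc N) \<longlonglongrightarrow> 0"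
      using LIMSEQ_Suc[OF lim_const_over_n[of "2 * c"]] by simp
    ultimately have "\<bar>m (\<lambda>x. v (a \<otimes> x)) - m v\<bar> \<le> 0"
      by (intro LIMSEQ_le_const) auto
    then show ?thesis by simp
  qed
  ultimately show ?thesis by (auto simp: left_invariant_def)
qed

end

section \<open>Group actions and metric topological groups\<close>

text \<open>Bijectivity is supplied by the inverse group element. Extensionality is among the
  conditions because the elements of \<open>BijGroup\<close> are extensional maps.\<close>

lemma group_actionI:
  fixes G (structure)
  assumes "group G" and ext: "\<And>g. g \<in> carrier G \<Longrightarrow> \<phi> g \<in> extensional E"
    and closed: "\<And>g x. \<lbrakk>g \<in> carrier G; x \<in> E\<rbrakk> \<Longrightarrow> \<phi> g x \<in> E"
    and one: "\<And>x. x \<in> E \<Longrightarrow> \<phi> \<one> x = x"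
    and mult: "\<And>g h x. \<lbrakk>g \<in> carrier G; h \<in> carrier G; x \<in> E\<rbrakk> \<Longrightarrow> \<phi> (g \<otimes> h) x = \<phi> g (\<phi> h x)"
  shows "group_action G E \<phi>"
proof -
  interpret group G by fact
  have Bij: "\<phi> g \<in> Bij E" if g: "g \<in> carrier G" for g
  proof -
    have "bij_betw (\<phi> g) E E"
      by (rule bij_betw_byWitness[where f' = "\<phi> (inv g)"])
        (use g closed one mult[of "inv g" g] mult[of g "inv g"] in auto)
    then show ?thesis using ext[OF g] by (simp add: Bij_def)
  qed
  have "\<phi> \<in> hom G (BijGroup E)"
  proof (rule homI)
    show "\<phi> g \<in> carrier (BijGroup E)" if "g \<in> carrier G" for g
      using Bij[OF that] by (simp add: BijGroup_def)
    fix g h assume gh: "g \<in> carrier G" "h \<in> carrier G"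
    then have "\<phi> (g \<otimes> h) = compose E (\<phi> g) (\<phi> h)"
      using ext[of "g \<otimes> h"] mult[OF gh] by (auto simp: compose_def extensional_def)
    then show "\<phi> (g \<otimes> h) = \<phi> g \<otimes>\<^bsub>BijGroup E\<^esub> \<phi> h"
      using gh Bij by (simp add: BijGroup_def)
  qed
  then show ?thesis
    by (simp add: group_action_def group_hom_def group_hom_axioms_def group_BijGroup is_group)
qed

lemma continuous_map_euclideanreal_iff:
  "continuous_map X euclideanreal f \<longleftrightarrow>
    (\<forall>x\<in>topspace X. \<forall>\<epsilon>>0. \<exists>U. openin X U \<and> x \<in> U \<and> (\<forall>y\<in>U. \<bar>f y - f x\<bar> < \<epsilon>))"
  using Met_TC.continuous_map_to_metric[of X f]
  by (simp add: dist_real_def abs_minus_commute)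

lemma borel_of_euclidean: "borel_of euclidean = borel"
  by (simp add: borel_of_def borel_def)

text \<open>Bi-invariance gives
  \<open>d (x \<otimes> y) (x' \<otimes> y') \<le> d x x' + d y y'\<close> and makes inversion an
  isometry.\<close>

lemma (in biinvariant_metric_group) topological_group_metric: "topological_group G mtopology"
  unfolding topological_group_def
proof (intro conjI)
  show "continuous_map (prod_topology mtopology mtopology) mtopology (\<lambda>(g, h). g \<otimes> h)"
    unfolding continuous_map_to_metric
  proof (intro ballI allI impI)
    fix p and \<epsilon> :: real assume "p \<in> topspace (prod_topology mtopology mtopology)" and \<epsilon>: "\<epsilon> > 0"
    then obtain x y where [simp]: "p = (x, y)" and x: "x \<in> carrier G" and y: "y \<in> carrier G" by auto
    have "x \<otimes> y \<in> carrier G" using x y by simp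
    have "d (x \<otimes> y) (x' \<otimes> y') < \<epsilon>" if "d x x' < \<epsilon> / 2" "d y y' < \<epsilon> / 2" "x' \<in> carrier G" "y' \<in> carrier G" for x' y'
    proof -
      have "d (x \<otimes> y) (x' \<otimes> y') \<le> d (x \<otimes> y) (x' \<otimes> y) + d (x' \<otimes> y) (x' \<otimes> y')"
        by (rule triangle) (use that x y in auto)
      then show ?thesis using that x y by (simp add: dist_left dist_right)
    qed
    then show "\<exists>U. openin (prod_topology mtopology mtopology) U \<and> p \<in> U \<and>
        (\<forall>y\<in>U. (case y of (g, h) \<Rightarrow> g \<otimes> h) \<in> mball (case p of (g, h) \<Rightarrow> g \<otimes> h) \<epsilon>)"
      using x y \<epsilon>
      by (intro exI[of _ "mball x (\<epsilon> / 2) \<times> mball y (\<epsilon> / 2)"]) (auto simp: openin_prod_Times_iff)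
  qed
  show "continuous_map mtopology mtopology (\<lambda>g. inv g)"
    unfolding continuous_map_to_metric
  proof (intro ballI allI impI)
    fix x and \<epsilon> :: real assume x: "x \<in> topspace mtopology" and \<epsilon>: "\<epsilon> > 0"
    have "d (inv x) (inv y) = d x y" if y: "y \<in> carrier G" for y
    proof -
      \<comment> \<open>Multiply by \<open>x\<close> on the left and by \<open>y\<close> on the
        right.\<close>
      have "d (inv x) (inv y) = d y x"
        using x y dist_left[of "inv x" "inv y" x] dist_right[of "x \<otimes> inv x" "x \<otimes> inv y" y]
        by (simp add: m_assoc)
      then show ?thesis by (simp add: commute)
    qed
    then show "\<exists>U. openin mtopology U \<and> x \<in> U \<and> (\<forall>y\<in>U. inv y \<in> mball (inv x) \<epsilon>)"
      using x \<epsilon> by (intro exI[of _ "mball x \<epsilon>"]) auto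
  qed
qed (simp_all add: is_group)

section \<open>Invariant means from amenability\<close>

context biinvariant_metric_group
begin

text \<open>The group \<open>D\<close> acts through \<open>\<psi>\<close> by translations on the
  compact space of means on the image. An invariant probability measure on this space has a
  barycentre, which is an invariant mean. The detour is due to the definition of amenability, which
  speaks of actions on compact spaces.\<close>

lemma amenable_image_invariant_mean:
  fixes D :: "('d, 'n) monoid_scheme"
  assumes am: "amenable TYPE('d set set) D T" and hom: "\<psi> \<in> hom D G"
    and cont: "continuous_map T mtopology \<psi>"
  shows "\<exists>m. mean_on (\<psi> ` carrier D) m \<and> left_invariant (\<psi> ` carrier D) m"
proof -
  have tg: "topological_group D T" using am by (simp add: amenable_def)
  interpret D: group D using tg by (simp add: topological_group_def)
  interpret \<psi>: group_hom D G \<psi>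
    by (simp add: group_hom_def group_hom_axioms_def hom is_group D.is_group)
  have topT: "topspace T = carrier D" using tg by (simp add: topological_group_def)
  define A where "A = \<psi> ` carrier D"
  have AG: "A \<subseteq> carrier G" by (auto simp: A_def)
  have \<psi>1: "\<psi> \<one>\<^bsub>D\<^esub> = \<one>" by simp
  define X where "X = mean_space A"
  have topX: "topspace X = {m \<in> extensional V. mean_on A m}" by (simp add: X_def topspace_mean_space)
  have comp: "compact_space X" unfolding X_def by (rule compact_mean_space[OF AG])
  have ne: "topspace X \<noteq> {}" unfolding X_def by (rule mean_space_nonempty[of "\<psi> \<one>\<^bsub>D\<^esub>"]) (unfold A_def, rule imageI, simp)
  \<comment> \<open>Push-forward of means along left translation; means are covariant in the group,
    so this is a left action without an inverse in the formula.\<close>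
  define \<Phi> where "\<Phi> = (\<lambda>g. \<lambda>m\<in>topspace X. \<lambda>v\<in>V. m (\<lambda>x. v (\<psi> g \<otimes> x)))"
  have left: "(\<lambda>x. v (\<psi> g \<otimes> x)) \<in> V" if "v \<in> V" "g \<in> carrier D" for v g
    using bounded_lipschitz_left[OF that(1)] that(2) by simp
  have \<Phi>X: "\<Phi> g m \<in> topspace X" if g: "g \<in> carrier D" and m: "m \<in> topspace X" for g m
  proof -
    have mm: "mean_on A m" using m by (simp add: topX)
    have "mean_on A (\<lambda>v. m (\<lambda>x. v (\<psi> g \<otimes> x)))"
      unfolding mean_on_def
    proof (intro conjI ballI allI impI)
      fix v assume v: "v \<in> V" "\<forall>x\<in>A. 0 \<le> v x"
      show "0 \<le> m (\<lambda>x. v (\<psi> g \<otimes> x))"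
        by (rule mean_nonneg[OF mm left[OF v(1) g]]) (use v(2) g in \<open>auto simp: A_def simp flip: \<psi>.hom_mult\<close>)
    qed (use mean_add[OF mm left left] mean_scale[OF mm left] mean_const[OF mm] g in auto)
    then show ?thesis using mean_on_restrict m by (simp add: \<Phi>_def topX)
  qed
  have act: "group_action D (topspace X) \<Phi>"
  proof (rule group_actionI[OF D.is_group])
    show "\<Phi> g \<in> extensional (topspace X)" for g by (simp add: \<Phi>_def)
    show "\<Phi> \<one>\<^bsub>D\<^esub> m = m" if m: "m \<in> topspace X" for m
    proof
      fix v show "\<Phi> \<one>\<^bsub>D\<^esub> m v = m v"
      proof (cases "v \<in> V")
        case True
        have mm: "mean_on A m" using m by (simp add: topX)
        have "m (\<lambda>x. v (\<one> \<otimes> x)) = m v"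
          by (rule mean_cong[OF mm bounded_lipschitz_left[OF True one_closed] True]) (use AG in auto)
        then show ?thesis using True m \<psi>1 by (simp add: \<Phi>_def)
      next
        case False
        then show ?thesis using m by (simp add: \<Phi>_def topX extensional_def)
      qed
    qed
    show "\<Phi> (g \<otimes>\<^bsub>D\<^esub> h) m = \<Phi> g (\<Phi> h m)"
      if gh: "g \<in> carrier D" "h \<in> carrier D" and m: "m \<in> topspace X" for g h m
    proof
      fix v show "\<Phi> (g \<otimes>\<^bsub>D\<^esub> h) m v = \<Phi> g (\<Phi> h m) v"
      proof (cases "v \<in> V")
        case True
        have mm: "mean_on A m" using m by (simp add: topX)
        have "m (\<lambda>x. v (\<psi> (g \<otimes>\<^bsub>D\<^esub> h) \<otimes> x)) = m (\<lambda>x. v (\<psi> g \<otimes> (\<psi> h \<otimes> x)))"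
          by (rule mean_cong[OF mm left[OF True] left[OF left[OF True]]])
            (use gh AG in \<open>auto simp: m_assoc\<close>)
        then show ?thesis using True m gh \<Phi>X[OF gh(2) m] left by (simp add: \<Phi>_def)
      next
        case False
        then show ?thesis using m gh \<Phi>X[OF gh(2) m] by (simp add: \<Phi>_def)
      qed
    qed
  qed (rule \<Phi>X)
  have "continuous_map (prod_topology T X) X (\<lambda>(g, m). \<Phi> g m)"
    unfolding X_def mean_space_def
  proof (rule continuous_map_into_subtopology, fold mean_space_def, fold X_def)
    show "(\<lambda>(g, m). \<Phi> g m) \<in> topspace (prod_topology T X) \<rightarrow> {m. mean_on A m}"
      using \<Phi>X by (auto simp: topT) (simp add: topX)
    show "continuous_map (prod_topology T X) (product_topology (\<lambda>_. euclideanreal) V) (\<lambda>(g, m). \<Phi> g m)"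
      unfolding continuous_map_componentwise
    proof (intro conjI ballI)
      show "(\<lambda>(g, m). \<Phi> g m) ` topspace (prod_topology T X) \<subseteq> extensional V"
        using \<Phi>X by (auto simp: topT) (simp add: topX)
      fix v assume v: "v \<in> V"
      then obtain L where L: "lipschitz_bound L v" by (auto simp: bounded_lipschitz_def)
      have L0: "L \<ge> 0" using L by (simp add: lipschitz_bound_def)
      show "continuous_map (prod_topology T X) euclideanreal (\<lambda>p. (case p of (g, m) \<Rightarrow> \<Phi> g m) v)"
        unfolding continuous_map_euclideanreal_iff
      proof (intro ballI allI impI)
        fix p and \<epsilon> :: real assume "p \<in> topspace (prod_topology T X)" and \<epsilon>: "\<epsilon> > 0"
        then obtain g0 m0 where [simp]: "p = (g0, m0)" and g0: "g0 \<in> carrier D" and m0: "m0 \<in> topspace X"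
          by (auto simp: topT)
        \<comment> \<open>Chosen so that \<open>L * r < \<epsilon> / 2\<close>; the summand 1 covers
          the case \<open>L = 0\<close>.\<close>
        define r where "r = \<epsilon> / (2 * (L + 1))"
        have r: "r > 0" using \<epsilon> L0 by (simp add: r_def)
        \<comment> \<open>Joint continuity at \<open>(g0, m0)\<close>: moving \<open>g\<close>
          changes the translate of \<open>v\<close> uniformly by at most \<open>L * r\<close>, by
          right invariance of the metric; what is left depends on \<open>m\<close> through the
          single coordinate \<open>w\<close>.\<close>
        define w where "w = (\<lambda>x. v (\<psi> g0 \<otimes> x))"
        have w: "w \<in> V" unfolding w_def by (rule left[OF v g0])
        define U1 where "U1 = {g \<in> topspace T. \<psi> g \<in> mball (\<psi> g0) r}"
        define U2 where "U2 = {m \<in> topspace X. m w \<in> ball (m0 w) (\<epsilon> / 2)}"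
        have "openin T U1" unfolding U1_def by (rule openin_continuous_map_preimage[OF cont]) simp
        moreover have "openin X U2"
          unfolding U2_def X_def using continuous_map_mean_space[OF w]
          by (rule openin_continuous_map_preimage) auto
        moreover have "g0 \<in> U1" "m0 \<in> U2" using g0 m0 r \<epsilon> by (auto simp: U1_def U2_def topT)
        moreover have "\<bar>\<Phi> g m v - \<Phi> g0 m0 v\<bar> < \<epsilon>" if "g \<in> U1" "m \<in> U2" for g m
        proof -
          have g: "g \<in> carrier D" "d (\<psi> g) (\<psi> g0) < r" using that by (auto simp: U1_def topT commute)
          have m: "m \<in> topspace X" "\<bar>m w - m0 w\<bar> < \<epsilon> / 2"
            using that by (auto simp: U2_def dist_real_def abs_minus_commute)
          have mm: "mean_on A m" using m by (simp add: topX)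
          have "\<bar>m (\<lambda>x. v (\<psi> g \<otimes> x) - w x)\<bar> \<le> L * r"
          proof (rule mean_abs_le[OF mm bounded_lipschitz_diff[OF left[OF v g(1)] w]])
            fix x assume "x \<in> A"
            then have x: "x \<in> carrier G" using AG by auto
            have "\<bar>v (\<psi> g \<otimes> x) - w x\<bar> \<le> L * d (\<psi> g) (\<psi> g0)"
              using lipschitz_boundD[OF L, of "\<psi> g \<otimes> x" "\<psi> g0 \<otimes> x"] x g(1) g0
              by (simp add: w_def dist_right)
            also have "\<dots> \<le> L * r" using L0 g(2) by (simp add: mult_left_mono)
            finally show "\<bar>v (\<psi> g \<otimes> x) - w x\<bar> \<le> L * r" .
          qed
          moreover have "m (\<lambda>x. v (\<psi> g \<otimes> x) - w x) = m (\<lambda>x. v (\<psi> g \<otimes> x)) - m w"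
            by (rule mean_diff[OF mm left[OF v g(1)] w])
          moreover have "L * r < \<epsilon> / 2"
            using L0 \<epsilon> by (simp add: r_def field_simps)
          ultimately have "\<bar>m (\<lambda>x. v (\<psi> g \<otimes> x)) - m0 w\<bar> < \<epsilon>" using m(2) by linarith
          then show ?thesis using v m(1) m0 by (simp add: \<Phi>_def w_def)
        qed
        ultimately show "\<exists>U. openin (prod_topology T X) U \<and> p \<in> U \<and>
            (\<forall>y\<in>U. \<bar>(case y of (g, m) \<Rightarrow> \<Phi> g m) v - (case p of (g, m) \<Rightarrow> \<Phi> g m) v\<bar> < \<epsilon>)"
          by (intro exI[of _ "U1 \<times> U2"]) (auto simp: openin_prod_Times_iff)
      qed
    qed
  qed
  then have cact: "continuous_action D T X \<Phi>" using act by (simp add: continuous_action_def)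
  \<comment> \<open>The points of \<open>X\<close> are functionals, so amenability has to be carried
    over to another type of points.\<close>
  obtain M where M: "regular_borel_probability X M"
    and Minv: "\<And>g. g \<in> carrier D \<Longrightarrow> distr M M (\<Phi> g) = M"
    using amenable_any_type[OF am] comp ne cact Hausdorff_mean_space[of A]
    unfolding amenable_def X_def by metis
  interpret M: prob_space M using M by (simp add: regular_borel_probability_def)
  have setsM: "sets M = sets (borel_of X)" using M by (simp add: regular_borel_probability_def)
  have spM: "space M = topspace X" using sets_eq_imp_space_eq[OF setsM] by simp
  have meas: "(\<lambda>m. m v) \<in> borel_measurable M" if "v \<in> V" for v
    using continuous_map_measurable[OF continuous_map_mean_space[OF that, of A]] measurable_cong_sets[OF setsM refl]
    unfolding X_def borel_of_euclidean by blast
  have int: "integrable M (\<lambda>m. m v)" if v: "v \<in> V" for v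
  proof -
    obtain c where c: "\<forall>x\<in>carrier G. \<bar>v x\<bar> \<le> c" using v by (auto simp: bounded_lipschitz_def)
    have "\<bar>m v\<bar> \<le> c" if "m \<in> space M" for m
      using that c AG v by (intro mean_abs_le[of A m]) (auto simp: spM topX)
    then show ?thesis
      by (intro M.integrable_const_bound[of _ c] meas v) auto
  qed
  \<comment> \<open>The barycentre of \<open>M\<close>: each condition on a mean holds at every
    point of the space and survives integration.\<close>
  define N where "N v = (\<integral>m. m v \<partial>M)" for v
  have "mean_on A N"
    unfolding mean_on_def
  proof (intro conjI ballI allI impI)
    fix v w assume vw: "v \<in> V" "w \<in> V"
    have "N (\<lambda>x. v x + w x) = (\<integral>m. m v + m w \<partial>M)"
      unfolding N_def by (rule Bochner_Integration.integral_cong) (use vw in \<open>auto simp: spM topX mean_add\<close>)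
    then show "N (\<lambda>x. v x + w x) = N v + N w" using int vw by (simp add: N_def)
  next
    fix v c assume v: "v \<in> V"
    have "N (\<lambda>x. c * v x) = (\<integral>m. c * m v \<partial>M)"
      unfolding N_def by (rule Bochner_Integration.integral_cong) (use v in \<open>auto simp: spM topX mean_scale\<close>)
    then show "N (\<lambda>x. c * v x) = c * N v" by (simp add: N_def)
  next
    fix v assume "v \<in> V" "\<forall>x\<in>A. 0 \<le> v x"
    then show "0 \<le> N v"
      unfolding N_def by (intro integral_nonneg_AE AE_I2) (auto simp: spM topX intro: mean_nonneg)
  next
    have "N (\<lambda>_. 1) = (\<integral>m. 1 \<partial>M)"
      unfolding N_def by (rule Bochner_Integration.integral_cong) (auto simp: spM topX mean_one)
    then show "N (\<lambda>_. 1) = 1" by (simp add: M.prob_space)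
  qed
  moreover have "left_invariant A N"
    unfolding left_invariant_def
  proof (intro ballI)
    fix a v assume "a \<in> A" and v: "v \<in> V"
    then obtain g where g: "g \<in> carrier D" "a = \<psi> g" by (auto simp: A_def)
    have "continuous_map X (prod_topology T X) (\<lambda>x. (g, x))"
      using g topT by (intro continuous_map_pairedI) auto
    then have "continuous_map X X (\<Phi> g)"
      using cact continuous_map_compose[of X _ "\<lambda>x. (g, x)" X "\<lambda>(g, m). \<Phi> g m"]
      by (auto simp: continuous_action_def o_def)
    from continuous_map_measurable[OF this] have mg: "\<Phi> g \<in> M \<rightarrow>\<^sub>M M"
      using measurable_cong_sets[OF setsM setsM] by blast
    have "N v = (\<integral>m. m v \<partial>(distr M M (\<Phi> g)))" by (simp add: N_def Minv[OF g(1)])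
    also have "\<dots> = (\<integral>m. \<Phi> g m v \<partial>M)" by (rule integral_distr[OF mg meas[OF v]])
    also have "\<dots> = N (\<lambda>x. v (a \<otimes> x))"
      unfolding N_def by (rule Bochner_Integration.integral_cong) (use v g in \<open>auto simp: spM \<Phi>_def\<close>)
    finally show "N (\<lambda>x. v (a \<otimes> x)) = N v" by simp
  qed
  ultimately show ?thesis unfolding A_def by blast
qed

section \<open>Fixed points from concentration\<close>

text \<open>The infimal convolution of \<open>F\<close> with \<open>d / \<delta>\<close> has
  Lipschitz constant \<open>1 / \<delta>\<close>. Points at distance at least
  \<open>\<delta>\<close> from \<open>g\<close> pay a penalty of at least 1 and cannot undercut a
  value in \<open>[0, 1]\<close>; nearer points undercut \<open>F g\<close> by at most
  \<open>\<eta>\<close>.\<close>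

lemma lipschitz_approximation:
  assumes \<delta>: "\<delta> > 0" and \<eta>: "\<eta> \<ge> 0"
    and F: "\<And>g. g \<in> carrier G \<Longrightarrow> F g \<in> {0..1}"
    and unif: "\<And>g h. \<lbrakk>g \<in> carrier G; h \<in> carrier G; d g h < \<delta>\<rbrakk> \<Longrightarrow> \<bar>F g - F h\<bar> \<le> \<eta>"
  shows "\<exists>v L. v \<in> V \<and> lipschitz_bound L v \<and> (\<forall>g\<in>carrier G. \<bar>v g - F g\<bar> \<le> \<eta>)"
proof -
  define v where "v g = (INF h\<in>carrier G. F h + d g h / \<delta>)" for g
  have pos: "0 \<le> F h + d g h / \<delta>" if "h \<in> carrier G" for g h
    using F[OF that] \<delta> by simp
  then have bdd: "bdd_below ((\<lambda>h. F h + d g h / \<delta>) ` carrier G)" for g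
    by (intro bdd_belowI2[of _ 0]) auto
  have ne: "carrier G \<noteq> {}" using one_closed by blast
  have le: "v g \<le> F h + d g h / \<delta>" if "h \<in> carrier G" for g h
    unfolding v_def by (rule cINF_lower[OF bdd that])
  have ge: "c \<le> v g" if "\<And>h. h \<in> carrier G \<Longrightarrow> c \<le> F h + d g h / \<delta>" for c g
    unfolding v_def by (rule cINF_greatest[OF ne that])
  have up: "v g \<le> F g" if "g \<in> carrier G" for g using le[OF that, of g] that by simp
  have low: "F g - \<eta> \<le> v g" if g: "g \<in> carrier G" for g
  proof (rule ge)
    fix h assume h: "h \<in> carrier G"
    show "F g - \<eta> \<le> F h + d g h / \<delta>"
    proof (cases "d g h < \<delta>")
      case True
      then have "F g - F h \<le> \<eta>" using unif[OF g h] by linarith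
      moreover have "0 \<le> d g h / \<delta>" using \<delta> by simp
      ultimately show ?thesis by linarith
    next
      case False
      then have "1 \<le> d g h / \<delta>" using \<delta> by simp
      then show ?thesis using F[OF g] F[OF h] \<eta> by simp
    qed
  qed
  have lip1: "v x - v y \<le> d x y / \<delta>" if xy: "x \<in> carrier G" "y \<in> carrier G" for x y
  proof -
    have "v x - d x y / \<delta> \<le> v y"
    proof (rule ge)
      fix h assume h: "h \<in> carrier G"
      have "v x \<le> F h + d x h / \<delta>" by (rule le[OF h])
      also have "\<dots> \<le> F h + (d x y + d y h) / \<delta>"
        using triangle[OF xy h] \<delta> by (simp add: divide_right_mono)
      finally show "v x - d x y / \<delta> \<le> F h + d y h / \<delta>" by (simp add: add_divide_distrib)
    qed
    then show ?thesis by linarith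
  qed
  have L: "lipschitz_bound (1 / \<delta>) v"
    unfolding lipschitz_bound_def
  proof (intro conjI ballI)
    show "0 \<le> 1 / \<delta>" using \<delta> by simp
    fix x y assume xy: "x \<in> carrier G" "y \<in> carrier G"
    show "\<bar>v x - v y\<bar> \<le> 1 / \<delta> * d x y"
      using lip1[OF xy] lip1[OF xy(2,1)] by (simp add: commute abs_le_iff)
  qed
  have "\<bar>v g\<bar> \<le> 1" if g: "g \<in> carrier G" for g
    using up[OF g] F[OF g] ge[of 0 g, OF pos] by simp
  then have "v \<in> V" using L unfolding bounded_lipschitz_def by blast
  moreover have "\<bar>v g - F g\<bar> \<le> \<eta>" if "g \<in> carrier G" for g
    using up[OF that] low[OF that] \<eta> by linarith
  ultimately show ?thesis using L by blast
qed

text \<open>Continuity at \<open>(\<one>, y)\<close> gives a radius that serves a whole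
  neighbourhood of \<open>y\<close>; compactness of \<open>X\<close> leaves finitely many radii to
  be respected.\<close>

lemma continuous_action_uniform:
  assumes comp: "compact_space X" and cont: "continuous_map (prod_topology mtopology X) X (\<lambda>(g, x). \<phi> g x)"
    and one: "\<And>x. x \<in> topspace X \<Longrightarrow> \<phi> \<one> x = x"
    and f: "continuous_map X euclideanreal f" and \<epsilon>: "\<epsilon> > 0"
  shows "\<exists>\<delta>>0. \<forall>h\<in>carrier G. d h \<one> < \<delta> \<longrightarrow> (\<forall>x\<in>topspace X. \<bar>f (\<phi> h x) - f x\<bar> < \<epsilon>)"
proof -
  have c: "continuous_map (prod_topology mtopology X) euclideanreal (\<lambda>p. f (case p of (g, x) \<Rightarrow> \<phi> g x))"
    using continuous_map_compose[OF cont f] by (simp add: o_def)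
  have "\<exists>r W. r > 0 \<and> openin X W \<and> y \<in> W \<and> (\<forall>h\<in>carrier G. \<forall>x\<in>W. d h \<one> < r \<longrightarrow> \<bar>f (\<phi> h x) - f y\<bar> < \<epsilon> / 2)"
    if y: "y \<in> topspace X" for y
  proof -
    have mem: "(\<one>, y) \<in> topspace (prod_topology mtopology X)" and e2: "\<epsilon> / 2 > 0" using y \<epsilon> by simp_all
    obtain U where U: "openin (prod_topology mtopology X) U" "(\<one>, y) \<in> U"
      "\<forall>p\<in>U. \<bar>f (case p of (g, x) \<Rightarrow> \<phi> g x) - f y\<bar> < \<epsilon> / 2"
      using c[unfolded continuous_map_euclideanreal_iff, rule_format, OF mem e2]
      unfolding prod.case one[OF y] by blast
    obtain U1 W where U1: "openin mtopology U1" "\<one> \<in> U1" and W: "openin X W" "y \<in> W" and sub: "U1 \<times> W \<subseteq> U"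
      using U(1,2) unfolding openin_prod_topology_alt by meson
    obtain r where r: "r > 0" "mball \<one> r \<subseteq> U1" using U1 unfolding openin_mtopology by blast
    have "\<bar>f (\<phi> h x) - f y\<bar> < \<epsilon> / 2" if "h \<in> carrier G" "x \<in> W" "d h \<one> < r" for h x
    proof -
      have "h \<in> mball \<one> r" using that by (simp add: commute)
      then have "(h, x) \<in> U" using that r sub by blast
      from U(3)[rule_format, OF this] show ?thesis by simp
    qed
    then show ?thesis using r W by blast
  qed
  then obtain r W where rW: "r y > 0" "openin X (W y)" "y \<in> W y"
    "\<forall>h\<in>carrier G. \<forall>x\<in>W y. d h \<one> < r y \<longrightarrow> \<bar>f (\<phi> h x) - f y\<bar> < \<epsilon> / 2" if "y \<in> topspace X" for y
    by metis
  obtain \<F> where \<F>: "finite \<F>" "\<F> \<subseteq> W ` topspace X" "topspace X \<subseteq> \<Union>\<F>"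
    using comp[unfolded compact_space_alt, rule_format, of "W ` topspace X"] rW(2,3) by blast
  then obtain Y where Y: "finite Y" "Y \<subseteq> topspace X" "\<F> = W ` Y" by (meson finite_subset_image)
  define \<delta> where "\<delta> = Min (insert 1 (r ` Y))"
  have "\<delta> > 0" using Y rW(1) by (auto simp: \<delta>_def)
  moreover have "\<bar>f (\<phi> h x) - f x\<bar> < \<epsilon>" if h: "h \<in> carrier G" "d h \<one> < \<delta>" and x: "x \<in> topspace X" for h x
  proof -
    obtain y where y: "y \<in> Y" "x \<in> W y" using \<F>(3) Y(3) x by blast
    have yX: "y \<in> topspace X" using y Y by blast
    have "\<delta> \<le> r y" using y Y by (auto simp: \<delta>_def)
    then have "\<bar>f (\<phi> h x) - f y\<bar> < \<epsilon> / 2" using rW(4)[OF yX] h y by auto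
    \<comment> \<open>The same neighbourhood with \<open>h = \<one>\<close> compares
      \<open>f x\<close> with \<open>f y\<close>.\<close>
    moreover have "\<bar>f (\<phi> \<one> x) - f y\<bar> < \<epsilon> / 2" using rW(4)[OF yX] rW(1)[OF yX] y by auto
    ultimately show ?thesis unfolding one[OF x] by linarith
  qed
  ultimately show ?thesis by blast
qed

text \<open>Chebyshev's argument for means. By invariance \<open>v p\<close> and its translate by
  \<open>k p\<close> have the same mean, and each has variance at most
  \<open>(L p)\<^sup>2 * s\<close>, whence the factor 2. As the sum of all squared deviations has
  mean below \<open>\<epsilon>\<^sup>2\<close>, positivity on \<open>B\<close> yields a point of
  \<open>B\<close> where it is below \<open>\<epsilon>\<^sup>2\<close>, and there every single
  deviation is below \<open>\<epsilon>\<close>.\<close>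

lemma concentrated_common_point:
  assumes conc: "concentrated B s" and K: "finite P" "\<And>p. p \<in> P \<Longrightarrow> k p \<in> B" and B: "B \<subseteq> carrier G"
    and v: "\<And>p. p \<in> P \<Longrightarrow> v p \<in> V" "\<And>p. p \<in> P \<Longrightarrow> lipschitz_bound (L p) (v p)"
    and small: "2 * (\<Sum>p\<in>P. (L p)\<^sup>2) * s < \<epsilon>\<^sup>2" and \<epsilon>: "\<epsilon> > 0"
  shows "\<exists>b\<in>B. \<forall>p\<in>P. \<bar>v p (k p \<otimes> b) - v p b\<bar> < 2 * \<epsilon>"
proof -
  obtain M where M: "mean_on B M" and Minv: "left_invariant B M"
    and Mvar: "\<And>L v. \<lbrakk>v \<in> V; lipschitz_bound L v\<rbrakk> \<Longrightarrow> M (\<lambda>x. (v x)\<^sup>2) - (M v)\<^sup>2 \<le> L\<^sup>2 * s"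
    using conc unfolding concentrated_def by blast
  define w where "w p x = (v p x - M (v p))\<^sup>2 + (v p (k p \<otimes> x) - M (v p))\<^sup>2" for p x
  have kG: "k p \<in> carrier G" if "p \<in> P" for p using K(2)[OF that] B by auto
  note left = bounded_lipschitz_left[OF v(1) kG]
  have sqV: "(\<lambda>x. (u x - c)\<^sup>2) \<in> V" if "u \<in> V" for u c
    by (intro bounded_lipschitz_power2 bounded_lipschitz_diff that bounded_lipschitz_const)
  have wV: "w p \<in> V" if "p \<in> P" for p
    unfolding w_def using that by (intro bounded_lipschitz_add sqV left v(1)) auto
  have dev: "M (\<lambda>x. (u x - M u)\<^sup>2) \<le> l\<^sup>2 * s" if "u \<in> V" "lipschitz_bound l u" for u l
    using mean_square_deviation[OF M that(1), of "M u"] Mvar[OF that] by simp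
  have "M (w p) \<le> 2 * ((L p)\<^sup>2 * s)" if p: "p \<in> P" for p
  proof -
    have "M (\<lambda>x. v p (k p \<otimes> x)) = M (v p)" using Minv K(2)[OF p] v(1)[OF p] by (simp add: left_invariant_def)
    moreover have "M (w p) = M (\<lambda>x. (v p x - M (v p))\<^sup>2) + M (\<lambda>x. (v p (k p \<otimes> x) - M (v p))\<^sup>2)"
      unfolding w_def by (rule mean_add[OF M]) (intro sqV v left p)+
    ultimately show ?thesis
      using dev[OF v(1)[OF p] v(2)[OF p]] dev[OF left[OF p p] lipschitz_bound_left[OF v(2) kG, OF p p]] by simp
  qed
  then have "(\<Sum>p\<in>P. M (w p)) \<le> (\<Sum>p\<in>P. 2 * ((L p)\<^sup>2 * s))" by (rule sum_mono)
  also have "\<dots> = 2 * (\<Sum>p\<in>P. (L p)\<^sup>2) * s" by (simp add: sum_distrib_left sum_distrib_right mult.assoc)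
  finally have less: "M (\<lambda>x. \<Sum>p\<in>P. w p x) < \<epsilon>\<^sup>2"
    using mean_sum[OF M K(1) wV] small by simp
  have "\<exists>b\<in>B. (\<Sum>p\<in>P. w p b) < \<epsilon>\<^sup>2"
  proof (rule ccontr)
    assume "\<not> ?thesis"
    then have "M (\<lambda>_. \<epsilon>\<^sup>2) \<le> M (\<lambda>x. \<Sum>p\<in>P. w p x)"
      by (intro mean_mono[OF M] bounded_lipschitz_const bounded_lipschitz_sum K(1) wV) (auto simp: not_less)
    then show False using less by (simp add: mean_const[OF M])
  qed
  then obtain b where b: "b \<in> B" "(\<Sum>p\<in>P. w p b) < \<epsilon>\<^sup>2" by blast
  have sq: "\<bar>x\<bar> < \<epsilon>" if "x\<^sup>2 < \<epsilon>\<^sup>2" for x :: real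
    using power2_less_imp_less[of "\<bar>x\<bar>" \<epsilon>] that \<epsilon> by simp
  have "\<bar>v p (k p \<otimes> b) - v p b\<bar> < 2 * \<epsilon>" if p: "p \<in> P" for p
  proof -
    have "w p b \<le> (\<Sum>p\<in>P. w p b)" by (rule member_le_sum[OF p _ K(1)]) (simp add: w_def)
    then have "w p b < \<epsilon>\<^sup>2" using b(2) by linarith
    then have "(v p b - M (v p))\<^sup>2 < \<epsilon>\<^sup>2" "(v p (k p \<otimes> b) - M (v p))\<^sup>2 < \<epsilon>\<^sup>2"
      unfolding w_def by (smt (verit) zero_le_power2)+
    from sq[OF this(1)] sq[OF this(2)] show ?thesis by linarith
  qed
  then show ?thesis using b(1) by blast
qed

text \<open>Almost fixed points are found on the orbit of one point \<open>x0\<close>: functions on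
  the orbit pull back to nearly Lipschitz functions on the group, and some element of a concentrated
  set sees almost no change of them under the given translations. Compactness then yields a point
  that no continuous function with values in \<open>[0, 1]\<close> distinguishes from its
  translates, and Urysohn functions separate points.\<close>

theorem extremely_amenable_of_concentration:
  assumes conc: "\<And>K \<delta>. \<lbrakk>finite K; K \<subseteq> carrier G; \<delta> > 0\<rbrakk> \<Longrightarrow>
    \<exists>B s. K \<subseteq> B \<and> B \<subseteq> carrier G \<and> concentrated B s \<and> s \<le> \<delta>"
  shows "extremely_amenable TYPE('x) G mtopology"
  unfolding extremely_amenable_def
proof (intro conjI allI impI)
  show "topological_group G mtopology" by (rule topological_group_metric)
next
  fix X :: "'x topology" and \<phi>
  assume asm: "topspace X \<noteq> {} \<and> compact_space X \<and> Hausdorff_space X \<and> continuous_action G mtopology X \<phi>"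
  then have comp: "compact_space X" and haus: "Hausdorff_space X"
    and act: "group_action G (topspace X) \<phi>"
    and cont: "continuous_map (prod_topology mtopology X) X (\<lambda>(g, x). \<phi> g x)"
    by (auto simp: continuous_action_def)
  interpret act: group_action G "topspace X" \<phi> by fact
  obtain x0 where x0: "x0 \<in> topspace X" using asm by blast
  have one: "\<phi> \<one> x = x" if "x \<in> topspace X" for x
    using act.id_eq_one that by (metis restrict_apply')
  have \<phi>X: "\<phi> g x \<in> topspace X" if "g \<in> carrier G" "x \<in> topspace X" for g x
    using act.element_image that by blast
  have \<phi>g: "continuous_map X X (\<phi> g)" if "g \<in> carrier G" for g
  proof -
    have "continuous_map X (prod_topology mtopology X) (\<lambda>x. (g, x))"
      using that by (intro continuous_map_pairedI) auto
    from continuous_map_compose[OF this cont] show ?thesis by (simp add: o_def)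
  qed
  define \<Q> where "\<Q> = {f. continuous_map X euclideanreal f \<and> f ` topspace X \<subseteq> {0..1}} \<times> carrier G \<times> (UNIV :: nat set)"
  define C where "C = (\<lambda>(f, k, n :: nat). {x \<in> topspace X. f (\<phi> k x) - f x \<in> {- (1 / Suc n)..1 / Suc n}})"
  have "closedin X (C q)" if q: "q \<in> \<Q>" for q
  proof -
    obtain f k n where [simp]: "q = (f, k, n)" and f: "continuous_map X euclideanreal f" and k: "k \<in> carrier G"
      using q by (auto simp: \<Q>_def)
    have "continuous_map X euclideanreal (\<lambda>x. f (\<phi> k x) - f x)"
      using continuous_map_compose[OF \<phi>g[OF k] f] f by (intro continuous_map_diff) (simp_all add: o_def)
    then show ?thesis
      unfolding C_def by simp (rule closedin_continuous_map_preimage[of _ euclideanreal _ "{_.._}", simplified], auto)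
  qed
  moreover have "\<Inter>\<F> \<noteq> {}" if \<F>: "finite \<F>" "\<F> \<subseteq> C ` \<Q>" for \<F>
  proof -
    obtain P where P: "finite P" "P \<subseteq> \<Q>" "\<F> = C ` P"
      using \<F> by (meson finite_subset_image)
    define N where "N = Max (insert 0 ((\<lambda>p. snd (snd p)) ` P))"
    define \<epsilon> where "\<epsilon> = 1 / real (Suc N)"
    have \<epsilon>: "\<epsilon> > 0" by (simp add: \<epsilon>_def)
    define F where "F p g = fst p (\<phi> g x0)" for p :: "('x \<Rightarrow> real) \<times> 'a \<times> nat" and g
    have PF: "continuous_map X euclideanreal (fst p)" "fst p ` topspace X \<subseteq> {0..1}" "fst (snd p) \<in> carrier G"
      if "p \<in> P" for p
    proof -
      have "p \<in> \<Q>" using that P(2) by blast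
      then show "continuous_map X euclideanreal (fst p)" "fst p ` topspace X \<subseteq> {0..1}" "fst (snd p) \<in> carrier G"
        by (auto simp: \<Q>_def mem_Times_iff)
    qed
    have "\<exists>v L. v \<in> V \<and> lipschitz_bound L v \<and> (\<forall>g\<in>carrier G. \<bar>v g - F p g\<bar> \<le> \<epsilon> / 4)" if p: "p \<in> P" for p
    proof -
      obtain \<delta> where \<delta>: "\<delta> > 0" "\<forall>h\<in>carrier G. d h \<one> < \<delta> \<longrightarrow> (\<forall>x\<in>topspace X. \<bar>fst p (\<phi> h x) - fst p x\<bar> < \<epsilon> / 4)"
        using continuous_action_uniform[OF comp cont one PF(1)[OF p], of "\<epsilon> / 4"] \<epsilon> by auto
      show ?thesis
      proof (rule lipschitz_approximation[OF \<delta>(1)])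
        show "0 \<le> \<epsilon> / 4" using \<epsilon> by simp
        show "F p g \<in> {0..1}" if "g \<in> carrier G" for g
          using PF(2)[OF p] \<phi>X[OF that x0] by (auto simp: F_def)
        fix g h assume gh: "g \<in> carrier G" "h \<in> carrier G" "d g h < \<delta>"
        \<comment> \<open>By right invariance \<open>d g h\<close> is the distance of
          \<open>k\<close> from \<open>\<one>\<close>, so uniformity of the action near
          \<open>\<one>\<close> gives uniform continuity of \<open>F p\<close> on the whole
          group.\<close>
        define k where "k = g \<otimes> inv h"
        have k: "k \<in> carrier G" "k \<otimes> h = g" using gh by (simp_all add: k_def m_assoc)
        have "d k \<one> = d g h" using dist_right[of k \<one> h] k gh by simp
        then have "\<bar>fst p (\<phi> k (\<phi> h x0)) - fst p (\<phi> h x0)\<bar> < \<epsilon> / 4"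
          using \<delta>(2) k gh \<phi>X[OF gh(2) x0] by auto
        moreover have "\<phi> k (\<phi> h x0) = \<phi> g x0"
          using act.composition_rule[OF x0 k(1) gh(2)] k(2) by simp
        ultimately show "\<bar>F p g - F p h\<bar> \<le> \<epsilon> / 4" by (simp add: F_def)
      qed
    qed
    then obtain v L where v: "v p \<in> V" "lipschitz_bound (L p) (v p)"
      "\<forall>g\<in>carrier G. \<bar>v p g - F p g\<bar> \<le> \<epsilon> / 4" if "p \<in> P" for p by metis
    define S where "S = (\<Sum>p\<in>P. (L p)\<^sup>2)"
    have S: "S \<ge> 0" by (simp add: S_def sum_nonneg)
    \<comment> \<open>Makes \<open>2 * S * \<delta>\<close> smaller than
      \<open>(\<epsilon> / 4)\<^sup>2\<close>, also when \<open>S = 0\<close>.\<close>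
    define \<delta> where "\<delta> = (\<epsilon> / 4)\<^sup>2 / (4 * (S + 1))"
    have \<delta>: "\<delta> > 0" using S \<epsilon> by (simp add: \<delta>_def)
    have "finite ((\<lambda>p. fst (snd p)) ` P)" "(\<lambda>p. fst (snd p)) ` P \<subseteq> carrier G" using P(1) PF(3) by auto
    from conc[OF this \<delta>] obtain B s where B: "(\<lambda>p. fst (snd p)) ` P \<subseteq> B" "B \<subseteq> carrier G" "concentrated B s" "s \<le> \<delta>"
      by blast
    have "2 * S * s \<le> 2 * S * \<delta>" using S B(4) by (intro mult_left_mono) auto
    also have "\<dots> < (\<epsilon> / 4)\<^sup>2"
    proof -
      have "2 * S < 4 * (S + 1)" using S by simp
      then have "2 * S / (4 * (S + 1)) < 1" using S by simp
      then have "2 * S / (4 * (S + 1)) * (\<epsilon> / 4)\<^sup>2 < 1 * (\<epsilon> / 4)\<^sup>2" using \<epsilon> by (intro mult_strict_right_mono) auto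
      then show ?thesis by (simp add: \<delta>_def)
    qed
    finally have small: "2 * (\<Sum>p\<in>P. (L p)\<^sup>2) * s < (\<epsilon> / 4)\<^sup>2" by (simp add: S_def)
    obtain b where b: "b \<in> B" "\<forall>p\<in>P. \<bar>v p (fst (snd p) \<otimes> b) - v p b\<bar> < 2 * (\<epsilon> / 4)"
      using concentrated_common_point[OF B(3) P(1) _ B(2) v(1,2) small, of "\<lambda>p. fst (snd p)"] B(1) \<epsilon> by auto
    have bG: "b \<in> carrier G" using b B by auto
    have "\<phi> b x0 \<in> C p" if p: "p \<in> P" for p
    proof -
      obtain f k n where pe [simp]: "p = (f, k, n)" by (metis prod_cases3)
      have k: "k \<in> carrier G" using PF(3)[OF p] by simp
      have kb: "k \<otimes> b \<in> carrier G" using k bG by simp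
      \<comment> \<open>The error budget: a quarter of \<open>\<epsilon>\<close> for each of the two
        Lipschitz approximations and half of it for the translation.\<close>
      have tri: "\<bar>s' - t'\<bar> < e" if "\<bar>s - t\<bar> < 2 * (e / 4)" "\<bar>s - s'\<bar> \<le> e / 4" "\<bar>t - t'\<bar> \<le> e / 4"
        for s t s' t' e :: real using that by linarith
      have "\<bar>F p (k \<otimes> b) - F p b\<bar> < \<epsilon>"
        using b(2)[rule_format, OF p] v(3)[OF p, rule_format, OF kb] v(3)[OF p, rule_format, OF bG] pe
        by (intro tri[of "v p (k \<otimes> b)" "v p b" \<epsilon>]) (simp_all only: fst_conv snd_conv)
      moreover have "n \<le> N"
        unfolding N_def using p P(1) by (intro Max_ge) force+
      then have "\<epsilon> \<le> 1 / Suc n" unfolding \<epsilon>_def by (intro divide_left_mono) auto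
      moreover have "\<phi> (k \<otimes> b) x0 = \<phi> k (\<phi> b x0)" by (rule act.composition_rule[OF x0 k bG])
      ultimately show ?thesis using \<phi>X[OF bG x0] by (simp add: C_def F_def abs_less_iff)
    qed
    then show ?thesis unfolding P(3) by blast
  qed
  ultimately have "(\<forall>Q\<in>C ` \<Q>. closedin X Q) \<and> (\<forall>\<F>. finite \<F> \<and> \<F> \<subseteq> C ` \<Q> \<longrightarrow> \<Inter>\<F> \<noteq> {})"
    by simp
  then have ne: "\<Inter>(C ` \<Q>) \<noteq> {}"
    by (rule comp[unfolded compact_space_fip, THEN spec, THEN mp])
  have q0: "(\<lambda>_. 0, \<one>, 0) \<in> \<Q>" by (auto simp: \<Q>_def)
  obtain x where x: "\<And>q. q \<in> \<Q> \<Longrightarrow> x \<in> C q" using ne by blast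
  have xX: "x \<in> topspace X" using x[OF q0] by (simp add: C_def)
  have "\<phi> k x = x" if k: "k \<in> carrier G" for k
  proof (rule ccontr)
    assume neq: "\<phi> k x \<noteq> x"
    have t1: "t1_space X" by (rule Hausdorff_imp_t1_space[OF haus])
    have "normal_space X" by (rule compact_Hausdorff_or_regular_imp_normal_space[OF comp]) (use haus in blast)
    moreover have "closedin X {x}" "closedin X {\<phi> k x}"
      using t1 xX \<phi>X[OF k xX] by (simp_all add: t1_space_closedin_singleton)
    moreover have "disjnt {x} {\<phi> k x}" using neq by simp
    ultimately obtain f :: "'x \<Rightarrow> real" where f: "continuous_map X (top_of_set {0..1}) f" "f ` {x} \<subseteq> {0}" "f ` {\<phi> k x} \<subseteq> {1}"
      by (rule Urysohn_lemma[of X "{x}" "{\<phi> k x}" 0 1]) auto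
    \<comment> \<open>Index 1 stands for accuracy 1/2, which the values 0 and 1 of \<open>f\<close>
      violate; index 0 would not exclude them.\<close>
    then have "(f, k, 1) \<in> \<Q>" using k by (auto simp: \<Q>_def continuous_map_in_subtopology)
    from x[OF this] f(2,3) show False by (simp add: C_def)
  qed
  then show "\<exists>x\<in>topspace X. \<forall>g\<in>carrier G. \<phi> g x = x" using xX by blast
qed

end

section \<open>Regular rings and their rank functions\<close>

locale von_neumann_regular_ring = ring R for R (structure) +
  assumes regular: "a \<in> carrier R \<Longrightarrow> \<exists>b\<in>carrier R. a \<otimes> b \<otimes> a = a"
begin

abbreviation "PI \<equiv> principal_right_ideal R"

lemma diff_zero_iff:
  assumes "x \<in> carrier R" "y \<in> carrier R" shows "x \<ominus> y = \<zero> \<longleftrightarrow> x = y"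
proof
  assume "x \<ominus> y = \<zero>"
  moreover have "x = (x \<ominus> y) \<oplus> y" using assms by (simp add: minus_eq a_assoc l_neg)
  ultimately show "x = y" using assms by simp
qed (use assms in \<open>simp add: minus_eq r_neg\<close>)

definition Lat :: "'a set set" where "Lat = PI ` carrier R"

lemma PI_iff: "x \<in> PI a \<longleftrightarrow> (\<exists>y\<in>carrier R. x = a \<otimes> y)"
  by (auto simp: principal_right_ideal_def)

lemma PI_self: "a \<in> carrier R \<Longrightarrow> a \<in> PI a"
  using PI_iff r_one by (metis one_closed)

lemma PI_in_Lat [intro, simp]: "a \<in> carrier R \<Longrightarrow> PI a \<in> Lat"
  by (simp add: Lat_def)

lemma PI_subset_iff:
  assumes "a \<in> carrier R" "b \<in> carrier R" shows "PI a \<subseteq> PI b \<longleftrightarrow> a \<in> PI b"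
proof
  assume "a \<in> PI b"
  then obtain y where "y \<in> carrier R" "a = b \<otimes> y" by (auto simp: PI_iff)
  then show "PI a \<subseteq> PI b" using assms by (auto simp: PI_iff m_assoc intro!: bexI[of _ "y \<otimes> _"])
qed (use assms PI_self in blast)

lemma Lat_closed:
  assumes "U \<in> Lat"
  shows "U \<subseteq> carrier R" "\<zero> \<in> U" "\<lbrakk>x \<in> U; y \<in> carrier R\<rbrakk> \<Longrightarrow> x \<otimes> y \<in> U"
    "\<lbrakk>x \<in> U; y \<in> U\<rbrakk> \<Longrightarrow> x \<oplus> y \<in> U" "x \<in> U \<Longrightarrow> \<ominus> x \<in> U" "\<lbrakk>x \<in> U; y \<in> U\<rbrakk> \<Longrightarrow> x \<ominus> y \<in> U"
proof -
  obtain a where a: "a \<in> carrier R" "U = PI a" using assms by (auto simp: Lat_def)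
  show "U \<subseteq> carrier R" using a by (auto simp: PI_iff)
  show "\<zero> \<in> U" using a r_null[of a] unfolding a(2) PI_iff by (metis zero_closed)
  show "x \<otimes> y \<in> U" if "x \<in> U" "y \<in> carrier R" for x y
    using that a by (auto simp: PI_iff m_assoc intro!: bexI[of _ "_ \<otimes> y"])
  show add: "x \<oplus> y \<in> U" if "x \<in> U" "y \<in> U" for x y
    using that a unfolding a(2) PI_iff by (metis add.m_closed r_distr)
  show neg: "\<ominus> x \<in> U" if "x \<in> U" for x
    using that a unfolding a(2) PI_iff by (metis add.inv_closed r_minus)
  show "x \<ominus> y \<in> U" if "x \<in> U" "y \<in> U" for x y
    using add neg that by (simp add: minus_eq)
qed

lemma PI_subset_Lat: "\<lbrakk>U \<in> Lat; a \<in> U\<rbrakk> \<Longrightarrow> PI a \<subseteq> U"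
  using Lat_closed(3) by (auto simp: PI_iff)

lemma PI_zero: "PI \<zero> = {\<zero>}"
  using PI_self[of \<zero>] by (auto simp: PI_iff)

lemma PI_one: "PI \<one> = carrier R"
  by (auto simp: PI_iff intro!: bexI)

lemma idem_PI_iff:
  assumes "e \<in> idempotents R"
  shows "x \<in> PI e \<longleftrightarrow> x \<in> carrier R \<and> e \<otimes> x = x"
proof -
  have e: "e \<in> carrier R" "e \<otimes> e = e" using assms by (auto simp: idempotents_def)
  show ?thesis
  proof
    assume "x \<in> PI e"
    then obtain y where "y \<in> carrier R" "x = e \<otimes> y" by (auto simp: PI_iff)
    then show "x \<in> carrier R \<and> e \<otimes> x = x" using e by (simp add: m_assoc[symmetric])
  qed (auto simp: PI_iff intro!: bexI[of _ x])
qed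

lemma idempotent_complement:
  assumes "e \<in> idempotents R"
  shows "\<one> \<ominus> e \<in> idempotents R" "e \<otimes> (\<one> \<ominus> e) = \<zero>" "(\<one> \<ominus> e) \<otimes> e = \<zero>"
proof -
  have e: "e \<in> carrier R" "e \<otimes> e = e" using assms by (auto simp: idempotents_def)
  show 1: "e \<otimes> (\<one> \<ominus> e) = \<zero>" "(\<one> \<ominus> e) \<otimes> e = \<zero>"
    using e by (simp_all add: minus_eq r_distr l_distr r_minus l_minus r_neg)
  have "(\<one> \<ominus> e) \<otimes> (\<one> \<ominus> e) = (\<one> \<ominus> e) \<ominus> (\<one> \<ominus> e) \<otimes> e"
    using e(1) by (simp add: minus_eq r_distr r_minus)
  then show "\<one> \<ominus> e \<in> idempotents R" using 1 e(1) by (simp add: idempotents_def minus_eq)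
qed

lemma PI_generated_by_idempotent:
  assumes "a \<in> carrier R"
  obtains e b where "e \<in> idempotents R" "PI e = PI a" "e \<otimes> a = a" "b \<in> carrier R" "e = a \<otimes> b"
proof -
  obtain b where b: "b \<in> carrier R" "a \<otimes> b \<otimes> a = a" using regular[OF assms] by blast
  define e where "e = a \<otimes> b"
  have e: "e \<in> carrier R" "e \<otimes> a = a" using assms b by (simp_all add: e_def)
  have "e \<otimes> e = e \<otimes> a \<otimes> b"
    using assms b(1) e(1) by (subst (2) e_def) (simp add: m_assoc)
  then have idem: "e \<in> idempotents R" using e by (simp add: idempotents_def e_def)
  have "e \<in> PI a" using b by (auto simp: PI_iff e_def)
  moreover have "a \<in> PI e" using e assms idem by (simp add: idem_PI_iff)
  ultimately have "PI e = PI a" using assms e PI_subset_iff by blast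
  then show thesis using that idem e b by (simp add: e_def)
qed

lemma Lat_idempotent:
  assumes "U \<in> Lat"
  obtains e where "e \<in> idempotents R" "U = PI e"
proof -
  obtain a where a: "a \<in> carrier R" "U = PI a" using assms by (auto simp: Lat_def)
  show thesis using PI_generated_by_idempotent[OF a(1)] that a(2) by metis
qed

lemma idempotentsD: "e \<in> idempotents R \<Longrightarrow> e \<in> carrier R \<and> e \<otimes> e = e"
  by (auto simp: idempotents_def)

text \<open>The element \<open>v \<otimes> c\<close> is an idempotent with the same right
  annihilator as \<open>c\<close>, so the complementary idempotent generates this
  annihilator.\<close>

lemma right_annihilator_principal:
  assumes c: "c \<in> carrier R" and v: "v \<in> carrier R" "c \<otimes> v \<otimes> c = c"
  shows "{x \<in> carrier R. c \<otimes> x = \<zero>} = PI (\<one> \<ominus> v \<otimes> c)"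
proof (intro equalityI subsetI)
  fix x assume "x \<in> {x \<in> carrier R. c \<otimes> x = \<zero>}"
  then have x: "x \<in> carrier R" "c \<otimes> x = \<zero>" by auto
  then have "(\<one> \<ominus> v \<otimes> c) \<otimes> x = x"
    using c v(1) by (simp add: minus_eq l_distr l_minus m_assoc)
  then show "x \<in> PI (\<one> \<ominus> v \<otimes> c)" using x by (metis PI_iff)
next
  fix x assume "x \<in> PI (\<one> \<ominus> v \<otimes> c)"
  then obtain y where y: "y \<in> carrier R" "x = (\<one> \<ominus> v \<otimes> c) \<otimes> y" by (auto simp: PI_iff)
  have "c \<otimes> (\<one> \<ominus> v \<otimes> c) = \<zero>"
    using c v by (simp add: minus_eq r_distr r_minus m_assoc[symmetric] r_neg)
  then show "x \<in> {x \<in> carrier R. c \<otimes> x = \<zero>}" using y c v by (simp add: m_assoc[symmetric])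
qed

lemma right_annihilator_in_Lat:
  assumes "c \<in> carrier R" shows "{x \<in> carrier R. c \<otimes> x = \<zero>} \<in> Lat"
proof -
  obtain v where "v \<in> carrier R" "c \<otimes> v \<otimes> c = c" using regular[OF assms] by blast
  then show ?thesis using right_annihilator_principal[OF assms] assms by simp
qed

text \<open>An element of \<open>U = PI e\<close> lies in \<open>W = PI f\<close> if and only if
  \<open>(\<one> \<ominus> f) \<otimes> e\<close> annihilates it. Hence the intersection is the
  image under \<open>e\<close> of the right annihilator of that product, which is principal.\<close>

lemma Lat_Int:
  assumes "U \<in> Lat" "W \<in> Lat" shows "U \<inter> W \<in> Lat"
proof -
  obtain e where e: "e \<in> idempotents R" "U = PI e" using Lat_idempotent[OF assms(1)] .
  obtain f where f: "f \<in> idempotents R" "W = PI f" using Lat_idempotent[OF assms(2)] .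
  have ef: "e \<in> carrier R" "f \<in> carrier R" "e \<otimes> e = e" "f \<otimes> f = f" using e f idempotentsD by auto
  define c where "c = (\<one> \<ominus> f) \<otimes> e"
  have c: "c \<in> carrier R" using ef by (simp add: c_def)
  obtain v where v: "v \<in> carrier R" "c \<otimes> v \<otimes> c = c" using regular[OF c] by blast
  have ann: "c \<otimes> x = \<zero> \<longleftrightarrow> (\<exists>y\<in>carrier R. x = (\<one> \<ominus> v \<otimes> c) \<otimes> y)" if "x \<in> carrier R" for x
    using right_annihilator_principal[OF c v] that PI_iff[of x "\<one> \<ominus> v \<otimes> c"] by blast
  have "U \<inter> W = PI (e \<otimes> (\<one> \<ominus> v \<otimes> c))"
  proof (intro equalityI subsetI)
    fix x assume "x \<in> U \<inter> W"
    then have x: "x \<in> carrier R" "e \<otimes> x = x" "f \<otimes> x = x" using e f by (auto simp: idem_PI_iff)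
    have "c \<otimes> x = (\<one> \<ominus> f) \<otimes> x" using x ef by (simp add: c_def m_assoc)
    also have "\<dots> = \<zero>" using x ef by (simp add: minus_eq l_distr l_minus r_neg)
    finally obtain y where "y \<in> carrier R" "x = (\<one> \<ominus> v \<otimes> c) \<otimes> y" using ann x by blast
    then have "x = (e \<otimes> (\<one> \<ominus> v \<otimes> c)) \<otimes> y" using x(2) ef c v(1) by (metis m_assoc minus_closed m_closed one_closed)
    then show "x \<in> PI (e \<otimes> (\<one> \<ominus> v \<otimes> c))" using \<open>y \<in> carrier R\<close> by (auto simp: PI_iff)
  next
    fix x assume "x \<in> PI (e \<otimes> (\<one> \<ominus> v \<otimes> c))"
    then obtain y where y: "y \<in> carrier R" "x = e \<otimes> (\<one> \<ominus> v \<otimes> c) \<otimes> y" by (auto simp: PI_iff)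
    define z where "z = (\<one> \<ominus> v \<otimes> c) \<otimes> y"
    have z: "z \<in> carrier R" using y c v by (simp add: z_def)
    have xz: "x = e \<otimes> z" using y ef c v by (simp add: z_def m_assoc)
    have xR: "x \<in> carrier R" using xz z ef by simp
    have ex: "e \<otimes> x = x" using xz z ef by (simp add: m_assoc[symmetric])
    have "c \<otimes> z = \<zero>" using ann[OF z] y(1) z_def by blast
    then have "(\<one> \<ominus> f) \<otimes> x = \<zero>" using xz z ef by (simp add: c_def m_assoc)
    then have "x \<ominus> f \<otimes> x = \<zero>" using xR ef by (simp add: minus_eq l_distr l_minus)
    then have "f \<otimes> x = x" using xR ef by (metis diff_zero_iff m_closed)
    then show "x \<in> U \<inter> W" using ex xR e f by (simp add: idem_PI_iff)
  qed
  then show ?thesis using ef c v by simp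
qed

text \<open>Gram--Schmidt for right ideals: only the part
  \<open>(\<one> \<ominus> e) \<otimes> b\<close> of \<open>b\<close> contributes something new to
  the sum.\<close>

lemma orthogonal_generators:
  assumes a: "a \<in> carrier R" and b: "b \<in> carrier R"
  obtains e f where "e \<in> idempotents R" "f \<in> idempotents R" "e \<otimes> f = \<zero>" "f \<otimes> e = \<zero>"
    "PI e = PI a" "PI f = PI ((\<one> \<ominus> e) \<otimes> b)" "PI (e \<oplus> f) = PI a <+>\<^bsub>R\<^esub> PI b" "e \<oplus> f \<in> idempotents R"
proof -
  obtain e where e: "e \<in> idempotents R" "PI e = PI a" using PI_generated_by_idempotent[OF a] by blast
  have eR: "e \<in> carrier R" "e \<otimes> e = e" using e idempotentsD by auto
  define c where "c = (\<one> \<ominus> e) \<otimes> b"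
  have c: "c \<in> carrier R" using eR b by (simp add: c_def)
  have ec: "e \<otimes> c = \<zero>"
    using idempotent_complement(2)[OF e(1)] eR b by (simp add: c_def m_assoc[symmetric])
  obtain g w where g: "g \<in> idempotents R" "PI g = PI c" "w \<in> carrier R" "g = c \<otimes> w" "g \<otimes> c = c"
    using PI_generated_by_idempotent[OF c] by metis
  have gR: "g \<in> carrier R" "g \<otimes> g = g" using g idempotentsD by auto
  have eg: "e \<otimes> g = \<zero>" using ec g eR c by (simp add: m_assoc[symmetric])
  \<comment> \<open>The idempotent \<open>g\<close> is orthogonal to \<open>e\<close> on one side
    only, \<open>e \<otimes> g = \<zero>\<close>. The factor \<open>\<one> \<ominus> e\<close> adds
    orthogonality on the other side and keeps the right ideal, because
    \<open>f \<otimes> g = g\<close> and \<open>g \<otimes> f = f\<close>.\<close>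
  define f where "f = g \<otimes> (\<one> \<ominus> e)"
  have fR: "f \<in> carrier R" using gR eR by (simp add: f_def)
  have ef: "e \<otimes> f = \<zero>" using eg eR gR by (simp add: f_def m_assoc[symmetric])
  have fe: "f \<otimes> e = \<zero>" using idempotent_complement(3)[OF e(1)] eR gR by (simp add: f_def m_assoc)
  have f1: "f = g \<ominus> g \<otimes> e" using eR gR by (simp add: f_def minus_eq r_distr r_minus)
  have fg: "f \<otimes> g = g"
    unfolding f1 using eg eR gR by (simp add: minus_eq l_distr l_minus m_assoc)
  have "g \<otimes> f = f" using gR eR by (simp add: f_def m_assoc[symmetric])
  then have ff: "f \<otimes> f = f" using fg gR eR by (simp add: f_def m_assoc[symmetric])
  then have f: "f \<in> idempotents R" using fR by (simp add: idempotents_def)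
  have "g \<in> PI f" using idem_PI_iff[OF f] fg gR by blast
  moreover have "f \<in> PI g" using idem_PI_iff[OF g(1)] \<open>g \<otimes> f = f\<close> fR by blast
  ultimately have PIf: "PI f = PI c" using g(2) gR fR PI_subset_iff by blast
  have h: "e \<oplus> f \<in> idempotents R"
    using eR fR ef fe ff by (simp add: idempotents_def l_distr r_distr)
  have "PI (e \<oplus> f) = PI a <+>\<^bsub>R\<^esub> PI b"
  proof (intro equalityI subsetI)
    fix x assume "x \<in> PI (e \<oplus> f)"
    then obtain y where y: "y \<in> carrier R" "x = (e \<oplus> f) \<otimes> y" by (auto simp: PI_iff)
    have "f \<in> PI c" using PIf PI_self fR by blast
    then obtain u where u: "u \<in> carrier R" "f = c \<otimes> u" by (auto simp: PI_iff)
    have fu: "f = b \<otimes> u \<ominus> e \<otimes> b \<otimes> u" using u eR b by (simp add: c_def minus_eq l_distr l_minus)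
    have "x = e \<otimes> y \<oplus> f \<otimes> y" using y eR fR by (simp add: l_distr)
    also have "f \<otimes> y = b \<otimes> (u \<otimes> y) \<ominus> e \<otimes> (b \<otimes> u \<otimes> y)"
      unfolding fu using u y eR b by (simp add: minus_eq l_distr l_minus m_assoc)
    also have "e \<otimes> y \<oplus> (b \<otimes> (u \<otimes> y) \<ominus> e \<otimes> (b \<otimes> u \<otimes> y)) = e \<otimes> (y \<ominus> b \<otimes> u \<otimes> y) \<oplus> b \<otimes> (u \<otimes> y)"
      using u y eR b by (simp add: minus_eq r_distr r_minus a_ac)
    finally have "x = e \<otimes> (y \<ominus> b \<otimes> u \<otimes> y) \<oplus> b \<otimes> (u \<otimes> y)" .
    moreover have "e \<otimes> (y \<ominus> b \<otimes> u \<otimes> y) \<in> PI a"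
      unfolding e(2)[symmetric] PI_iff using u y b by blast
    moreover have "b \<otimes> (u \<otimes> y) \<in> PI b" unfolding PI_iff using u y by blast
    ultimately show "x \<in> PI a <+>\<^bsub>R\<^esub> PI b" by (auto simp: set_add_def')
  next
    fix x assume "x \<in> PI a <+>\<^bsub>R\<^esub> PI b"
    then obtain p q where pq: "p \<in> PI a" "q \<in> PI b" "x = p \<oplus> q" by (auto simp: set_add_def')
    have p: "p \<in> carrier R" "e \<otimes> p = p" using pq(1)[folded e(2)] idem_PI_iff[OF e(1)] by blast+
    obtain y where y: "y \<in> carrier R" "q = b \<otimes> y" using pq(2) by (auto simp: PI_iff)
    have q: "q \<in> carrier R" using y b by simp
    have fp: "f \<otimes> p = \<zero>" using p fe fR eR by (metis m_assoc l_null)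
    have "c \<otimes> y \<in> PI f" unfolding PIf PI_iff using y by blast
    then have fcy: "f \<otimes> (c \<otimes> y) = c \<otimes> y" using f by (simp add: idem_PI_iff)
    have cy: "c \<otimes> y = q \<ominus> e \<otimes> q" using y eR b by (simp add: c_def minus_eq l_distr l_minus m_assoc)
    have "f \<otimes> (c \<otimes> y) = f \<otimes> q \<ominus> f \<otimes> e \<otimes> q" using cy fR eR q by (simp add: minus_eq r_distr r_minus m_assoc)
    then have fq: "f \<otimes> q = q \<ominus> e \<otimes> q" using fcy cy fe fR q by (simp add: minus_eq)
    have "(e \<oplus> f) \<otimes> x = (e \<otimes> p \<oplus> f \<otimes> p) \<oplus> (e \<otimes> q \<oplus> f \<otimes> q)"
      using pq(3) p q eR fR by (simp add: l_distr r_distr a_ac)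
    also have "\<dots> = x" using p q fp fq pq(3) eR by (simp add: minus_eq a_ac r_neg1 r_neg2 r_neg)
    finally show "x \<in> PI (e \<oplus> f)" using h p q pq(3) by (simp add: idem_PI_iff)
  qed
  with e f ef fe PIf h show thesis using that by (simp add: c_def)
qed

lemma Lat_sum:
  assumes "U \<in> Lat" "W \<in> Lat" shows "U <+>\<^bsub>R\<^esub> W \<in> Lat"
proof -
  obtain a b where ab: "a \<in> carrier R" "b \<in> carrier R" "U = PI a" "W = PI b" using assms by (auto simp: Lat_def)
  show ?thesis using orthogonal_generators[OF ab(1,2)] ab idempotentsD by (metis PI_in_Lat)
qed

lemma set_addI: "\<lbrakk>u \<in> U; w \<in> W\<rbrakk> \<Longrightarrow> u \<oplus> w \<in> U <+>\<^bsub>R\<^esub> W"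
  by (auto simp: set_add_def')

lemma Lat_sum_upper:
  assumes "U \<in> Lat" "W \<in> Lat" shows "U \<subseteq> U <+>\<^bsub>R\<^esub> W" "W \<subseteq> U <+>\<^bsub>R\<^esub> W"
proof -
  show "U \<subseteq> U <+>\<^bsub>R\<^esub> W"
  proof
    fix x assume "x \<in> U"
    then show "x \<in> U <+>\<^bsub>R\<^esub> W"
      using set_addI[of x U \<zero> W] Lat_closed(1)[OF assms(1)] Lat_closed(2)[OF assms(2)] by auto
  qed
  show "W \<subseteq> U <+>\<^bsub>R\<^esub> W"
  proof
    fix x assume "x \<in> W"
    then show "x \<in> U <+>\<^bsub>R\<^esub> W"
      using set_addI[of \<zero> U x W] Lat_closed(1)[OF assms(2)] Lat_closed(2)[OF assms(1)] by auto
  qed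
qed

lemma Lat_sum_least: "\<lbrakk>T \<in> Lat; U \<subseteq> T; W \<subseteq> T\<rbrakk> \<Longrightarrow> U <+>\<^bsub>R\<^esub> W \<subseteq> T"
  unfolding set_add_def' using Lat_closed(4) by blast

lemma set_addE:
  assumes "x \<in> U <+>\<^bsub>R\<^esub> W" obtains u w where "u \<in> U" "w \<in> W" "x = u \<oplus> w"
  using assms by (auto simp: set_add_def')

end

section \<open>Subadditivity of the rank, and the rank of right ideals\<close>

locale ranked_ring = von_neumann_regular_ring +
  fixes \<rho> :: "'a \<Rightarrow> real"
  assumes rank_function: "rank_function R \<rho>"
begin

lemma rho_nonneg: "a \<in> carrier R \<Longrightarrow> 0 \<le> \<rho> a"
  and rho_le_one: "a \<in> carrier R \<Longrightarrow> \<rho> a \<le> 1"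
  and rho_one: "\<rho> \<one> = 1"
  and rho_mult_left: "\<lbrakk>a \<in> carrier R; b \<in> carrier R\<rbrakk> \<Longrightarrow> \<rho> (a \<otimes> b) \<le> \<rho> a"
  and rho_mult_right: "\<lbrakk>a \<in> carrier R; b \<in> carrier R\<rbrakk> \<Longrightarrow> \<rho> (a \<otimes> b) \<le> \<rho> b"
  and rho_orthogonal: "\<lbrakk>e \<in> idempotents R; f \<in> idempotents R; e \<otimes> f = \<zero>; f \<otimes> e = \<zero>\<rbrakk> \<Longrightarrow> \<rho> (e \<oplus> f) = \<rho> e + \<rho> f"
  and rho_pos: "\<lbrakk>a \<in> carrier R; a \<noteq> \<zero>\<rbrakk> \<Longrightarrow> 0 < \<rho> a"
  using rank_function unfolding rank_function_def by (auto simp: Pi_iff)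

lemma rho_zero: "\<rho> \<zero> = 0"
  using rho_orthogonal[of \<zero> \<zero>] by (simp add: idempotents_def)

lemma rho_eq_0_iff: "a \<in> carrier R \<Longrightarrow> \<rho> a = 0 \<longleftrightarrow> a = \<zero>"
  using rho_pos rho_zero by force

lemma rho_mono:
  assumes "a \<in> carrier R" "b \<in> carrier R" "PI a \<subseteq> PI b" shows "\<rho> a \<le> \<rho> b"
proof -
  obtain y where "y \<in> carrier R" "a = b \<otimes> y" using assms PI_subset_iff by (auto simp: PI_iff)
  then show ?thesis using rho_mult_left assms by simp
qed

lemma rho_cong: "\<lbrakk>a \<in> carrier R; b \<in> carrier R; PI a = PI b\<rbrakk> \<Longrightarrow> \<rho> a = \<rho> b"
  by (rule antisym; rule rho_mono) auto

lemma rho_uminus: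
  assumes "a \<in> carrier R" shows "\<rho> (\<ominus> a) = \<rho> a"
proof -
  have le: "\<rho> (\<ominus> x) \<le> \<rho> x" if "x \<in> carrier R" for x
    using rho_mult_left[of x "\<ominus> \<one>"] that by (simp add: r_minus)
  show ?thesis using le[OF assms] le[of "\<ominus> a"] assms by simp
qed

text \<open>A rank function is additive on orthogonal idempotents, so orthogonal generators are put
  in place of \<open>a\<close> and \<open>b\<close>; the second has rank at most
  \<open>\<rho> b\<close>.\<close>

lemma rho_add_le:
  assumes "a \<in> carrier R" "b \<in> carrier R" shows "\<rho> (a \<oplus> b) \<le> \<rho> a + \<rho> b"
proof -
  obtain e f where ef: "e \<in> idempotents R" "f \<in> idempotents R" "e \<otimes> f = \<zero>" "f \<otimes> e = \<zero>"
    "PI e = PI a" "PI f = PI ((\<one> \<ominus> e) \<otimes> b)" "PI (e \<oplus> f) = PI a <+>\<^bsub>R\<^esub> PI b"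
    using orthogonal_generators[OF assms] by metis
  have R: "e \<in> carrier R" "f \<in> carrier R" using ef idempotentsD by auto
  have "a \<oplus> b \<in> PI (e \<oplus> f)" unfolding ef(7) using PI_self assms by (auto simp: set_add_def')
  then have "\<rho> (a \<oplus> b) \<le> \<rho> (e \<oplus> f)" using rho_mono PI_subset_iff assms R by auto
  also have "\<dots> = \<rho> e + \<rho> f" using rho_orthogonal ef by simp
  also have "\<rho> e = \<rho> a" by (rule rho_cong) (simp_all add: R assms ef(5))
  also have "\<rho> f = \<rho> ((\<one> \<ominus> e) \<otimes> b)" by (rule rho_cong) (simp_all add: R assms ef(6))
  also have "\<dots> \<le> \<rho> b" using rho_mult_right R assms by simp
  finally show ?thesis by simp
qed

text \<open>It has to be seen that \<open>(\<one> \<ominus> e) \<otimes> b\<close> has the rank of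
  \<open>b\<close>. Whatever this element annihilates, \<open>b\<close> maps into the intersection
  of the two ideals, hence to zero; therefore \<open>b\<close> is a left multiple of it.\<close>

lemma rho_add_disjoint:
  assumes a: "a \<in> carrier R" and b: "b \<in> carrier R" and c: "c \<in> carrier R"
    and eq: "PI c = PI a <+>\<^bsub>R\<^esub> PI b" and disj: "PI a \<inter> PI b = {\<zero>}"
  shows "\<rho> c = \<rho> a + \<rho> b"
proof -
  obtain e f where ef: "e \<in> idempotents R" "f \<in> idempotents R" "e \<otimes> f = \<zero>" "f \<otimes> e = \<zero>"
    "PI e = PI a" "PI f = PI ((\<one> \<ominus> e) \<otimes> b)" "PI (e \<oplus> f) = PI a <+>\<^bsub>R\<^esub> PI b"
    using orthogonal_generators[OF a b] by metis
  have R: "e \<in> carrier R" "f \<in> carrier R" using ef idempotentsD by auto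
  define d where "d = (\<one> \<ominus> e) \<otimes> b"
  have d: "d \<in> carrier R" using R b by (simp add: d_def)
  obtain v where v: "v \<in> carrier R" "d \<otimes> v \<otimes> d = d" using regular[OF d] by blast
  define x where "x = b \<otimes> (\<one> \<ominus> v \<otimes> d)"
  have x: "x \<in> carrier R" using b v d by (simp add: x_def)
  have "d \<otimes> (\<one> \<ominus> v \<otimes> d) = \<zero>"
    using d v by (simp add: minus_eq r_distr r_minus m_assoc[symmetric] r_neg)
  then have "(\<one> \<ominus> e) \<otimes> x = \<zero>" using R b v d by (simp add: x_def d_def m_assoc)
  then have "x \<ominus> e \<otimes> x = \<zero>" using R x by (simp add: minus_eq l_distr l_minus)
  then have "e \<otimes> x = x" using R x by (metis diff_zero_iff m_closed)
  then have "x \<in> PI a" using idem_PI_iff[OF ef(1)] x ef(5) by blast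
  moreover have "x \<in> PI b" unfolding x_def PI_iff using v d by blast
  ultimately have "x = \<zero>" using disj by blast
  then have "b \<ominus> b \<otimes> v \<otimes> d = \<zero>" using b v d by (simp add: x_def minus_eq r_distr r_minus m_assoc)
  then have "b = b \<otimes> v \<otimes> d" using b v d by (metis diff_zero_iff m_closed)
  then have "\<rho> b \<le> \<rho> d" using rho_mult_right[of "b \<otimes> v" d] b v d by simp
  moreover have "\<rho> d \<le> \<rho> b" unfolding d_def using rho_mult_right R b by simp
  moreover have "\<rho> f = \<rho> d" by (rule rho_cong) (simp_all add: R b ef(6) d_def)
  moreover have "\<rho> e = \<rho> a" by (rule rho_cong) (simp_all add: R a ef(5))
  moreover have "\<rho> c = \<rho> (e \<oplus> f)" by (rule rho_cong) (simp_all add: R c ef(7) eq)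
  ultimately show ?thesis using rho_orthogonal ef by simp
qed

text \<open>Independent of the chosen generator by \<open>rho_cong\<close>; outside
  \<open>Lat\<close> the value is meaningless.\<close>

definition rk :: "'a set \<Rightarrow> real" where
  "rk U = \<rho> (SOME a. a \<in> carrier R \<and> PI a = U)"

lemma rk_PI: "a \<in> carrier R \<Longrightarrow> rk (PI a) = \<rho> a"
  unfolding rk_def by (metis (mono_tags, lifting) rho_cong someI)

lemma rk_mono: "\<lbrakk>U \<in> Lat; W \<in> Lat; U \<subseteq> W\<rbrakk> \<Longrightarrow> rk U \<le> rk W"
  by (auto simp: Lat_def rk_PI intro: rho_mono)

lemma rk_sum:
  assumes "U \<in> Lat" "W \<in> Lat" "U \<inter> W = {\<zero>}" shows "rk (U <+>\<^bsub>R\<^esub> W) = rk U + rk W"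
proof -
  obtain a b c where "a \<in> carrier R" "U = PI a" "b \<in> carrier R" "W = PI b" "c \<in> carrier R" "U <+>\<^bsub>R\<^esub> W = PI c"
    using assms(1,2) Lat_sum[OF assms(1,2)] by (auto simp: Lat_def)
  then show ?thesis using rho_add_disjoint[of a b c] assms(3) by (simp add: rk_PI)
qed

end

section \<open>Continuous rings\<close>

locale continuous_regular_ring = von_neumann_regular_ring +
  assumes continuous_geometry: "continuous_geometry (right_ideal_lattice R)"
begin

lemma carrier_right_ideal_lattice: "carrier (right_ideal_lattice R) = Lat"
  by (simp add: right_ideal_lattice_def Lat_def)

lemma le_right_ideal_lattice: "x \<sqsubseteq>\<^bsub>right_ideal_lattice R\<^esub> y \<longleftrightarrow> x \<subseteq> y"
  by (simp add: right_ideal_lattice_def)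

definition LSup :: "'a set set \<Rightarrow> 'a set" where "LSup C = \<Squnion>\<^bsub>right_ideal_lattice R\<^esub> C"

definition LInf :: "'a set set \<Rightarrow> 'a set" where "LInf C = \<Sqinter>\<^bsub>right_ideal_lattice R\<^esub> C"

lemma complete_right_ideal_lattice: "complete_lattice (right_ideal_lattice R)"
  using continuous_geometry by (simp add: continuous_geometry_def)

context
  fixes C assumes C: "C \<subseteq> Lat"
begin

interpretation L: complete_lattice "right_ideal_lattice R" by (rule complete_right_ideal_lattice)

lemma LSup_in_Lat: "LSup C \<in> Lat"
  using L.sup_closed[of C] C by (simp add: LSup_def carrier_right_ideal_lattice)

lemma LSup_upper: "U \<in> C \<Longrightarrow> U \<subseteq> LSup C"
  using L.sup_upper[of C U] C by (simp add: LSup_def carrier_right_ideal_lattice le_right_ideal_lattice)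

lemma LSup_least: "\<lbrakk>T \<in> Lat; \<And>U. U \<in> C \<Longrightarrow> U \<subseteq> T\<rbrakk> \<Longrightarrow> LSup C \<subseteq> T"
  using L.sup_least[of C T] C by (simp add: LSup_def carrier_right_ideal_lattice le_right_ideal_lattice)

lemma LInf_in_Lat: "LInf C \<in> Lat"
  using L.inf_closed[of C] C by (simp add: LInf_def carrier_right_ideal_lattice)

lemma LInf_lower: "U \<in> C \<Longrightarrow> LInf C \<subseteq> U"
  using L.inf_lower[of C U] C by (simp add: LInf_def carrier_right_ideal_lattice le_right_ideal_lattice)

lemma LInf_greatest: "\<lbrakk>T \<in> Lat; \<And>U. U \<in> C \<Longrightarrow> T \<subseteq> U\<rbrakk> \<Longrightarrow> T \<subseteq> LInf C"
  using L.inf_greatest[of C T] C by (simp add: LInf_def carrier_right_ideal_lattice le_right_ideal_lattice)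

end

lemma join_eq_sum:
  assumes "U \<in> Lat" "W \<in> Lat" shows "U \<squnion>\<^bsub>right_ideal_lattice R\<^esub> W = U <+>\<^bsub>R\<^esub> W"
proof -
  have UW: "{U, W} \<subseteq> Lat" using assms by simp
  have "U \<squnion>\<^bsub>right_ideal_lattice R\<^esub> W = LSup {U, W}" by (simp add: join_def LSup_def)
  moreover have "LSup {U, W} \<subseteq> U <+>\<^bsub>R\<^esub> W"
    using Lat_sum_upper[OF assms] by (intro LSup_least[OF UW Lat_sum[OF assms]]) auto
  moreover have "U <+>\<^bsub>R\<^esub> W \<subseteq> LSup {U, W}"
    by (intro Lat_sum_least LSup_in_Lat LSup_upper UW) auto
  ultimately show ?thesis by (metis subset_antisym)
qed

lemma meet_eq_Int:
  assumes "U \<in> Lat" "W \<in> Lat" shows "U \<sqinter>\<^bsub>right_ideal_lattice R\<^esub> W = U \<inter> W"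
proof -
  have UW: "{U, W} \<subseteq> Lat" using assms by simp
  have "U \<sqinter>\<^bsub>right_ideal_lattice R\<^esub> W = LInf {U, W}" by (simp add: meet_def LInf_def)
  moreover have "LInf {U, W} \<subseteq> U \<inter> W" using LInf_lower[OF UW] by blast
  moreover have "U \<inter> W \<subseteq> LInf {U, W}"
    by (intro LInf_greatest UW Lat_Int assms) auto
  ultimately show ?thesis by (metis subset_antisym)
qed

lemma chain_continuity:
  assumes C: "C \<subseteq> Lat" and chain: "\<And>U W. \<lbrakk>U \<in> C; W \<in> C\<rbrakk> \<Longrightarrow> U \<subseteq> W \<or> W \<subseteq> U" and X: "X \<in> Lat"
  shows "X \<inter> LSup C = LSup ((\<lambda>Y. X \<inter> Y) ` C)" "X <+>\<^bsub>R\<^esub> LInf C = LInf ((\<lambda>Y. X <+>\<^bsub>R\<^esub> Y) ` C)"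
proof -
  let ?L = "right_ideal_lattice R"
  have "pred_on.chain (carrier ?L) (\<lambda>x y. x \<sqsubseteq>\<^bsub>?L\<^esub> y) C"
    using C chain by (simp add: pred_on.chain_def carrier_right_ideal_lattice le_right_ideal_lattice)
  then have "X \<sqinter>\<^bsub>?L\<^esub> (\<Squnion>\<^bsub>?L\<^esub> C) = \<Squnion>\<^bsub>?L\<^esub> ((\<lambda>y. X \<sqinter>\<^bsub>?L\<^esub> y) ` C) \<and>
      X \<squnion>\<^bsub>?L\<^esub> (\<Sqinter>\<^bsub>?L\<^esub> C) = \<Sqinter>\<^bsub>?L\<^esub> ((\<lambda>y. X \<squnion>\<^bsub>?L\<^esub> y) ` C)"
    using continuous_geometry X unfolding continuous_geometry_def carrier_right_ideal_lattice by blast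
  moreover have "(\<lambda>y. X \<sqinter>\<^bsub>?L\<^esub> y) ` C = (\<lambda>Y. X \<inter> Y) ` C"
    using meet_eq_Int[OF X] C by (intro image_cong) auto
  moreover have "(\<lambda>y. X \<squnion>\<^bsub>?L\<^esub> y) ` C = (\<lambda>Y. X <+>\<^bsub>R\<^esub> Y) ` C"
    using join_eq_sum[OF X] C by (intro image_cong) auto
  ultimately show "X \<inter> LSup C = LSup ((\<lambda>Y. X \<inter> Y) ` C)" "X <+>\<^bsub>R\<^esub> LInf C = LInf ((\<lambda>Y. X <+>\<^bsub>R\<^esub> Y) ` C)"
    using meet_eq_Int[OF X LSup_in_Lat[OF C]] join_eq_sum[OF X LInf_in_Lat[OF C]]
    by (simp_all add: LSup_def LInf_def)
qed

lemma zero_in_Lat: "{\<zero>} \<in> Lat" and carrier_in_Lat: "carrier R \<in> Lat"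
  using PI_in_Lat[of \<zero>] PI_in_Lat[of \<one>] by (simp_all add: PI_zero PI_one)

lemma Lat_Int_zero: "\<lbrakk>U \<in> Lat; W \<in> Lat; U \<inter> W \<subseteq> {\<zero>}\<rbrakk> \<Longrightarrow> U \<inter> W = {\<zero>}"
  using Lat_closed(2) by blast

text \<open>This special case is the form in which the continuity of meets enters all later
  arguments.\<close>

lemma chain_Sup_disjoint:
  assumes C: "C \<subseteq> Lat" and chain: "\<And>U W. \<lbrakk>U \<in> C; W \<in> C\<rbrakk> \<Longrightarrow> U \<subseteq> W \<or> W \<subseteq> U" and X: "X \<in> Lat"
    and disj: "\<And>U. U \<in> C \<Longrightarrow> X \<inter> U = {\<zero>}"
  shows "X \<inter> LSup C = {\<zero>}"
proof (rule Lat_Int_zero[OF X LSup_in_Lat[OF C]])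
  have "(\<lambda>Y. X \<inter> Y) ` C \<subseteq> Lat" using C X Lat_Int by blast
  then have "LSup ((\<lambda>Y. X \<inter> Y) ` C) \<subseteq> {\<zero>}"
    by (rule LSup_least[OF _ zero_in_Lat]) (use disj in auto)
  moreover have "X \<inter> LSup C = LSup ((\<lambda>Y. X \<inter> Y) ` C)"
    by (rule chain_continuity(1)[OF C _ X]) (rule chain)
  ultimately show "X \<inter> LSup C \<subseteq> {\<zero>}" by simp
qed

text \<open>The dual special case, for the continuity of joins.\<close>

lemma chain_Inf_sum:
  assumes C: "C \<subseteq> Lat" and chain: "\<And>U W. \<lbrakk>U \<in> C; W \<in> C\<rbrakk> \<Longrightarrow> U \<subseteq> W \<or> W \<subseteq> U" and X: "X \<in> Lat"
    and sum: "\<And>U. U \<in> C \<Longrightarrow> X <+>\<^bsub>R\<^esub> U = carrier R"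
  shows "X <+>\<^bsub>R\<^esub> LInf C = carrier R"
proof
  have D: "(\<lambda>Y. X <+>\<^bsub>R\<^esub> Y) ` C \<subseteq> Lat" using C X Lat_sum by blast
  have "X <+>\<^bsub>R\<^esub> LInf C = LInf ((\<lambda>Y. X <+>\<^bsub>R\<^esub> Y) ` C)"
    by (rule chain_continuity(2)[OF C _ X]) (rule chain)
  moreover have "carrier R \<subseteq> LInf ((\<lambda>Y. X <+>\<^bsub>R\<^esub> Y) ` C)"
    by (rule LInf_greatest[OF D carrier_in_Lat]) (use sum in blast)
  ultimately show "carrier R \<subseteq> X <+>\<^bsub>R\<^esub> LInf C" by simp
  show "X <+>\<^bsub>R\<^esub> LInf C \<subseteq> carrier R"
    using Lat_closed(1)[OF Lat_sum[OF X LInf_in_Lat[OF C]]] .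
qed

text \<open>The intersection is not known to be principal beforehand, but each of its elements
  generates a principal right ideal contained in all members of \<open>C\<close>.\<close>

lemma LInf_eq_Inter:
  assumes C: "C \<subseteq> Lat" "C \<noteq> {}" shows "LInf C = \<Inter>C"
proof
  show "LInf C \<subseteq> \<Inter>C" using LInf_lower[OF C(1)] by blast
  show "\<Inter>C \<subseteq> LInf C"
  proof
    fix x assume x: "x \<in> \<Inter>C"
    then have xR: "x \<in> carrier R" using C Lat_closed(1) by blast
    have "PI x \<subseteq> LInf C"
      using x C by (intro LInf_greatest[OF C(1)] PI_in_Lat xR PI_subset_Lat) auto
    then show "x \<in> LInf C" using PI_self[OF xR] by blast
  qed
qed

end

section \<open>Central idempotents and primeness\<close>

context ring
begin

text \<open>For a central idempotent \<open>f\<close> the ideal generated by \<open>f\<close> is a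
  ring with unit \<open>f\<close>. The record is built anew so as to have the type
  \<open>'a ring\<close> over which \<open>irreducible_ring\<close> quantifies.\<close>

definition corner_ring :: "'a \<Rightarrow> 'a ring" where
  "corner_ring f = \<lparr>carrier = {x \<in> carrier R. f \<otimes> x = x}, Group.monoid.mult = (\<otimes>), one = f,
     zero = \<zero>, add = (\<oplus>)\<rparr>"

lemma corner_ring_is_ring:
  assumes f: "f \<in> carrier R" "f \<otimes> f = f" and central: "\<And>x. x \<in> carrier R \<Longrightarrow> f \<otimes> x = x \<otimes> f"
  shows "ring (corner_ring f)"
proof (rule ringI)
  show "abelian_group (corner_ring f)"
  proof (rule abelian_groupI)
    fix x assume "x \<in> carrier (corner_ring f)"
    then have x: "x \<in> carrier R" "f \<otimes> x = x" by (simp_all add: corner_ring_def)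
    then have "\<ominus> x \<in> carrier (corner_ring f)" using f by (simp add: corner_ring_def r_minus)
    then show "\<exists>y\<in>carrier (corner_ring f). y \<oplus>\<^bsub>corner_ring f\<^esub> x = \<zero>\<^bsub>corner_ring f\<^esub>"
      using x by (intro bexI[of _ "\<ominus> x"]) (simp_all add: corner_ring_def l_neg)
  qed (use f in \<open>auto simp: corner_ring_def r_distr a_ac\<close>)
  show "Group.monoid (corner_ring f)"
  proof (rule monoidI)
    fix x assume "x \<in> carrier (corner_ring f)"
    then have "x \<in> carrier R" "f \<otimes> x = x" by (simp_all add: corner_ring_def)
    then show "x \<otimes>\<^bsub>corner_ring f\<^esub> \<one>\<^bsub>corner_ring f\<^esub> = x"
      using central[of x] by (simp add: corner_ring_def)
  qed (use f in \<open>auto simp: corner_ring_def simp flip: m_assoc\<close>)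
qed (use f in \<open>auto simp: corner_ring_def l_distr r_distr\<close>)

text \<open>The Peirce decomposition: \<open>x\<close> corresponds to the pair of
  \<open>f \<otimes> x\<close> and \<open>(\<one> \<ominus> f) \<otimes> x\<close>, so a nontrivial
  \<open>f\<close> would split the ring.\<close>

lemma irreducible_central_idempotent:
  assumes irr: "irreducible_ring R" and f: "f \<in> carrier R" "f \<otimes> f = f"
    and central: "\<And>x. x \<in> carrier R \<Longrightarrow> f \<otimes> x = x \<otimes> f"
  shows "f = \<zero> \<or> f = \<one>"
proof (rule ccontr)
  assume neg: "\<not> ?thesis"
  define g where "g = \<one> \<ominus> f"
  have g: "g \<in> carrier R" "f \<otimes> g = \<zero>" "g \<otimes> f = \<zero>"
    using f by (simp_all add: g_def minus_eq r_distr l_distr r_minus l_minus r_neg)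
  have gx: "g \<otimes> x = x \<ominus> f \<otimes> x" "x \<otimes> g = x \<ominus> x \<otimes> f" if "x \<in> carrier R" for x
    using that f by (simp_all add: g_def minus_eq r_distr l_distr r_minus l_minus)
  have gc: "g \<otimes> x = x \<otimes> g" if "x \<in> carrier R" for x using gx[OF that] central[OF that] by simp
  have gg: "g \<otimes> g = g" using gx(1)[OF g(1)] g f by (simp add: minus_eq)
  have "g = \<ominus> f \<oplus> \<one>" using f a_comm[of \<one> "\<ominus> f"] by (simp add: g_def minus_eq)
  then have fg1: "f \<oplus> g = \<one>" using f by (simp add: r_neg2)
  let ?S = "corner_ring f" and ?T = "corner_ring g"
  have S: "ring ?S" by (rule corner_ring_is_ring[OF f central])
  have T: "ring ?T" by (rule corner_ring_is_ring[OF g(1) gg gc])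
  have "f \<in> carrier ?S" "g \<in> carrier ?T" using f g gg by (simp_all add: corner_ring_def)
  moreover have "g \<noteq> \<zero>" using neg fg1 f by auto
  ultimately have ne: "carrier ?S \<noteq> {\<zero>\<^bsub>?S\<^esub>}" "carrier ?T \<noteq> {\<zero>\<^bsub>?T\<^esub>}"
    using neg by (auto simp: corner_ring_def)
  have "(\<lambda>x. (f \<otimes> x, g \<otimes> x)) \<in> ring_iso R (RDirProd ?S ?T)"
    unfolding ring_iso_def
  proof (intro CollectI conjI ring_hom_memI)
    fix x y assume xy: "x \<in> carrier R" "y \<in> carrier R"
    show "(f \<otimes> x, g \<otimes> x) \<in> carrier (RDirProd ?S ?T)"
      using xy f g(1) gg by (simp add: RDirProd_carrier corner_ring_def m_assoc[symmetric])
    have star: "h \<otimes> (x \<otimes> y) = (h \<otimes> x) \<otimes> (h \<otimes> y)"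
      if h: "h \<in> carrier R" "h \<otimes> h = h" "\<And>x. x \<in> carrier R \<Longrightarrow> h \<otimes> x = x \<otimes> h" for h
    proof -
      have "(h \<otimes> x) \<otimes> (h \<otimes> y) = h \<otimes> (x \<otimes> h) \<otimes> y" using h(1) xy by (simp add: m_assoc)
      also have "\<dots> = h \<otimes> (h \<otimes> x) \<otimes> y" by (simp only: h(3)[OF xy(1)])
      also have "\<dots> = h \<otimes> (x \<otimes> y)" using h(1,2) xy by (simp add: m_assoc[symmetric])
      finally show ?thesis by simp
    qed
    have "f \<otimes> (x \<otimes> y) = (f \<otimes> x) \<otimes> (f \<otimes> y)" by (rule star[OF f]) (rule central)
    moreover have "g \<otimes> (x \<otimes> y) = (g \<otimes> x) \<otimes> (g \<otimes> y)" by (rule star[OF g(1) gg]) (rule gc)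
    ultimately show "(f \<otimes> (x \<otimes> y), g \<otimes> (x \<otimes> y)) = (f \<otimes> x, g \<otimes> x) \<otimes>\<^bsub>RDirProd ?S ?T\<^esub> (f \<otimes> y, g \<otimes> y)"
      by (simp add: RDirProd_def DirProd_def monoid.defs corner_ring_def)
    show "(f \<otimes> (x \<oplus> y), g \<otimes> (x \<oplus> y)) = (f \<otimes> x, g \<otimes> x) \<oplus>\<^bsub>RDirProd ?S ?T\<^esub> (f \<otimes> y, g \<otimes> y)"
      using xy f g by (simp add: RDirProd_def DirProd_def monoid.defs corner_ring_def r_distr)
  next
    show "(f \<otimes> \<one>, g \<otimes> \<one>) = \<one>\<^bsub>RDirProd ?S ?T\<^esub>"
      using f g by (simp add: RDirProd_def DirProd_def monoid.defs corner_ring_def)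
  next
    have fz: "f \<otimes> (x \<oplus> y) = x" and gz: "g \<otimes> (x \<oplus> y) = y"
      if "x \<in> carrier R" "y \<in> carrier R" "f \<otimes> x = x" "g \<otimes> y = y" for x y
    proof -
      have "f \<otimes> y = \<zero>" using that g f by (metis m_assoc l_null)
      moreover have "g \<otimes> x = \<zero>" using that g f by (metis m_assoc l_null)
      ultimately show "f \<otimes> (x \<oplus> y) = x" "g \<otimes> (x \<oplus> y) = y" using that f g by (simp_all add: r_distr)
    qed
    show "bij_betw (\<lambda>x. (f \<otimes> x, g \<otimes> x)) (carrier R) (carrier (RDirProd ?S ?T))"
    proof (rule bij_betw_byWitness[where f' = "\<lambda>(x, y). x \<oplus> y"])
      show "\<forall>x\<in>carrier R. (case (f \<otimes> x, g \<otimes> x) of (x, y) \<Rightarrow> x \<oplus> y) = x"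
        using f g fg1 by (simp add: l_distr[symmetric])
    qed (use f g gg fz gz in \<open>auto simp: RDirProd_carrier corner_ring_def m_assoc[symmetric]\<close>)
  qed
  then have "R \<simeq> RDirProd ?S ?T" by (auto simp: is_ring_iso_def)
  then show False using irr S T ne unfolding irreducible_ring_def by blast
qed

end

text \<open>If all these products vanished, the common right annihilator \<open>J\<close> of the
  elements \<open>a \<otimes> r\<close> would be a two-sided ideal different from zero and from the
  ring. Completeness of the lattice makes it principal, and regularity makes its idempotent
  generator central, against irreducibility.\<close>

lemma (in continuous_regular_ring) irreducible_prime:
  assumes irr: "irreducible_ring R" and a: "a \<in> carrier R" "a \<noteq> \<zero>" and b: "b \<in> carrier R" "b \<noteq> \<zero>"
  shows "\<exists>r\<in>carrier R. a \<otimes> r \<otimes> b \<noteq> \<zero>"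
proof (rule ccontr)
  assume "\<not> ?thesis"
  then have ab: "a \<otimes> r \<otimes> b = \<zero>" if "r \<in> carrier R" for r using that by blast
  define C where "C = (\<lambda>r. {x \<in> carrier R. (a \<otimes> r) \<otimes> x = \<zero>}) ` carrier R"
  have C: "C \<subseteq> Lat" "C \<noteq> {}" using right_annihilator_in_Lat a(1) unfolding C_def by auto
  define J where "J = LInf C"
  have J: "J \<in> Lat" unfolding J_def by (rule LInf_in_Lat[OF C(1)])
  have JI: "J = \<Inter>C" unfolding J_def by (rule LInf_eq_Inter[OF C])
  have Jiff: "x \<in> J \<longleftrightarrow> x \<in> carrier R \<and> (\<forall>r\<in>carrier R. a \<otimes> r \<otimes> x = \<zero>)" for x
    unfolding JI by (auto simp: C_def)
  obtain f where f: "f \<in> idempotents R" "J = PI f" using Lat_idempotent[OF J] .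
  have fR: "f \<in> carrier R" "f \<otimes> f = f" using idempotentsD f by auto
  have fJ: "f \<in> J" using PI_self fR f(2) by simp
  have lf: "f \<otimes> (r \<otimes> f) = r \<otimes> f" if r: "r \<in> carrier R" for r
  proof -
    have "a \<otimes> s \<otimes> (r \<otimes> f) = a \<otimes> (s \<otimes> r) \<otimes> f" if "s \<in> carrier R" for s
      using a(1) r fR that by (simp add: m_assoc)
    then have "r \<otimes> f \<in> J" using fJ r fR Jiff by simp
    then show ?thesis using f idem_PI_iff by blast
  qed
  have rf: "f \<otimes> r = f \<otimes> r \<otimes> f" if r: "r \<in> carrier R" for r
  proof -
    \<comment> \<open>Regular rings are semiprime: with \<open>v\<close> from regularity,
      \<open>y \<otimes> v \<otimes> y\<close> contains the factor
      \<open>(\<one> \<ominus> f) \<otimes> (v \<otimes> f)\<close>, which is zero because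
      \<open>v \<otimes> f\<close> lies in \<open>J\<close>.\<close>
    define y where "y = f \<otimes> r \<otimes> (\<one> \<ominus> f)"
    have y: "y \<in> carrier R" using r fR by (simp add: y_def)
    obtain v where v: "v \<in> carrier R" "y \<otimes> v \<otimes> y = y" using regular[OF y] by blast
    have "(\<one> \<ominus> f) \<otimes> (v \<otimes> f) = \<zero>"
      using lf[OF v(1)] v fR by (simp add: minus_eq l_distr l_minus r_neg)
    moreover have "y \<otimes> v \<otimes> y = f \<otimes> r \<otimes> ((\<one> \<ominus> f) \<otimes> (v \<otimes> f)) \<otimes> (r \<otimes> (\<one> \<ominus> f))"
      using v r fR by (simp add: y_def m_assoc)
    ultimately have "y = \<zero>" using v r fR by simp
    moreover have "y = f \<otimes> r \<ominus> f \<otimes> r \<otimes> f" using r fR by (simp add: y_def minus_eq r_distr r_minus)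
    ultimately show ?thesis using diff_zero_iff[of "f \<otimes> r" "f \<otimes> r \<otimes> f"] r fR by simp
  qed
  have "f = \<zero> \<or> f = \<one>"
  proof (rule irreducible_central_idempotent[OF irr fR])
    fix x assume x: "x \<in> carrier R"
    show "f \<otimes> x = x \<otimes> f" using rf[OF x] lf[OF x] x fR by (simp add: m_assoc)
  qed
  moreover have "f \<noteq> \<zero>"
  proof
    assume "f = \<zero>"
    then have "J = {\<zero>}" using f PI_zero by simp
    moreover have "b \<in> J" using Jiff b ab by simp
    ultimately show False using b by simp
  qed
  moreover have "f \<noteq> \<one>"
  proof
    assume "f = \<one>"
    then have "\<one> \<in> J" using fJ by simp
    then have "a \<otimes> \<one> \<otimes> \<one> = \<zero>" using Jiff by blast
    then show False using a by simp
  qed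
  ultimately show False by blast
qed

section \<open>The order on idempotents\<close>

context ring
begin

lemma plus_minus_cancel:
  assumes "x \<in> carrier R" "y \<in> carrier R" shows "x \<oplus> (y \<oplus> \<ominus> x) = y"
  using assms a_lcomm[of x y "\<ominus> x"] by (simp add: r_neg)

lemma idem_leD:
  assumes "idem_le R e f" shows "e \<otimes> f = e" "f \<otimes> e = e"
  using assms by (auto simp: idem_le_def)

lemma idem_le_refl: "e \<in> idempotents R \<Longrightarrow> idem_le R e e"
  by (simp add: idem_le_def idempotents_def)

lemma idem_le_trans:
  assumes "e \<in> carrier R" "f \<in> carrier R" "g \<in> carrier R" "idem_le R e f" "idem_le R f g"
  shows "idem_le R e g"
  using assms unfolding idem_le_def by (metis m_assoc)

lemma idem_le_antisym: "\<lbrakk>idem_le R e f; idem_le R f e\<rbrakk> \<Longrightarrow> e = f"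
  by (simp add: idem_le_def)

lemma idem_le_diff:
  assumes e: "e \<in> idempotents R" and f: "f \<in> idempotents R" and le: "idem_le R e f"
  shows "f \<ominus> e \<in> idempotents R" "e \<otimes> (f \<ominus> e) = \<zero>" "(f \<ominus> e) \<otimes> e = \<zero>" "e \<oplus> (f \<ominus> e) = f"
    "f \<otimes> (f \<ominus> e) = f \<ominus> e" "(f \<ominus> e) \<otimes> f = f \<ominus> e"
proof -
  have R: "e \<in> carrier R" "f \<in> carrier R" "e \<otimes> e = e" "f \<otimes> f = f" "e \<otimes> f = e" "f \<otimes> e = e"
    using e f le by (auto simp: idempotents_def idem_le_def)
  show 1: "e \<otimes> (f \<ominus> e) = \<zero>" "(f \<ominus> e) \<otimes> e = \<zero>" "f \<otimes> (f \<ominus> e) = f \<ominus> e" "(f \<ominus> e) \<otimes> f = f \<ominus> e"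
    using R by (simp_all add: minus_eq r_distr l_distr r_minus l_minus r_neg)
  have "(f \<ominus> e) \<otimes> (f \<ominus> e) = f \<otimes> (f \<ominus> e) \<ominus> e \<otimes> (f \<ominus> e)"
    using R by (simp add: minus_eq l_distr l_minus)
  then show "f \<ominus> e \<in> idempotents R" using R 1 by (simp add: idempotents_def minus_eq)
  show "e \<oplus> (f \<ominus> e) = f" using R a_comm[of f "\<ominus> e"] by (simp add: minus_eq r_neg2)
qed

end

lemma (in ranked_ring) rho_idem_diff:
  assumes e: "e \<in> idempotents R" and f: "f \<in> idempotents R" and le: "idem_le R e f"
  shows "\<rho> (f \<ominus> e) = \<rho> f - \<rho> e"
  using rho_orthogonal[OF e idem_le_diff(1)[OF assms]] idem_le_diff[OF assms] by simp

lemma (in von_neumann_regular_ring) idem_le_PI: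
  assumes "e \<in> idempotents R" "f \<in> idempotents R" "idem_le R e f" shows "PI e \<subseteq> PI f"
  using assms idempotentsD[OF assms(1)] idempotentsD[OF assms(2)]
  by (simp add: PI_subset_iff idem_PI_iff idem_le_def)

section \<open>Comparison of right ideals by rank\<close>

locale irreducible_continuous_ring = continuous_regular_ring R + ranked_ring R \<rho> for R (structure) and \<rho> +
  assumes irreducible: "irreducible_ring R"
begin

text \<open>Subtract from an element of \<open>U\<close> outside \<open>T\<close> its component in
  \<open>U \<inter> T\<close>; what is left generates a right ideal meeting \<open>T\<close> in zero
  only.\<close>

lemma complement_element:
  assumes U: "U \<in> Lat" and T: "T \<in> Lat" and not: "\<not> U \<subseteq> T"
  shows "\<exists>u\<in>U. u \<noteq> \<zero> \<and> (\<forall>y\<in>carrier R. u \<otimes> y \<in> T \<longrightarrow> u \<otimes> y = \<zero>)"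
proof -
  obtain f where f: "f \<in> idempotents R" "U \<inter> T = PI f" using Lat_idempotent[OF Lat_Int[OF U T]] .
  have fR: "f \<in> carrier R" "f \<otimes> f = f" using idempotentsD[OF f(1)] by auto
  obtain x where x: "x \<in> U" "x \<notin> T" using not by blast
  have xR: "x \<in> carrier R" using x Lat_closed(1)[OF U] by blast
  have fx: "f \<otimes> x \<in> U \<inter> T" unfolding f(2) PI_iff using xR by blast
  define u where "u = x \<ominus> f \<otimes> x"
  have uU: "u \<in> U" unfolding u_def using Lat_closed(6)[OF U x(1)] fx by blast
  have uR: "u \<in> carrier R" using xR fR by (simp add: u_def)
  have "u \<noteq> \<zero>"
  proof
    assume "u = \<zero>"
    then have "x = f \<otimes> x" using diff_zero_iff[of x "f \<otimes> x"] xR fR by (simp add: u_def)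
    then show False using fx x(2) by auto
  qed
  moreover have "u \<otimes> y = \<zero>" if y: "y \<in> carrier R" "u \<otimes> y \<in> T" for y
  proof -
    have "u \<otimes> y \<in> PI f" unfolding f(2)[symmetric] using y Lat_closed(3)[OF U uU] by blast
    then have "u \<otimes> y = f \<otimes> (u \<otimes> y)" using idem_PI_iff[OF f(1)] by simp
    moreover have "f \<otimes> u = \<zero>"
      using xR fR by (simp add: u_def minus_eq r_distr r_minus r_neg m_assoc[symmetric])
    ultimately show ?thesis using y uR fR by (metis m_assoc l_null)
  qed
  ultimately show ?thesis using uU by blast
qed

lemma rk_sum_le:
  assumes "U \<in> Lat" "W \<in> Lat" "T \<in> Lat" "U \<inter> W = {\<zero>}" "U \<subseteq> T" "W \<subseteq> T"
  shows "rk U + rk W \<le> rk T"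
  using rk_mono[OF Lat_sum[OF assms(1,2)] assms(3) Lat_sum_least[OF assms(3,5,6)]] rk_sum[OF assms(1,2,4)] by simp

lemma Lat_sum_mono:
  assumes "U \<in> Lat" "W \<in> Lat" "U' \<subseteq> U" "W' \<subseteq> W" shows "U' <+>\<^bsub>R\<^esub> W' \<subseteq> U <+>\<^bsub>R\<^esub> W"
  using Lat_sum_upper[OF assms(1,2)] by (intro Lat_sum_least[OF Lat_sum[OF assms(1,2)]]) (use assms in auto)

text \<open>A maximal submodule \<open>Z\<close> of \<open>A \<oplus> B\<close> meeting both summands trivially is the graph of an
  isomorphism between submodules of \<open>A\<close> and \<open>B\<close>; by primeness it could be enlarged if it
  exhausted neither summand, so it exhausts the one of smaller rank.\<close>

lemma graph_extension:
  assumes A: "A \<in> Lat" and B: "B \<in> Lat" and AB: "A \<inter> B = {\<zero>}" and less: "rk A < rk B"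
    and Z0: "Z0 \<in> Lat" "Z0 \<subseteq> A <+>\<^bsub>R\<^esub> B" "A \<inter> Z0 = {\<zero>}" "B \<inter> Z0 = {\<zero>}"
  shows "\<exists>Z\<in>Lat. Z0 \<subseteq> Z \<and> Z \<subseteq> A <+>\<^bsub>R\<^esub> B \<and> A \<inter> Z = {\<zero>} \<and> B \<inter> Z = {\<zero>} \<and> A \<subseteq> Z <+>\<^bsub>R\<^esub> B"
proof -
  note ABL = Lat_sum[OF A B]
  define \<Z> where "\<Z> = {Z \<in> Lat. Z0 \<subseteq> Z \<and> Z \<subseteq> A <+>\<^bsub>R\<^esub> B \<and> A \<inter> Z = {\<zero>} \<and> B \<inter> Z = {\<zero>}}"
  \<comment> \<open>Zorn's lemma applies because joins of chains stay disjoint from \<open>A\<close>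
    and from \<open>B\<close>; the empty chain is bounded by \<open>Z0\<close>.\<close>
  have "\<exists>U\<in>\<Z>. \<forall>X\<in>C. X \<subseteq> U" if C: "subset.chain \<Z> C" for C
  proof (cases "C = {}")
    case True
    then show ?thesis using Z0 by (auto simp: \<Z>_def)
  next
    case False
    have CZ: "C \<subseteq> \<Z>" and ch: "\<And>U W. \<lbrakk>U \<in> C; W \<in> C\<rbrakk> \<Longrightarrow> U \<subseteq> W \<or> W \<subseteq> U"
      using C by (auto simp: subset_chain_def)
    have CL: "C \<subseteq> Lat" using CZ by (auto simp: \<Z>_def)
    have "A \<inter> LSup C = {\<zero>}" by (rule chain_Sup_disjoint[OF CL ch A]) (use CZ in \<open>auto simp: \<Z>_def\<close>)
    moreover have "B \<inter> LSup C = {\<zero>}" by (rule chain_Sup_disjoint[OF CL ch B]) (use CZ in \<open>auto simp: \<Z>_def\<close>)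
    moreover have "LSup C \<subseteq> A <+>\<^bsub>R\<^esub> B" by (rule LSup_least[OF CL ABL]) (use CZ in \<open>auto simp: \<Z>_def\<close>)
    moreover have "Z0 \<subseteq> LSup C"
    proof -
      obtain U where "U \<in> C" using False by blast
      then show ?thesis using LSup_upper[OF CL] CZ unfolding \<Z>_def by blast
    qed
    ultimately have "LSup C \<in> \<Z>" using LSup_in_Lat[OF CL] by (simp add: \<Z>_def)
    then show ?thesis using LSup_upper[OF CL] by blast
  qed
  from subset_Zorn[OF this] obtain Z where Z: "Z \<in> \<Z>" and max: "\<And>X. \<lbrakk>X \<in> \<Z>; Z \<subseteq> X\<rbrakk> \<Longrightarrow> X = Z" by blast
  have ZL: "Z \<in> Lat" and Zsub: "Z0 \<subseteq> Z" "Z \<subseteq> A <+>\<^bsub>R\<^esub> B" and AZ: "A \<inter> Z = {\<zero>}" and BZ: "B \<inter> Z = {\<zero>}"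
    using Z by (auto simp: \<Z>_def)
  note ZBL = Lat_sum[OF ZL B] and ZAL = Lat_sum[OF ZL A]
  have "A \<subseteq> Z <+>\<^bsub>R\<^esub> B"
  proof (rule ccontr)
    assume notA: "\<not> A \<subseteq> Z <+>\<^bsub>R\<^esub> B"
    \<comment> \<open>Otherwise counting ranks would give
      \<open>rk B \<le> rk Z \<le> rk A\<close>.\<close>
    have notB: "\<not> B \<subseteq> Z <+>\<^bsub>R\<^esub> A"
    proof
      assume "B \<subseteq> Z <+>\<^bsub>R\<^esub> A"
      then have "rk A + rk B \<le> rk (Z <+>\<^bsub>R\<^esub> A)"
        using Lat_sum_upper[OF ZL A] by (intro rk_sum_le[OF A B ZAL AB]) auto
      also have "\<dots> = rk Z + rk A" using AZ by (intro rk_sum[OF ZL A]) auto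
      finally have "rk B \<le> rk Z" by simp
      moreover have "rk B + rk Z \<le> rk (A <+>\<^bsub>R\<^esub> B)"
        using Lat_sum_upper[OF A B] Zsub by (intro rk_sum_le[OF B ZL ABL BZ]) auto
      then have "rk Z \<le> rk A" using rk_sum[OF A B AB] by simp
      ultimately show False using less by simp
    qed
    obtain a where a: "a \<in> A" "a \<noteq> \<zero>" and ay: "\<And>y. \<lbrakk>y \<in> carrier R; a \<otimes> y \<in> Z <+>\<^bsub>R\<^esub> B\<rbrakk> \<Longrightarrow> a \<otimes> y = \<zero>"
      using complement_element[OF A ZBL notA] by blast
    obtain b where b: "b \<in> B" "b \<noteq> \<zero>" and byy: "\<And>y. \<lbrakk>y \<in> carrier R; b \<otimes> y \<in> Z <+>\<^bsub>R\<^esub> A\<rbrakk> \<Longrightarrow> b \<otimes> y = \<zero>"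
      using complement_element[OF B ZAL notB] by blast
    have aR: "a \<in> carrier R" and bR: "b \<in> carrier R" using a b Lat_closed(1) A B by auto
    obtain r where r: "r \<in> carrier R" "b \<otimes> r \<otimes> a \<noteq> \<zero>"
      using irreducible_prime[OF irreducible bR b(2) aR a(2)] by blast
    define w where "w = b \<otimes> r \<otimes> a"
    have wR: "w \<in> carrier R" using aR bR r by (simp add: w_def)
    obtain v where v: "v \<in> carrier R" "w \<otimes> v \<otimes> w = w" using regular[OF wR] by blast
    \<comment> \<open>Since \<open>b \<otimes> r \<otimes> e = w\<close>, left multiplication by
      \<open>b \<otimes> r\<close> maps \<open>PI e\<close>, a part of \<open>A\<close>,
      isomorphically onto \<open>PI w\<close>, a part of \<open>B\<close>. The element
      \<open>c = e \<oplus> w\<close> generates the graph of this isomorphism, which is to be added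
      to \<open>Z\<close>.\<close>
    define e where "e = a \<otimes> v \<otimes> w"
    have eR: "e \<in> carrier R" using aR v wR by (simp add: e_def)
    have wB: "w \<in> B" using Lat_closed(3)[OF B b(1), of "r \<otimes> a"] r aR bR by (simp add: w_def m_assoc)
    have eA: "e \<in> A" using Lat_closed(3)[OF A a(1), of "v \<otimes> w"] v wR aR by (simp add: e_def m_assoc)
    have bre: "b \<otimes> r \<otimes> e = w"
      using v aR bR r wR by (simp add: e_def m_assoc) (simp add: w_def m_assoc)
    have wy: "w \<otimes> y = \<zero>" if "y \<in> carrier R" "w \<otimes> y \<in> Z <+>\<^bsub>R\<^esub> A" for y
      using byy[of "r \<otimes> a \<otimes> y"] that r aR bR by (simp add: w_def m_assoc)
    have ey: "e \<otimes> y = \<zero>" if "y \<in> carrier R" "e \<otimes> y \<in> Z <+>\<^bsub>R\<^esub> B" for y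
      using ay[of "v \<otimes> w \<otimes> y"] that v wR aR by (simp add: e_def m_assoc)
    have ew: "e \<otimes> y = \<zero> \<longleftrightarrow> w \<otimes> y = \<zero>" if y: "y \<in> carrier R" for y
    proof
      assume "e \<otimes> y = \<zero>"
      then have "b \<otimes> r \<otimes> (e \<otimes> y) = \<zero>" using bR r by simp
      then have "b \<otimes> r \<otimes> e \<otimes> y = \<zero>" using bR r eR y by (simp add: m_assoc)
      then show "w \<otimes> y = \<zero>" by (simp add: bre)
    next
      assume "w \<otimes> y = \<zero>"
      then show "e \<otimes> y = \<zero>" using aR v wR y by (simp add: e_def m_assoc)
    qed
    define c where "c = e \<oplus> w"
    have cR: "c \<in> carrier R" using eR wR by (simp add: c_def)
    define Z' where "Z' = Z <+>\<^bsub>R\<^esub> PI c"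
    have Z'L: "Z' \<in> Lat" unfolding Z'_def by (rule Lat_sum[OF ZL PI_in_Lat[OF cR]])
    have elem: "\<exists>z y. z \<in> Z \<and> y \<in> carrier R \<and> x = z \<oplus> (e \<otimes> y \<oplus> w \<otimes> y)" if "x \<in> Z'" for x
    proof -
      obtain z t where "z \<in> Z" "t \<in> PI c" "x = z \<oplus> t" using \<open>x \<in> Z'\<close> unfolding Z'_def by (rule set_addE)
      then show ?thesis using eR wR by (auto simp: PI_iff c_def l_distr)
    qed
    have ZR: "z \<in> carrier R" if "z \<in> Z" for z using that Lat_closed(1)[OF ZL] by blast
    have "A \<inter> Z' = {\<zero>}"
    proof (rule Lat_Int_zero[OF A Z'L], rule subsetI)
      fix x assume x: "x \<in> A \<inter> Z'"
      then obtain z y where zy: "z \<in> Z" "y \<in> carrier R" "x = z \<oplus> (e \<otimes> y \<oplus> w \<otimes> y)" using elem by blast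
      have eyA: "e \<otimes> y \<in> A" using Lat_closed(3)[OF A eA zy(2)] .
      have "w \<otimes> y = \<ominus> z \<oplus> (x \<ominus> e \<otimes> y)"
        using zy eR wR ZR[OF zy(1)] by (simp add: minus_eq a_assoc r_neg1 plus_minus_cancel)
      moreover have "\<ominus> z \<oplus> (x \<ominus> e \<otimes> y) \<in> Z <+>\<^bsub>R\<^esub> A"
        using Lat_closed(5)[OF ZL zy(1)] Lat_closed(6)[OF A _ eyA] x by (intro set_addI) auto
      ultimately have "w \<otimes> y = \<zero>" using wy zy by simp
      moreover from this have "e \<otimes> y = \<zero>" using ew zy by simp
      ultimately have "x = z" using zy ZR by simp
      then show "x \<in> {\<zero>}" using x zy AZ by blast
    qed
    moreover have "B \<inter> Z' = {\<zero>}"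
    proof (rule Lat_Int_zero[OF B Z'L], rule subsetI)
      fix x assume x: "x \<in> B \<inter> Z'"
      then obtain z y where zy: "z \<in> Z" "y \<in> carrier R" "x = z \<oplus> (e \<otimes> y \<oplus> w \<otimes> y)" using elem by blast
      have wyB: "w \<otimes> y \<in> B" using Lat_closed(3)[OF B wB zy(2)] .
      have "e \<otimes> y = \<ominus> z \<oplus> (x \<ominus> w \<otimes> y)"
        using zy eR wR ZR[OF zy(1)] by (simp add: minus_eq a_assoc r_neg r_neg1 r_neg2)
      moreover have "\<ominus> z \<oplus> (x \<ominus> w \<otimes> y) \<in> Z <+>\<^bsub>R\<^esub> B"
        using Lat_closed(5)[OF ZL zy(1)] Lat_closed(6)[OF B _ wyB] x by (intro set_addI) auto
      ultimately have "e \<otimes> y = \<zero>" using ey zy by simp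
      moreover from this have "w \<otimes> y = \<zero>" using ew zy by simp
      ultimately have "x = z" using zy ZR by simp
      then show "x \<in> {\<zero>}" using x zy BZ by blast
    qed
    moreover have "Z \<subseteq> Z'" unfolding Z'_def by (rule Lat_sum_upper[OF ZL PI_in_Lat[OF cR]])
    moreover have "c \<in> A <+>\<^bsub>R\<^esub> B" unfolding c_def by (rule set_addI[OF eA wB])
    then have "Z' \<subseteq> A <+>\<^bsub>R\<^esub> B"
      unfolding Z'_def by (intro Lat_sum_least[OF ABL Zsub(2)] PI_subset_Lat[OF ABL])
    ultimately have "Z' \<in> \<Z>" using Z'L Zsub by (auto simp: \<Z>_def)
    then have "Z' = Z" using max \<open>Z \<subseteq> Z'\<close> by blast
    then have "c \<in> Z"
      using Lat_sum_upper(2)[OF ZL PI_in_Lat[OF cR]] PI_self[OF cR] unfolding Z'_def by blast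
    \<comment> \<open>If the graph added nothing to \<open>Z\<close>, then \<open>w\<close>, being
      \<open>c\<close> minus \<open>e\<close>, would lie in the sum of \<open>Z\<close> and
      \<open>A\<close>, which \<open>PI w\<close> meets in zero only.\<close>
    then have "c \<oplus> \<ominus> e \<in> Z <+>\<^bsub>R\<^esub> A" using Lat_closed(5)[OF A eA] by (rule set_addI)
    moreover have "c \<oplus> \<ominus> e = w \<otimes> \<one>" using eR wR by (simp add: c_def a_assoc plus_minus_cancel)
    ultimately have "w \<otimes> \<one> = \<zero>" using wy[of \<one>] by simp
    then show False using r wR by (simp add: w_def)
  qed
  then show ?thesis using ZL Zsub AZ BZ by blast
qed

end

section \<open>Continuity of the rank along chains of idempotents\<close>

context continuous_regular_ring
begin

text \<open>The order of idempotents compares the images \<open>PI e\<close> as well as the kernels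
  \<open>PI (\<one> \<ominus> e)\<close>. The join \<open>S\<close> of the images and the meet
  \<open>W\<close> of the kernels are complementary by continuity of the lattice, and
  \<open>s\<close> is the projection onto \<open>S\<close> along \<open>W\<close>.\<close>

lemma idem_chain_Sup:
  assumes C: "C \<subseteq> idempotents R" "C \<noteq> {}" and chain: "\<And>e f. \<lbrakk>e \<in> C; f \<in> C\<rbrakk> \<Longrightarrow> idem_le R e f \<or> idem_le R f e"
  obtains s where "s \<in> idempotents R" "PI s = LSup (PI ` C)" "\<And>c. c \<in> C \<Longrightarrow> idem_le R c s"
    "\<And>g. \<lbrakk>g \<in> idempotents R; \<And>c. c \<in> C \<Longrightarrow> idem_le R c g\<rbrakk> \<Longrightarrow> idem_le R s g"
proof -
  have CR: "c \<in> carrier R" "c \<otimes> c = c" "c \<in> idempotents R" if "c \<in> C" for c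
    using C(1) that idempotentsD by auto
  have CL: "PI ` C \<subseteq> Lat" using CR by auto
  have ch: "U \<subseteq> W \<or> W \<subseteq> U" if UW: "U \<in> PI ` C" "W \<in> PI ` C" for U W
  proof -
    obtain e f where ef: "e \<in> C" "f \<in> C" "U = PI e" "W = PI f" using UW by blast
    show ?thesis
      using chain[OF ef(1,2)] idem_le_PI[OF CR(3)[OF ef(1)] CR(3)[OF ef(2)]]
        idem_le_PI[OF CR(3)[OF ef(2)] CR(3)[OF ef(1)]] ef(3,4) by blast
  qed
  define D where "D = (\<lambda>c. PI (\<one> \<ominus> c)) ` C"
  have DL: "D \<subseteq> Lat" using CR by (auto simp: D_def)
  have le_comp: "PI (\<one> \<ominus> f) \<subseteq> PI (\<one> \<ominus> e)" if "e \<in> carrier R" "f \<in> carrier R" "idem_le R e f" "e \<otimes> e = e" for e f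
  proof -
    have "e \<otimes> (\<one> \<ominus> f) = \<zero>"
      using that by (simp add: idem_le_def minus_eq r_distr r_minus r_neg)
    moreover have "(\<one> \<ominus> e) \<otimes> (\<one> \<ominus> f) = (\<one> \<ominus> f) \<ominus> e \<otimes> (\<one> \<ominus> f)"
      using that(1,2) by (simp add: minus_eq l_distr l_minus)
    ultimately have "(\<one> \<ominus> e) \<otimes> (\<one> \<ominus> f) = \<one> \<ominus> f" using that(1,2) by (simp add: minus_eq)
    then show ?thesis using that by (metis PI_iff PI_subset_iff minus_closed one_closed)
  qed
  have chD: "U \<subseteq> W \<or> W \<subseteq> U" if UW: "U \<in> D" "W \<in> D" for U W
  proof -
    obtain e f where ef: "e \<in> C" "f \<in> C" "U = PI (\<one> \<ominus> e)" "W = PI (\<one> \<ominus> f)"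
      using UW unfolding D_def by blast
    show ?thesis
      using chain[OF ef(1,2)] le_comp[of e f] le_comp[of f e] CR[OF ef(1)] CR[OF ef(2)] ef(3,4) by blast
  qed
  define S W where "S = LSup (PI ` C)" and "W = LInf D"
  have SL: "S \<in> Lat" and WL: "W \<in> Lat"
    unfolding S_def W_def by (rule LSup_in_Lat[OF CL], rule LInf_in_Lat[OF DL])
  have "W \<inter> S = {\<zero>}"
    unfolding S_def
  proof (rule chain_Sup_disjoint[OF CL ch WL])
    fix U assume "U \<in> PI ` C"
    then obtain c where c: "c \<in> C" "U = PI c" by auto
    have "W \<inter> U \<subseteq> {\<zero>}"
    proof
      fix x assume x: "x \<in> W \<inter> U"
      have "x \<in> PI (\<one> \<ominus> c)" using x LInf_lower[OF DL] c(1) unfolding W_def D_def by blast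
      then obtain y where y: "y \<in> carrier R" "x = (\<one> \<ominus> c) \<otimes> y" by (auto simp: PI_iff)
      have "c \<otimes> x = \<zero>"
        using y CR[OF c(1)] idempotent_complement(2)[OF CR(3)[OF c(1)]] by (simp add: m_assoc[symmetric])
      moreover have "c \<otimes> x = x" using x c CR idem_PI_iff by auto
      ultimately show "x \<in> {\<zero>}" by simp
    qed
    then show "W \<inter> U = {\<zero>}" using Lat_Int_zero WL c CR by auto
  qed
  have "S <+>\<^bsub>R\<^esub> W = carrier R"
    unfolding W_def
  proof (rule chain_Inf_sum[OF DL chD SL])
    fix U assume "U \<in> D"
    then obtain c where c: "c \<in> C" "U = PI (\<one> \<ominus> c)" by (auto simp: D_def)
    show "S <+>\<^bsub>R\<^esub> U = carrier R"
    proof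
      show "S <+>\<^bsub>R\<^esub> U \<subseteq> carrier R" using Lat_closed(1)[OF Lat_sum[OF SL]] c CR by simp
      show "carrier R \<subseteq> S <+>\<^bsub>R\<^esub> U"
      proof
        fix x assume x: "x \<in> carrier R"
        have "c \<otimes> x \<in> PI c" using x unfolding PI_iff by blast
        then have "c \<otimes> x \<in> S" using LSup_upper[OF CL imageI[OF c(1)]] unfolding S_def by blast
        moreover have "(\<one> \<ominus> c) \<otimes> x \<in> U" using x unfolding c(2) PI_iff by blast
        ultimately have "c \<otimes> x \<oplus> (\<one> \<ominus> c) \<otimes> x \<in> S <+>\<^bsub>R\<^esub> U" by (rule set_addI)
        then show "x \<in> S <+>\<^bsub>R\<^esub> U"
          using x CR[OF c(1)] by (simp add: minus_eq l_distr l_minus plus_minus_cancel)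
      qed
    qed
  qed
  then have "\<one> \<in> S <+>\<^bsub>R\<^esub> W" by simp
  \<comment> \<open>The components of \<open>\<one>\<close> in \<open>S\<close> and \<open>W\<close>
    are the two complementary projections.\<close>
  then obtain s w where sw: "s \<in> S" "w \<in> W" "\<one> = s \<oplus> w" by (rule set_addE)
  have sR: "s \<in> carrier R" and wR: "w \<in> carrier R" using sw Lat_closed(1) SL WL by auto
  have eqs: "s \<otimes> x = x" if x: "x \<in> S" for x
  proof -
    have xR: "x \<in> carrier R" using x Lat_closed(1)[OF SL] by blast
    have eq: "x = s \<otimes> x \<oplus> w \<otimes> x" using xR sR wR l_distr[of s w x] by (simp flip: sw(3))
    have "(s \<otimes> x \<oplus> w \<otimes> x) \<ominus> s \<otimes> x = w \<otimes> x"
      using xR sR wR by (simp add: minus_eq a_assoc plus_minus_cancel)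
    then have "w \<otimes> x = x \<ominus> s \<otimes> x" by (simp flip: eq)
    moreover have "x \<ominus> s \<otimes> x \<in> S" using Lat_closed(3,6)[OF SL] x sw(1) xR by blast
    moreover have "w \<otimes> x \<in> W" using Lat_closed(3)[OF WL sw(2) xR] .
    ultimately have "w \<otimes> x = \<zero>" using \<open>W \<inter> S = {\<zero>}\<close> by auto
    then show ?thesis using eq xR sR by simp
  qed
  have s: "s \<in> idempotents R" using eqs[OF sw(1)] sR by (simp add: idempotents_def)
  have PIs: "PI s = S"
  proof
    show "PI s \<subseteq> S" by (rule PI_subset_Lat[OF SL sw(1)])
    show "S \<subseteq> PI s" using eqs Lat_closed(1)[OF SL] idem_PI_iff[OF s] by blast
  qed
  have w: "w = \<one> \<ominus> s" using sw(3) sR wR plus_minus_cancel[of s w] by (simp add: minus_eq a_assoc)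
  have le: "idem_le R c s" if c: "c \<in> C" for c
  proof -
    have "c \<in> S" using LSup_upper[OF CL, of "PI c"] c PI_self CR unfolding S_def by blast
    then have "s \<otimes> c = c" by (rule eqs)
    moreover have "w \<in> PI (\<one> \<ominus> c)" using sw(2) LInf_lower[OF DL] c unfolding W_def D_def by blast
    then obtain y where y: "y \<in> carrier R" "w = (\<one> \<ominus> c) \<otimes> y" by (auto simp: PI_iff)
    then have "c \<otimes> w = \<zero>"
      using CR[OF c] idempotent_complement(2)[OF CR(3)[OF c]] by (simp add: m_assoc[symmetric])
    then have "c \<ominus> c \<otimes> s = \<zero>" using w sR CR[OF c] by (simp add: minus_eq r_distr r_minus)
    then have "c \<otimes> s = c" using diff_zero_iff[of c "c \<otimes> s"] sR CR[OF c] by simp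
    ultimately show ?thesis by (simp add: idem_le_def)
  qed
  have least: "idem_le R s g" if g: "g \<in> idempotents R" and gc: "\<And>c. c \<in> C \<Longrightarrow> idem_le R c g" for g
  proof -
    have gR: "g \<in> carrier R" "g \<otimes> g = g" using g idempotentsD by auto
    have "S \<subseteq> PI g"
      unfolding S_def
    proof (rule LSup_least[OF CL PI_in_Lat[OF gR(1)]])
      fix U assume "U \<in> PI ` C"
      then obtain c where c: "c \<in> C" "U = PI c" by auto
      show "U \<subseteq> PI g" unfolding c(2) by (rule idem_le_PI[OF CR(3)[OF c(1)] g gc[OF c(1)]])
    qed
    then have "g \<otimes> s = s" using sw(1) idem_PI_iff[OF g] by blast
    moreover have "PI (\<one> \<ominus> g) \<subseteq> W"
      unfolding W_def
    proof (rule LInf_greatest[OF DL])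
      show "PI (\<one> \<ominus> g) \<in> Lat" using gR by simp
      fix U assume "U \<in> D"
      then obtain c where c: "c \<in> C" "U = PI (\<one> \<ominus> c)" by (auto simp: D_def)
      show "PI (\<one> \<ominus> g) \<subseteq> U"
        unfolding c(2) by (rule le_comp[OF CR(1)[OF c(1)] gR(1) gc[OF c(1)] CR(2)[OF c(1)]])
    qed
    then have gW: "\<one> \<ominus> g \<in> W" using PI_self gR by blast
    then have "s \<otimes> (\<one> \<ominus> g) = \<zero>"
    proof -
      have gg: "\<one> \<ominus> g = s \<otimes> (\<one> \<ominus> g) \<oplus> w \<otimes> (\<one> \<ominus> g)"
        using gR(1) sR wR l_distr[of s w "\<one> \<ominus> g"] by (simp flip: sw(3))
      have "(s \<otimes> (\<one> \<ominus> g) \<oplus> w \<otimes> (\<one> \<ominus> g)) \<ominus> w \<otimes> (\<one> \<ominus> g) = s \<otimes> (\<one> \<ominus> g)"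
        using gR(1) sR wR minus_closed[OF one_closed gR(1)] by (simp add: minus_eq[of "_ \<oplus> _"] a_assoc r_neg)
      then have 1: "s \<otimes> (\<one> \<ominus> g) = (\<one> \<ominus> g) \<ominus> w \<otimes> (\<one> \<ominus> g)" by (simp flip: gg)
      have "(\<one> \<ominus> g) \<ominus> w \<otimes> (\<one> \<ominus> g) \<in> W" using Lat_closed(3,6)[OF WL] gW sw(2) gR by simp
      then have "s \<otimes> (\<one> \<ominus> g) \<in> W" by (simp only: 1)
      moreover have "s \<otimes> (\<one> \<ominus> g) \<in> S" using Lat_closed(3)[OF SL sw(1)] gR by simp
      ultimately show ?thesis using \<open>W \<inter> S = {\<zero>}\<close> by blast
    qed
    then have "s \<ominus> s \<otimes> g = \<zero>" using sR gR by (simp add: minus_eq r_distr r_minus)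
    then have "s \<otimes> g = s" using diff_zero_iff[of s "s \<otimes> g"] sR gR by simp
    ultimately show ?thesis by (simp add: idem_le_def)
  qed
  from s PIs le least show thesis unfolding S_def by (rule that)
qed

end

context irreducible_continuous_ring
begin

text \<open>If the rank jumped by \<open>\<gamma>\<close> at the supremum \<open>s\<close>, then graphs matching the parts
  \<open>a (m + n) - a m\<close> injectively with submodules of one right ideal \<open>Q\<close> of rank less than \<open>\<gamma>\<close>
  could be chosen increasing in \<open>n\<close>, and their supremum would match \<open>s - a m\<close>, which has rank
  at least \<open>\<gamma>\<close>.\<close>

lemma rho_increasing_Sup:
  assumes a: "\<And>n. a n \<in> idempotents R" "\<And>n. idem_le R (a n) (a (Suc n))" and s: "s \<in> idempotents R"
    "\<And>n. idem_le R (a n) s" "PI s \<subseteq> LSup (range (\<lambda>n. PI (a n)))"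
    and lim: "\<And>n. \<rho> (a n) < \<alpha>" "\<And>\<delta>. \<delta> > 0 \<Longrightarrow> \<exists>n. \<rho> (a n) > \<alpha> - \<delta>"
  shows "\<rho> s \<le> \<alpha>"
proof (rule ccontr)
  assume "\<not> \<rho> s \<le> \<alpha>"
  define \<gamma> where "\<gamma> = \<rho> s - \<alpha>"
  have \<gamma>: "\<gamma> > 0" using \<open>\<not> \<rho> s \<le> \<alpha>\<close> by (simp add: \<gamma>_def)
  have aR: "a n \<in> carrier R" "a n \<otimes> a n = a n" for n using a(1)[of n] idempotentsD by auto
  have sR: "s \<in> carrier R" "s \<otimes> s = s" using s(1) idempotentsD by auto
  have a_le: "idem_le R (a m) (a n)" if "m \<le> n" for m n
    using that by (induction rule: dec_induct) (use a idem_le_refl idem_le_trans aR in blast)+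
  \<comment> \<open>The indices \<open>k\<close> and \<open>m\<close> are chosen so that
    \<open>q = a m \<ominus> a k\<close> has rank below \<open>\<gamma>\<close> but above
    \<open>\<alpha> - \<rho> (a m)\<close>, which bounds the rank of every \<open>T n\<close>. The
    choice of \<open>k\<close> ensures the former; the latter holds once \<open>\<rho> (a m)\<close>
    has passed the midpoint between \<open>\<rho> (a k)\<close> and \<open>\<alpha>\<close>.\<close>
  obtain k where k: "\<rho> (a k) > \<alpha> - \<gamma>" using lim(2)[OF \<gamma>] by blast
  have "(\<alpha> - \<rho> (a k)) / 2 > 0" using lim(1)[of k] by simp
  from lim(2)[OF this] obtain m0 where m0: "\<rho> (a m0) > \<alpha> - (\<alpha> - \<rho> (a k)) / 2" by blast
  have rho_a: "\<rho> (a m) \<le> \<rho> (a n)" if "m \<le> n" for m n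
    by (rule rho_mono[OF aR(1) aR(1) idem_le_PI[OF a(1) a(1) a_le[OF that]]])
  define m where "m = max m0 k"
  have m: "k \<le> m" "\<rho> (a m) > \<alpha> - (\<alpha> - \<rho> (a k)) / 2"
    using rho_a[of m0 m] m0 by (auto simp: m_def)
  define q where "q = a m \<ominus> a k"
  have qR: "q \<in> carrier R" using aR by (simp add: q_def)
  have rho_q: "\<rho> q = \<rho> (a m) - \<rho> (a k)"
    unfolding q_def by (rule rho_idem_diff[OF a(1) a(1) a_le[OF m(1)]])
  have q1: "\<alpha> - \<rho> (a m) < \<rho> q" using m(2) rho_q by (simp add: field_simps)
  have q2: "\<rho> q < \<gamma>" using k rho_q lim(1)[of m] by simp
  have aq: "a m \<otimes> q = q" unfolding q_def by (rule idem_le_diff(5)[OF a(1) a(1) a_le[OF m(1)]])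
  define Q where "Q = PI q"
  have QL: "Q \<in> Lat" using qR by (simp add: Q_def)
  have rkQ: "rk Q = \<rho> q" by (simp add: Q_def rk_PI qR)
  \<comment> \<open>Left multiplication by \<open>a m\<close> is the identity on \<open>Q\<close>
    and zero on every \<open>T n\<close>; it serves as the projection that separates the
    two.\<close>
  have amQ: "a m \<otimes> x = x" if "x \<in> Q" for x
    using that aq qR aR by (auto simp: Q_def PI_iff m_assoc[symmetric])
  define T where "T n = PI (a (m + n) \<ominus> a m)" for n
  have dR: "a (m + n) \<ominus> a m \<in> carrier R" for n using aR by simp
  have TL: "T n \<in> Lat" for n using dR by (simp add: T_def)
  have amT: "a m \<otimes> x = \<zero>" if "x \<in> T n" for x n
    using that idem_le_diff(2)[OF a(1) a(1) a_le, of m "m + n"] aR dR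
    by (auto simp: T_def PI_iff m_assoc[symmetric])
  have rkT: "rk (T n) < rk Q" for n
  proof -
    have "rk (T n) = \<rho> (a (m + n)) - \<rho> (a m)"
      unfolding T_def rk_PI[OF dR] by (rule rho_idem_diff[OF a(1) a(1) a_le]) simp
    then show ?thesis using lim(1)[of "m + n"] q1 rkQ by simp
  qed
  have T_Suc: "T n \<subseteq> T (Suc n)" for n
  proof -
    have "(a (m + Suc n) \<ominus> a m) \<otimes> (a (m + n) \<ominus> a m) = a (m + n) \<ominus> a m"
      using idem_leD[OF a_le[of "m + n" "m + Suc n"]] idem_leD[OF a_le[of m "m + n"]]
        idem_leD[OF a_le[of m "m + Suc n"]] aR
      by (simp add: minus_eq l_distr r_distr l_minus r_minus a_assoc r_neg)
    then have "a (m + n) \<ominus> a m \<in> PI (a (m + Suc n) \<ominus> a m)" using dR[of n] unfolding PI_iff by metis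
    then show ?thesis unfolding T_def using PI_subset_iff dR by blast
  qed
  have T_mono: "T i \<subseteq> T j" if "i \<le> j" for i j
    using lift_Suc_mono_le[of T, OF T_Suc that] .
  have QT: "T n \<inter> Q = {\<zero>}" for n
    by (rule Lat_Int_zero[OF TL QL]) (use amQ amT in force)
  define P where "P n Z \<longleftrightarrow> Z \<in> Lat \<and> Z \<subseteq> T n <+>\<^bsub>R\<^esub> Q \<and> T n \<inter> Z = {\<zero>} \<and> Q \<inter> Z = {\<zero>} \<and> T n \<subseteq> Z <+>\<^bsub>R\<^esub> Q" for n Z
  have z1: "{\<zero>} \<subseteq> T n <+>\<^bsub>R\<^esub> Q" "T n \<inter> {\<zero>} = {\<zero>}" "Q \<inter> {\<zero>} = {\<zero>}" for n
    using Lat_closed(2)[OF Lat_sum[OF TL QL]] Lat_closed(2)[OF TL] Lat_closed(2)[OF QL] by auto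
  have "\<exists>Z. \<forall>n. P n (Z n) \<and> Z n \<subseteq> Z (Suc n)"
  proof (rule dependent_nat_choice)
    have "\<exists>Z\<in>Lat. {\<zero>} \<subseteq> Z \<and> Z \<subseteq> T 0 <+>\<^bsub>R\<^esub> Q \<and> T 0 \<inter> Z = {\<zero>} \<and> Q \<inter> Z = {\<zero>} \<and> T 0 \<subseteq> Z <+>\<^bsub>R\<^esub> Q"
      by (rule graph_extension[OF TL QL QT rkT zero_in_Lat z1])
    then obtain Z where "P 0 Z" by (elim bexE conjE) (simp add: P_def)
    then show "\<exists>Z. P 0 Z" by (rule exI)
    fix Z n assume Z: "P n Z"
    have Z2: "Z \<subseteq> T (Suc n) <+>\<^bsub>R\<^esub> Q"
      using Z Lat_sum_mono[OF TL QL T_Suc subset_refl, of n] unfolding P_def by blast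
    have ZL: "Z \<in> Lat" using Z by (simp add: P_def)
    \<comment> \<open>The graph built so far has to avoid the larger ideal \<open>T (Suc n)\<close>.
      An element of the intersection lies in the sum of \<open>T n\<close> and \<open>Q\<close>, and
      applying \<open>a m\<close> shows that its component in \<open>Q\<close> vanishes.\<close>
    have "T (Suc n) \<inter> Z = {\<zero>}"
    proof (rule Lat_Int_zero[OF TL ZL], rule subsetI)
      fix x assume x: "x \<in> T (Suc n) \<inter> Z"
      then have "x \<in> T n <+>\<^bsub>R\<^esub> Q" using Z unfolding P_def by blast
      then obtain t u where tu: "t \<in> T n" "u \<in> Q" "x = t \<oplus> u" by (rule set_addE)
      have R: "t \<in> carrier R" "u \<in> carrier R" using tu Lat_closed(1) TL QL by blast+
      have "a m \<otimes> x = u" using tu R amQ amT aR by (simp add: r_distr)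
      moreover have "a m \<otimes> x = \<zero>" using x amT by blast
      ultimately have "x = t" using tu R by simp
      then have "x \<in> T n \<inter> Z" using tu x by blast
      then show "x \<in> {\<zero>}" using Z unfolding P_def by blast
    qed
    moreover have "Q \<inter> Z = {\<zero>}" using Z by (simp add: P_def)
    ultimately have "\<exists>Z'\<in>Lat. Z \<subseteq> Z' \<and> Z' \<subseteq> T (Suc n) <+>\<^bsub>R\<^esub> Q \<and> T (Suc n) \<inter> Z' = {\<zero>} \<and> Q \<inter> Z' = {\<zero>} \<and> T (Suc n) \<subseteq> Z' <+>\<^bsub>R\<^esub> Q"
      by (rule graph_extension[OF TL QL QT rkT ZL Z2])
    then obtain Z' where "P (Suc n) Z'" "Z \<subseteq> Z'" by (elim bexE conjE) (simp add: P_def)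
    then show "\<exists>Z'. P (Suc n) Z' \<and> Z \<subseteq> Z'" by blast
  qed
  then obtain Z where ZP: "\<And>n. P n (Z n)" and Z_Suc: "\<And>n. Z n \<subseteq> Z (Suc n)" by blast
  have ZL: "Z n \<in> Lat" for n using ZP[of n] by (simp add: P_def)
  have Z_mono: "Z i \<subseteq> Z j" if "i \<le> j" for i j
    using lift_Suc_mono_le[of Z, OF Z_Suc that] .
  have mono_ch: "U \<subseteq> W \<or> W \<subseteq> U" if h: "\<And>i j. i \<le> j \<Longrightarrow> F i \<subseteq> F j" "U \<in> range F" "W \<in> range F" for F :: "nat \<Rightarrow> 'a set" and U W
  proof -
    obtain i j where "U = F i" "W = F j" using h(2,3) by blast
    then show ?thesis using h(1)[of i j] h(1)[of j i] nle_le[of i j] by auto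
  qed
  have TTL: "range T \<subseteq> Lat" and ZZL: "range Z \<subseteq> Lat" using TL ZL by auto
  define TT ZZ where "TT = LSup (range T)" and "ZZ = LSup (range Z)"
  have L: "TT \<in> Lat" "ZZ \<in> Lat" unfolding TT_def ZZ_def using LSup_in_Lat TTL ZZL by auto
  have TTu: "T n \<subseteq> TT" and ZZu: "Z n \<subseteq> ZZ" for n
    unfolding TT_def ZZ_def using LSup_upper[OF TTL] LSup_upper[OF ZZL] by auto
  have TZ: "T i \<inter> Z j = {\<zero>}" for i j
  proof -
    have "T i \<subseteq> T (max i j)" "Z j \<subseteq> Z (max i j)" by (simp_all add: T_mono Z_mono)
    then have "T i \<inter> Z j \<subseteq> {\<zero>}" using ZP[of "max i j"] unfolding P_def by blast
    then show ?thesis by (rule Lat_Int_zero[OF TL ZL])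
  qed
  have TZZ: "T i \<inter> ZZ = {\<zero>}" for i
    unfolding ZZ_def using TZ by (intro chain_Sup_disjoint[OF ZZL mono_ch[OF Z_mono] TL]) auto
  have "ZZ \<inter> TT = {\<zero>}"
    unfolding TT_def using TZZ by (intro chain_Sup_disjoint[OF TTL mono_ch[OF T_mono] L(2)]) auto
  have QZZ: "Q \<inter> ZZ = {\<zero>}"
    unfolding ZZ_def using ZP by (intro chain_Sup_disjoint[OF ZZL mono_ch[OF Z_mono] QL]) (auto simp: P_def)
  have QTT: "Q \<inter> TT = {\<zero>}"
    unfolding TT_def using QT by (intro chain_Sup_disjoint[OF TTL mono_ch[OF T_mono] QL]) auto
  have "ZZ \<subseteq> TT <+>\<^bsub>R\<^esub> Q"
    unfolding ZZ_def
  proof (rule LSup_least[OF ZZL Lat_sum[OF L(1) QL]])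
    fix U assume "U \<in> range Z"
    then show "U \<subseteq> TT <+>\<^bsub>R\<^esub> Q" using ZP Lat_sum_mono[OF L(1) QL TTu subset_refl] unfolding P_def by blast
  qed
  \<comment> \<open>The limit \<open>ZZ\<close> is still a graph between \<open>TT\<close> and a
    part of \<open>Q\<close>: counting ranks in the sum of \<open>TT\<close> and \<open>Q\<close>
    gives \<open>rk ZZ \<le> rk Q\<close>, and counting them in the sum of \<open>ZZ\<close> and
    \<open>Q\<close> gives \<open>rk TT \<le> rk ZZ\<close>.\<close>
  then have "rk ZZ + rk TT \<le> rk (TT <+>\<^bsub>R\<^esub> Q)"
    using Lat_sum_upper[OF L(1) QL] by (intro rk_sum_le Lat_sum L QL \<open>ZZ \<inter> TT = {\<zero>}\<close>) auto
  also have "\<dots> = rk TT + rk Q" using QTT by (intro rk_sum L QL) auto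
  finally have 1: "rk ZZ \<le> rk Q" by simp
  have "TT \<subseteq> ZZ <+>\<^bsub>R\<^esub> Q"
    unfolding TT_def
  proof (rule LSup_least[OF TTL Lat_sum[OF L(2) QL]])
    fix U assume "U \<in> range T"
    then show "U \<subseteq> ZZ <+>\<^bsub>R\<^esub> Q" using ZP Lat_sum_mono[OF L(2) QL ZZu subset_refl] unfolding P_def by blast
  qed
  then have "rk Q + rk TT \<le> rk (ZZ <+>\<^bsub>R\<^esub> Q)"
    using Lat_sum_upper[OF L(2) QL] by (intro rk_sum_le Lat_sum L QL QTT) auto
  also have "\<dots> = rk ZZ + rk Q" using QZZ by (intro rk_sum L QL) auto
  finally have 2: "rk TT \<le> rk ZZ" by simp
  have amTT: "a m \<otimes> x = \<zero>" if "x \<in> TT" for x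
  proof -
    have "TT \<subseteq> {x \<in> carrier R. a m \<otimes> x = \<zero>}"
      unfolding TT_def by (rule LSup_least[OF TTL right_annihilator_in_Lat[OF aR(1)]])
        (use amT Lat_closed(1)[OF TL] in blast)
    then show ?thesis using that by blast
  qed
  have AL: "PI (a m) \<in> Lat" using aR by simp
  have "PI s \<subseteq> PI (a m) <+>\<^bsub>R\<^esub> TT"
  proof (rule order_trans[OF s(3)], rule LSup_least)
    show "range (\<lambda>n. PI (a n)) \<subseteq> Lat" using aR by auto
    show "PI (a m) <+>\<^bsub>R\<^esub> TT \<in> Lat" by (rule Lat_sum[OF AL L(1)])
    fix U assume "U \<in> range (\<lambda>n. PI (a n))"
    then obtain n where n: "U = PI (a n)" by auto
    have "a n \<in> PI (a m) <+>\<^bsub>R\<^esub> TT"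
    proof (cases "n \<le> m")
      case True
      then show ?thesis
        using idem_le_PI[OF a(1) a(1) a_le[OF True]] PI_self[OF aR(1)[of n]] Lat_sum_upper[OF AL L(1)] by blast
    next
      case False
      define j where "j = n - m"
      have nj: "n = m + j" using False by (simp add: j_def)
      have "a m \<oplus> (a n \<ominus> a m) \<in> PI (a m) <+>\<^bsub>R\<^esub> TT"
        using TTu[of j] PI_self[OF dR[of j]] PI_self[OF aR(1)[of m]] unfolding T_def nj by (intro set_addI) auto
      then show ?thesis using aR by (simp add: minus_eq plus_minus_cancel)
    qed
    then show "U \<subseteq> PI (a m) <+>\<^bsub>R\<^esub> TT" unfolding n by (rule PI_subset_Lat[OF Lat_sum[OF AL L(1)]])
  qed
  \<comment> \<open>The rank of \<open>t\<close> is at least \<open>\<gamma>\<close> because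
    \<open>\<rho> (a m) < \<alpha>\<close>, while \<open>t\<close> turns out to lie in
    \<open>TT\<close>, whose rank is at most \<open>\<rho> q < \<gamma>\<close>.\<close>
  moreover define t where "t = s \<ominus> a m"
  have tR: "t \<in> carrier R" using sR aR by (simp add: t_def)
  note st = idem_le_diff[OF a(1) s(1) s(2), of m, folded t_def]
  have "t \<in> PI s" using idem_PI_iff[OF s(1)] st(5) tR by blast
  ultimately have "t \<in> PI (a m) <+>\<^bsub>R\<^esub> TT" by blast
  then obtain x y where xy: "x \<in> PI (a m)" "y \<in> TT" "t = x \<oplus> y" by (rule set_addE)
  have xR: "x \<in> carrier R" "a m \<otimes> x = x" using xy(1) idem_PI_iff[OF a(1)] by auto
  have yR: "y \<in> carrier R" using xy(2) Lat_closed(1)[OF L(1)] by blast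
  have "\<zero> = a m \<otimes> x \<oplus> a m \<otimes> y" using st(2) xy(3) xR yR aR by (simp add: r_distr)
  then have "x = \<zero>" using xR amTT[OF xy(2)] by simp
  then have "t \<in> TT" using xy yR by simp
  then have "\<rho> t \<le> rk TT" using rk_mono[OF PI_in_Lat[OF tR] L(1)] PI_subset_Lat[OF L(1)] rk_PI[OF tR] by simp
  moreover have "\<rho> t = \<rho> s - \<rho> (a m)" unfolding t_def by (rule rho_idem_diff[OF a(1) s(1) s(2)])
  then have "\<gamma> \<le> \<rho> t" using lim(1)[of m] by (simp add: \<gamma>_def)
  ultimately show False using 1 2 q2 rkQ by simp
qed

text \<open>Reduction to sequences. If the supremum \<open>\<alpha>\<close> of the ranks is
  attained, the element attaining it is the greatest one of \<open>C\<close>; otherwise an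
  increasing sequence with ranks approaching \<open>\<alpha>\<close> is cofinal in
  \<open>C\<close>.\<close>

lemma rho_chain_Sup:
  assumes C: "C \<subseteq> idempotents R" "C \<noteq> {}" and chain: "\<And>e f. \<lbrakk>e \<in> C; f \<in> C\<rbrakk> \<Longrightarrow> idem_le R e f \<or> idem_le R f e"
    and s: "s \<in> idempotents R" "PI s = LSup (PI ` C)" "\<And>c. c \<in> C \<Longrightarrow> idem_le R c s"
    and bound: "\<And>c. c \<in> C \<Longrightarrow> \<rho> c \<le> t"
  shows "\<rho> s \<le> t"
proof -
  have CR: "c \<in> carrier R" "c \<in> idempotents R" if "c \<in> C" for c using C(1) that idempotentsD by auto
  have CL: "PI ` C \<subseteq> Lat" using CR by auto
  have sR: "s \<in> carrier R" using s(1) idempotentsD by blast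
  define \<alpha> where "\<alpha> = Sup (\<rho> ` C)"
  have bdd: "bdd_above (\<rho> ` C)" by (intro bdd_aboveI2[of _ _ t] bound)
  have le\<alpha>: "\<rho> c \<le> \<alpha>" if "c \<in> C" for c unfolding \<alpha>_def using that bdd by (intro cSup_upper) auto
  have \<alpha>t: "\<alpha> \<le> t" unfolding \<alpha>_def using C(2) bound by (intro cSup_least) auto
  have rho_le: "\<rho> e \<le> \<rho> f" if "e \<in> C" "f \<in> C" "idem_le R e f" for e f
    using rho_mono idem_le_PI CR that by simp
  have "\<rho> s \<le> \<alpha>"
  proof (cases "\<exists>c\<in>C. \<rho> c = \<alpha>")
    case True
    then obtain c where c: "c \<in> C" "\<rho> c = \<alpha>" by blast
    have "PI e \<subseteq> PI c" if e: "e \<in> C" for e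
    proof (cases "idem_le R e c")
      case True
      then show ?thesis using idem_le_PI CR e c by blast
    next
      case False
      then have ce: "idem_le R c e" using chain e c by blast
      have "\<rho> (e \<ominus> c) = 0"
        using rho_idem_diff[OF CR(2) CR(2) ce] c e le\<alpha>[OF e] rho_le[OF c(1) e ce] by simp
      then have "e = c" using rho_eq_0_iff[of "e \<ominus> c"] diff_zero_iff[of e c] CR e c by simp
      then show ?thesis by simp
    qed
    then have "PI s \<subseteq> PI c" unfolding s(2) using CR c by (intro LSup_least[OF CL]) auto
    then show ?thesis using rho_mono[OF sR CR(1)[OF c(1)]] c by simp
  next
    case False
    then have lt\<alpha>: "\<rho> c < \<alpha>" if "c \<in> C" for c using le\<alpha>[OF that] that by force
    have approx: "\<exists>c\<in>C. \<rho> c > \<alpha> - \<delta>" if "\<delta> > 0" for \<delta>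
      using less_cSup_iff[of "\<rho> ` C" "\<alpha> - \<delta>"] C(2) bdd that by (auto simp: \<alpha>_def)
    have "\<exists>a. \<forall>n. (a n \<in> C \<and> \<rho> (a n) > \<alpha> - 1 / Suc n) \<and> idem_le R (a n) (a (Suc n))"
    proof (rule dependent_nat_choice)
      show "\<exists>c. c \<in> C \<and> \<rho> c > \<alpha> - 1 / Suc 0" using approx[of 1] by auto
      fix c n assume c: "c \<in> C \<and> \<rho> c > \<alpha> - 1 / Suc n"
      obtain f where f: "f \<in> C" "\<rho> f > \<alpha> - 1 / Suc (Suc n)" using approx[of "1 / Suc (Suc n)"] by auto
      show "\<exists>f. (f \<in> C \<and> \<rho> f > \<alpha> - 1 / Suc (Suc n)) \<and> idem_le R c f"
      proof (cases "idem_le R c f")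
        case True
        then show ?thesis using f by blast
      next
        case False
        then have "idem_le R f c" using chain f c by blast
        then have "\<rho> f \<le> \<rho> c" using rho_le f c by blast
        then show ?thesis using f c idem_le_refl CR by (intro exI[of _ c]) auto
      qed
    qed
    then obtain a where a: "\<And>n. a n \<in> C" "\<And>n. \<rho> (a n) > \<alpha> - 1 / Suc n" "\<And>n. idem_le R (a n) (a (Suc n))" by blast
    have lim: "\<exists>n. \<rho> (a n) > \<alpha> - \<delta>" if \<delta>: "\<delta> > 0" for \<delta>
    proof -
      obtain n where "1 / real (Suc n) < \<delta>" using \<delta> by (metis nat_approx_posE)
      then have "\<rho> (a n) > \<alpha> - \<delta>" using a(2)[of n] by linarith
      then show ?thesis by blast
    qed
    show ?thesis
    proof (rule rho_increasing_Sup[of a, OF _ a(3) s(1) _ _ _ lim])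
      show "PI s \<subseteq> LSup (range (\<lambda>n. PI (a n)))"
        unfolding s(2)
      proof (rule LSup_least[OF CL LSup_in_Lat])
        show rl: "range (\<lambda>n. PI (a n)) \<subseteq> Lat" using a(1) CR by auto
        fix U assume "U \<in> PI ` C"
        then obtain c where c: "c \<in> C" "U = PI c" by auto
        obtain n where n: "\<rho> (a n) > \<alpha> - (\<alpha> - \<rho> c)" using lim[of "\<alpha> - \<rho> c"] lt\<alpha>[OF c(1)] by auto
        have "\<not> idem_le R (a n) c" using rho_le[OF a(1) c(1)] n by force
        then have "U \<subseteq> PI (a n)" using chain a(1) c idem_le_PI CR by blast
        also have "\<dots> \<subseteq> LSup (range (\<lambda>n. PI (a n)))" by (rule LSup_upper[OF rl]) simp
        finally show "U \<subseteq> LSup (range (\<lambda>n. PI (a n)))" .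
      qed
    qed (use a CR s lt\<alpha> in auto)
  qed
  then show ?thesis using \<alpha>t by simp
qed

end

section \<open>Maximal nests\<close>

lemma (in ring) idempotent_complement_twice: "e \<in> carrier R \<Longrightarrow> \<one> \<ominus> (\<one> \<ominus> e) = e"
  using plus_minus_cancel[of "\<one>" e] by (simp add: minus_eq minus_add a_comm[of e] r_neg2)

lemma (in von_neumann_regular_ring) idem_le_complement:
  assumes "e \<in> carrier R" "f \<in> carrier R" "idem_le R e f" shows "idem_le R (\<one> \<ominus> f) (\<one> \<ominus> e)"
proof -
  have 1: "(\<one> \<ominus> f) \<otimes> e = \<zero>" "e \<otimes> (\<one> \<ominus> f) = \<zero>"
    using assms by (simp_all add: idem_le_def minus_eq l_distr r_distr l_minus r_minus r_neg)
  have "(\<one> \<ominus> f) \<otimes> (\<one> \<ominus> e) = (\<one> \<ominus> f) \<ominus> (\<one> \<ominus> f) \<otimes> e"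
    using assms(1,2) by (simp add: minus_eq r_distr r_minus)
  moreover have "(\<one> \<ominus> e) \<otimes> (\<one> \<ominus> f) = (\<one> \<ominus> f) \<ominus> e \<otimes> (\<one> \<ominus> f)"
    using assms(1,2) by (simp add: minus_eq l_distr l_minus)
  ultimately show ?thesis using 1 assms(1,2) by (simp add: idem_le_def minus_eq)
qed

context ranked_ring
begin

lemma rho_complement:
  assumes "e \<in> idempotents R" shows "\<rho> (\<one> \<ominus> e) = 1 - \<rho> e"
proof -
  have "idem_le R e \<one>" using idempotentsD[OF assms] by (simp add: idem_le_def)
  moreover have "\<one> \<in> idempotents R" by (simp add: idempotents_def)
  ultimately show ?thesis using rho_idem_diff[OF assms] rho_one by simp
qed

lemma rho_diff_commute:
  assumes "a \<in> carrier R" "b \<in> carrier R" shows "\<rho> (a \<ominus> b) = \<rho> (b \<ominus> a)"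
proof -
  have "\<ominus> (a \<ominus> b) = b \<ominus> a" using assms by (simp add: minus_eq minus_add a_comm)
  then show ?thesis using rho_uminus[of "a \<ominus> b"] assms by simp
qed

lemma rank_metric: "Metric_space (carrier R) (rank_dist R \<rho>)"
proof
  show "0 \<le> rank_dist R \<rho> x y" for x y using rho_nonneg by (simp add: rank_dist_def)
  show "rank_dist R \<rho> x y = rank_dist R \<rho> y x" for x y
    using rho_diff_commute by (simp add: rank_dist_def)
  show "rank_dist R \<rho> x y = 0 \<longleftrightarrow> x = y" if "x \<in> carrier R" "y \<in> carrier R" for x y
    using rho_eq_0_iff diff_zero_iff that by (simp add: rank_dist_def)
  fix x y z assume R: "x \<in> carrier R" "y \<in> carrier R" "z \<in> carrier R"
  have "x \<ominus> z = (x \<ominus> y) \<oplus> (y \<ominus> z)" using R by (simp add: minus_eq a_assoc r_neg1)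
  then show "rank_dist R \<rho> x z \<le> rank_dist R \<rho> x y + rank_dist R \<rho> y z"
    using rho_add_le[of "x \<ominus> y" "y \<ominus> z"] R by (simp add: rank_dist_def)
qed

text \<open>Distances are ranks of differences, so a positive lower bound for the ranks of non-zero
  elements would make all balls of that radius singletons.\<close>

lemma nondiscrete_small_elements:
  assumes nd: "rank_topology R \<rho> \<noteq> discrete_topology (carrier R)" and \<epsilon>: "\<epsilon> > 0"
  shows "\<exists>x\<in>carrier R. x \<noteq> \<zero> \<and> \<rho> x < \<epsilon>"
proof (rule ccontr)
  assume neg: "\<not> ?thesis"
  interpret M: Metric_space "carrier R" "rank_dist R \<rho>" by (rule rank_metric)
  have "M.mball x \<epsilon> \<subseteq> {x}" for x
  proof
    fix y assume "y \<in> M.mball x \<epsilon>"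
    then have R: "x \<in> carrier R" "y \<in> carrier R" "\<rho> (x \<ominus> y) < \<epsilon>" by (auto simp: rank_dist_def)
    then have "x \<ominus> y = \<zero>" using neg by blast
    then show "y \<in> {x}" using R diff_zero_iff by simp
  qed
  then have "openin M.mtopology S \<longleftrightarrow> S \<subseteq> carrier R" for S
    unfolding M.openin_mtopology using \<epsilon> by (metis singletonD subset_iff)
  then have "M.mtopology = discrete_topology (carrier R)" by (simp add: topology_eq)
  then show False using nd by (simp add: rank_topology_def)
qed

end

section \<open>The rank on a maximal nest\<close>

locale maximal_nest_ring = irreducible_continuous_ring R \<rho> for R (structure) and \<rho> +
  fixes E assumes maximal: "maximal_nest R E"
    and nondiscrete: "rank_topology R \<rho> \<noteq> discrete_topology (carrier R)"
begin

lemma nest_idem: "e \<in> E \<Longrightarrow> e \<in> idempotents R"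
  and nest_chain: "\<lbrakk>e \<in> E; f \<in> E\<rbrakk> \<Longrightarrow> idem_le R e f \<or> idem_le R f e"
proof -
  have "nest R E" using maximal by (simp add: pred_on.maxchain_def)
  then have sub: "E \<subseteq> idempotents R" and ch: "\<forall>x\<in>E. \<forall>y\<in>E. x = y \<or> idem_le R x y \<or> idem_le R y x"
    unfolding pred_on.chain_def by auto
  show "e \<in> E \<Longrightarrow> e \<in> idempotents R" using sub by blast
  assume ef: "e \<in> E" "f \<in> E"
  then have "e = f \<or> idem_le R e f \<or> idem_le R f e" using ch by blast
  moreover have "idem_le R e e" by (rule idem_le_refl) (use sub ef in blast)
  ultimately show "idem_le R e f \<or> idem_le R f e" by auto
qed

lemma nest_carrier: "e \<in> E \<Longrightarrow> e \<in> carrier R"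
  using nest_idem idempotentsD by blast

text \<open>Maximality of the nest, as opposed to its being a chain, is used through this criterion
  alone.\<close>

lemma nest_memI:
  assumes g: "g \<in> idempotents R" and comp: "\<And>e. e \<in> E \<Longrightarrow> idem_le R e g \<or> idem_le R g e"
  shows "g \<in> E"
proof (rule ccontr)
  assume "g \<notin> E"
  have "pred_on.chain (idempotents R) (idem_le R) (insert g E)"
    unfolding pred_on.chain_def using g nest_idem nest_chain comp idem_le_refl[OF g] by auto
  then show False using maximal \<open>g \<notin> E\<close> unfolding pred_on.maxchain_def by blast
qed

lemma zero_in_nest: "\<zero> \<in> E" and one_in_nest: "\<one> \<in> E"
  by (rule nest_memI; simp add: idempotents_def idem_le_def nest_carrier)+

lemma nest_rho_mono: "\<lbrakk>e \<in> E; f \<in> E; idem_le R e f\<rbrakk> \<Longrightarrow> \<rho> e \<le> \<rho> f"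
  using rho_mono idem_le_PI nest_idem nest_carrier by simp

text \<open>Comparable idempotents of equal rank coincide, as their difference has rank 0. So the
  rank embeds the nest into the ordered interval \<open>[0, 1]\<close>.\<close>

lemma nest_le_iff: "\<lbrakk>e \<in> E; f \<in> E\<rbrakk> \<Longrightarrow> idem_le R e f \<longleftrightarrow> \<rho> e \<le> \<rho> f"
proof
  assume ef: "e \<in> E" "f \<in> E" and le: "\<rho> e \<le> \<rho> f"
  show "idem_le R e f"
  proof (rule ccontr)
    assume "\<not> idem_le R e f"
    then have fe: "idem_le R f e" using nest_chain ef by blast
    have "\<rho> (e \<ominus> f) = 0"
      using rho_idem_diff[OF nest_idem nest_idem fe] nest_rho_mono[OF ef(2,1) fe] ef le by simp
    then have "e = f" using rho_eq_0_iff diff_zero_iff nest_carrier ef by simp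
    then show False using \<open>\<not> idem_le R e f\<close> idem_le_refl nest_idem ef by blast
  qed
qed (rule nest_rho_mono)

lemma nest_rho_inj: "\<lbrakk>e \<in> E; f \<in> E; \<rho> e = \<rho> f\<rbrakk> \<Longrightarrow> e = f"
  using nest_le_iff[of e f] nest_le_iff[of f e] idem_le_antisym by simp

text \<open>Take the supremum of all elements of rank at most \<open>t\<close>. Being a least upper
  bound it is comparable with the whole nest, hence belongs to it, and by continuity its rank is
  still at most \<open>t\<close>.\<close>

lemma nest_lower_cut:
  assumes t: "0 \<le> t"
  obtains s where "s \<in> E" "\<rho> s \<le> t" "\<And>e. \<lbrakk>e \<in> E; \<rho> e \<le> t\<rbrakk> \<Longrightarrow> idem_le R e s"
proof -
  define C where "C = {e \<in> E. \<rho> e \<le> t}"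
  have C: "C \<subseteq> idempotents R" "C \<noteq> {}" using nest_idem zero_in_nest rho_zero t by (auto simp: C_def)
  have chain: "idem_le R e f \<or> idem_le R f e" if "e \<in> C" "f \<in> C" for e f
    using nest_chain that by (simp add: C_def)
  obtain s where s: "s \<in> idempotents R" "PI s = LSup (PI ` C)" "\<And>c. c \<in> C \<Longrightarrow> idem_le R c s"
    and least: "\<And>g. \<lbrakk>g \<in> idempotents R; \<And>c. c \<in> C \<Longrightarrow> idem_le R c g\<rbrakk> \<Longrightarrow> idem_le R s g"
    by (rule idem_chain_Sup[OF C chain]) blast+
  have "\<rho> s \<le> t"
    by (rule rho_chain_Sup[OF C chain s]) (auto simp: C_def)
  moreover have "s \<in> E"
  proof (rule nest_memI[OF s(1)])
    fix e assume e: "e \<in> E"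
    show "idem_le R e s \<or> idem_le R s e"
    proof (cases "\<rho> e \<le> t")
      case True
      then show ?thesis using s(3) e by (simp add: C_def)
    next
      case False
      have "idem_le R s e"
      proof (rule least[OF nest_idem[OF e]])
        fix c assume "c \<in> C"
        then show "idem_le R c e" using nest_le_iff e False by (auto simp: C_def)
      qed
      then show ?thesis ..
    qed
  qed
  ultimately show thesis using that s(3) by (simp add: C_def)
qed

text \<open>Continuity of the rank was established for suprema; passing to complements reverses the
  order and replaces the rank by 1 minus the rank.\<close>

lemma nest_upper_cut:
  assumes t: "t \<le> 1"
  obtains g where "g \<in> E" "t \<le> \<rho> g" "\<And>e. \<lbrakk>e \<in> E; t \<le> \<rho> e\<rbrakk> \<Longrightarrow> idem_le R g e"
proof -
  define C where "C = (\<lambda>e. \<one> \<ominus> e) ` {e \<in> E. t \<le> \<rho> e}"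
  have C: "C \<subseteq> idempotents R" "C \<noteq> {}"
    using nest_idem idempotent_complement(1) one_in_nest rho_one t by (auto simp: C_def)
  have chain: "idem_le R e f \<or> idem_le R f e" if efC: "e \<in> C" "f \<in> C" for e f
  proof -
    obtain e' f' where ef: "e' \<in> E" "f' \<in> E" "e = \<one> \<ominus> e'" "f = \<one> \<ominus> f'" using efC by (auto simp: C_def)
    show ?thesis
      using nest_chain[OF ef(1,2)] idem_le_complement[OF nest_carrier nest_carrier, OF ef(1,2)]
        idem_le_complement[OF nest_carrier nest_carrier, OF ef(2,1)] ef(3,4) by blast
  qed
  obtain u where u: "u \<in> idempotents R" "PI u = LSup (PI ` C)" "\<And>c. c \<in> C \<Longrightarrow> idem_le R c u"
    and least: "\<And>g. \<lbrakk>g \<in> idempotents R; \<And>c. c \<in> C \<Longrightarrow> idem_le R c g\<rbrakk> \<Longrightarrow> idem_le R u g"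
    by (rule idem_chain_Sup[OF C chain]) blast+
  have uR: "u \<in> carrier R" using u(1) idempotentsD by blast
  define g where "g = \<one> \<ominus> u"
  have g: "g \<in> idempotents R" unfolding g_def by (rule idempotent_complement(1)[OF u(1)])
  have "\<rho> u \<le> 1 - t"
    by (rule rho_chain_Sup[OF C chain u]) (auto simp: C_def rho_complement nest_idem)
  then have gt: "t \<le> \<rho> g" using rho_complement[OF u(1)] by (simp add: g_def)
  have ge: "idem_le R g e" if e: "e \<in> E" "t \<le> \<rho> e" for e
  proof -
    have "idem_le R (\<one> \<ominus> e) u" using e by (intro u(3)) (auto simp: C_def)
    then have "idem_le R (\<one> \<ominus> u) (\<one> \<ominus> (\<one> \<ominus> e))"
      using idem_le_complement[of "\<one> \<ominus> e" u] nest_carrier[OF e(1)] uR by simp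
    then show ?thesis using idempotent_complement_twice nest_carrier[OF e(1)] by (simp add: g_def)
  qed
  have "g \<in> E"
  proof (rule nest_memI[OF g])
    fix e assume e: "e \<in> E"
    note eR = nest_carrier[OF e]
    show "idem_le R e g \<or> idem_le R g e"
    proof (cases "t \<le> \<rho> e")
      case True
      then show ?thesis using ge e by simp
    next
      case False
      have "idem_le R u (\<one> \<ominus> e)"
      proof (rule least[OF idempotent_complement(1)[OF nest_idem[OF e]]])
        fix c assume "c \<in> C"
        then obtain f where f: "f \<in> E" "t \<le> \<rho> f" "c = \<one> \<ominus> f" by (auto simp: C_def)
        have "idem_le R e f" using nest_le_iff e f False by simp
        then show "idem_le R c (\<one> \<ominus> e)" using idem_le_complement eR nest_carrier f by simp
      qed
      then have "idem_le R (\<one> \<ominus> (\<one> \<ominus> e)) (\<one> \<ominus> u)" using idem_le_complement[of u "\<one> \<ominus> e"] uR eR by simp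
      then show ?thesis using idempotent_complement_twice eR by (simp add: g_def)
    qed
  qed
  then show thesis using that gt ge by blast
qed

text \<open>A gap of the nest would be closed by a proper idempotent below the difference of its end
  points, which exists because there are non-zero elements of arbitrarily small rank.\<close>

lemma nest_rho_surj:
  assumes t: "0 \<le> t" "t \<le> 1" shows "\<exists>e\<in>E. \<rho> e = t"
proof (rule ccontr)
  assume neg: "\<not> ?thesis"
  obtain s where s: "s \<in> E" "\<rho> s \<le> t" "\<And>e. \<lbrakk>e \<in> E; \<rho> e \<le> t\<rbrakk> \<Longrightarrow> idem_le R e s"
    using nest_lower_cut[OF t(1)] by blast
  obtain g where g: "g \<in> E" "t \<le> \<rho> g" "\<And>e. \<lbrakk>e \<in> E; t \<le> \<rho> e\<rbrakk> \<Longrightarrow> idem_le R g e"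
    using nest_upper_cut[OF t(2)] by blast
  have strict: "\<rho> s < t" "t < \<rho> g" using neg s g by force+
  have sg: "idem_le R s g" using nest_le_iff s g strict by simp
  have R: "s \<in> carrier R" "g \<in> carrier R" using nest_carrier s g by auto
  define p where "p = g \<ominus> s"
  note p = idem_le_diff[OF nest_idem[OF s(1)] nest_idem[OF g(1)] sg, folded p_def]
  have pR: "p \<in> carrier R" "p \<otimes> p = p" using p(1) idempotentsD by auto
  have rho_p: "\<rho> p = \<rho> g - \<rho> s" unfolding p_def by (rule rho_idem_diff[OF nest_idem[OF s(1)] nest_idem[OF g(1)] sg])
  then have p_pos: "\<rho> p > 0" using strict by simp
  then have p0: "p \<noteq> \<zero>" using rho_zero by auto
  obtain x where x: "x \<in> carrier R" "x \<noteq> \<zero>" "\<rho> x < \<rho> p" using nondiscrete_small_elements[OF nondiscrete p_pos] by blast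
  \<comment> \<open>Primeness moves \<open>x\<close> under \<open>p\<close>: the product
    \<open>c\<close> is non-zero, lies in \<open>PI p\<close> and has rank at most
    \<open>\<rho> x < \<rho> p\<close>.\<close>
  obtain r where r: "r \<in> carrier R" "p \<otimes> r \<otimes> x \<noteq> \<zero>" using irreducible_prime[OF irreducible pR(1) p0 x(1,2)] by blast
  define c where "c = p \<otimes> r \<otimes> x"
  have cR: "c \<in> carrier R" using pR r x by (simp add: c_def)
  obtain h b where h: "h \<in> idempotents R" "h \<otimes> c = c" "b \<in> carrier R" "h = c \<otimes> b"
    using PI_generated_by_idempotent[OF cR] by metis
  have hR: "h \<in> carrier R" "h \<otimes> h = h" using h idempotentsD by auto
  have h0: "h \<noteq> \<zero>" using h(2) r cR by (auto simp: c_def)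
  have ph: "p \<otimes> h = h" using h(3,4) pR r x by (simp add: c_def m_assoc[symmetric])
  have "\<rho> h \<le> \<rho> c" using h rho_mult_left cR by simp
  also have "\<dots> \<le> \<rho> x" unfolding c_def using rho_mult_right pR r x by simp
  finally have rho_h: "\<rho> h < \<rho> p" using x by simp
  \<comment> \<open>The idempotent \<open>h\<close> is only known to satisfy
    \<open>p \<otimes> h = h\<close>; multiplying by \<open>p\<close> on the right gives a non-zero
    idempotent that lies below \<open>p\<close> on both sides.\<close>
  define h' where "h' = h \<otimes> p"
  have h'R: "h' \<in> carrier R" using hR pR by (simp add: h'_def)
  have h'p: "h' \<otimes> p = h'" "p \<otimes> h' = h'"
    using hR pR ph by (simp_all add: h'_def m_assoc) (simp add: m_assoc[symmetric])
  have h'h: "h' \<otimes> h = h" using hR pR ph by (simp add: h'_def m_assoc)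
  have "h' \<otimes> h' = h' \<otimes> h \<otimes> p" using hR pR h'R by (simp add: h'_def m_assoc)
  also have "\<dots> = h'" by (simp only: h'h) (simp add: h'_def)
  finally have h'i: "h' \<otimes> h' = h'" .
  have h'0: "h' \<noteq> \<zero>" using h'h h0 hR by auto
  have rho_h': "\<rho> h' < \<rho> p" using rho_mult_left[OF hR(1) pR(1)] rho_h by (simp add: h'_def)
  have sh: "s \<otimes> h' = \<zero>" using p(2) h'p(2) R pR h'R by (metis m_assoc l_null)
  have hs: "h' \<otimes> s = \<zero>" using p(3) h'p(1) R pR h'R by (metis m_assoc r_null)
  have gh: "g \<otimes> h' = h'" using p(5) h'p(2) R pR h'R by (metis m_assoc)
  have hg: "h' \<otimes> g = h'" using p(6) h'p(1) R pR h'R by (metis m_assoc)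
  define k where "k = s \<oplus> h'"
  have ss: "s \<otimes> s = s" using nest_idem[OF s(1)] idempotentsD by blast
  have kR: "k \<in> carrier R" using R h'R by (simp add: k_def)
  have ki: "k \<in> idempotents R"
    using kR R h'R ss sh hs h'i by (simp add: idempotents_def) (simp add: k_def l_distr r_distr)
  have sk: "idem_le R s k" using R h'R ss sh hs by (simp add: idem_le_def k_def l_distr r_distr)
  have kg: "idem_le R k g" using R h'R gh hg idem_leD[OF sg] by (simp add: idem_le_def k_def l_distr r_distr)
  have "k \<in> E"
  proof (rule nest_memI[OF ki])
    fix e assume e: "e \<in> E"
    show "idem_le R e k \<or> idem_le R k e"
    proof (cases "\<rho> e \<le> t")
      case True
      then show ?thesis using idem_le_trans[OF nest_carrier[OF e] R(1) kR s(3)[OF e] sk] by blast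
    next
      case False
      then show ?thesis using idem_le_trans[OF kR R(2) nest_carrier[OF e] kg g(3)[OF e]] by simp
    qed
  qed
  show False
  proof (cases "\<rho> k \<le> t")
    case True
    then have "k = s" using s(3)[OF \<open>k \<in> E\<close>] sk idem_le_antisym by blast
    then have "s \<oplus> h' = s \<oplus> \<zero>" using R by (simp add: k_def)
    then show False using h'0 R h'R by simp
  next
    case False
    then have "k = g" using g(3)[OF \<open>k \<in> E\<close>] kg idem_le_antisym by simp
    then have "s \<oplus> h' = s \<oplus> p" using p(4) by (simp add: k_def)
    then have "h' = p" using R h'R pR by simp
    then show False using rho_h' by simp
  qed
qed

text \<open>The inverse of the rank on \<open>E\<close>; it lets partitions of the nest be handled
  as finite subsets of \<open>[0, 1]\<close>.\<close>

definition eta :: "real \<Rightarrow> 'a" where "eta t = (SOME e. e \<in> E \<and> \<rho> e = t)"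

lemma eta:
  assumes "0 \<le> t" "t \<le> 1" shows "eta t \<in> E" "\<rho> (eta t) = t"
  using nest_rho_surj[OF assms] someI_ex[of "\<lambda>e. e \<in> E \<and> \<rho> e = t"] unfolding eta_def by blast+

lemma eta_rho: "e \<in> E \<Longrightarrow> eta (\<rho> e) = e"
  using eta[of "\<rho> e"] rho_nonneg rho_le_one nest_carrier nest_rho_inj by simp

lemma eta_mono: "\<lbrakk>0 \<le> s; s \<le> t; t \<le> 1\<rbrakk> \<Longrightarrow> idem_le R (eta s) (eta t)"
  using nest_le_iff eta by simp

lemma eta_0: "eta 0 = \<zero>" and eta_1: "eta 1 = \<one>"
  using eta_rho[OF zero_in_nest] eta_rho[OF one_in_nest] by (simp_all add: rho_zero rho_one)

end

section \<open>Block triangular subgroups\<close>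

locale nest_group = maximal_nest_ring R \<rho> E for R (structure) and \<rho> E +
  fixes G assumes G: "subgroup G (units_of (nest_subring R E))"
begin

definition RE :: "'a set" where "RE = carrier (nest_subring R E)"

lemma RE_iff: "a \<in> RE \<longleftrightarrow> a \<in> carrier R \<and> (\<forall>e\<in>E. e \<otimes> a \<otimes> e = a \<otimes> e)"
  by (simp add: RE_def nest_subring_def)

lemma RE_carrier: "a \<in> RE \<Longrightarrow> a \<in> carrier R"
  by (simp add: RE_iff)

lemma RE_triangular: "\<lbrakk>a \<in> RE; e \<in> E\<rbrakk> \<Longrightarrow> e \<otimes> (a \<otimes> e) = a \<otimes> e"
  using RE_iff nest_carrier by (metis m_assoc)

lemma RE_I: "\<lbrakk>a \<in> carrier R; \<And>e. e \<in> E \<Longrightarrow> e \<otimes> (a \<otimes> e) = a \<otimes> e\<rbrakk> \<Longrightarrow> a \<in> RE"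
  by (simp add: RE_iff m_assoc nest_carrier)

lemma RE_one: "\<one> \<in> RE"
  using nest_idem by (intro RE_I) (auto simp: nest_carrier idempotents_def)

lemma RE_mult:
  assumes "a \<in> RE" "b \<in> RE" shows "a \<otimes> b \<in> RE"
proof (rule RE_I)
  fix e assume e: "e \<in> E"
  note R = RE_carrier[OF assms(1)] RE_carrier[OF assms(2)] nest_carrier[OF e]
  have "a \<otimes> b \<otimes> e = a \<otimes> e \<otimes> (b \<otimes> e)" using RE_triangular[OF assms(2) e] R by (simp add: m_assoc)
  moreover have "e \<otimes> (a \<otimes> e \<otimes> (b \<otimes> e)) = e \<otimes> (a \<otimes> e) \<otimes> (b \<otimes> e)" using R by (simp add: m_assoc)
  ultimately show "e \<otimes> (a \<otimes> b \<otimes> e) = a \<otimes> b \<otimes> e" using RE_triangular[OF assms(1) e] by simp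
qed (use assms RE_carrier in simp)

lemma RE_add: "\<lbrakk>a \<in> RE; b \<in> RE\<rbrakk> \<Longrightarrow> a \<oplus> b \<in> RE"
  by (intro RE_I) (simp_all add: RE_carrier nest_carrier l_distr r_distr RE_triangular)

lemma RE_uminus: "a \<in> RE \<Longrightarrow> \<ominus> a \<in> RE"
  by (intro RE_I) (simp_all add: RE_carrier nest_carrier l_minus r_minus RE_triangular)

lemma RE_diff: "\<lbrakk>a \<in> RE; b \<in> RE\<rbrakk> \<Longrightarrow> a \<ominus> b \<in> RE"
  by (simp add: minus_eq RE_add RE_uminus)

lemma nest_subset_RE:
  assumes "e \<in> E" shows "e \<in> RE"
proof (rule RE_I)
  fix f assume f: "f \<in> E"
  then show "f \<otimes> (e \<otimes> f) = e \<otimes> f"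
    using nest_chain[OF assms f] nest_idem[OF f] by (auto simp: idem_le_def idempotents_def)
qed (rule nest_carrier[OF assms])

lemma monoid_RE: "Group.monoid (nest_subring R E)"
proof (rule monoidI)
  show "x \<otimes>\<^bsub>nest_subring R E\<^esub> y \<in> carrier (nest_subring R E)"
    if "x \<in> carrier (nest_subring R E)" "y \<in> carrier (nest_subring R E)" for x y
    using RE_mult that unfolding RE_def by (simp add: nest_subring_def)
  show "\<one>\<^bsub>nest_subring R E\<^esub> \<in> carrier (nest_subring R E)"
    using RE_one unfolding RE_def by (simp add: nest_subring_def)
qed (auto simp: nest_subring_def m_assoc)

lemma G_RE: "g \<in> G \<Longrightarrow> g \<in> RE"
  using subgroup.subset[OF G] by (auto simp: units_of_def Units_def RE_def)

lemma G_carrier: "g \<in> G \<Longrightarrow> g \<in> carrier R"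
  using G_RE RE_carrier by blast

lemma G_one: "\<one> \<in> G"
  using subgroup.one_closed[OF G] by (simp add: units_of_def nest_subring_def)

lemma G_mult: "\<lbrakk>g \<in> G; h \<in> G\<rbrakk> \<Longrightarrow> g \<otimes> h \<in> G"
  using subgroup.m_closed[OF G, of g h] by (simp add: units_of_def nest_subring_def)

lemma G_inverse:
  assumes "g \<in> G" shows "\<exists>h\<in>G. g \<otimes> h = \<one> \<and> h \<otimes> g = \<one>"
proof -
  interpret U: group "units_of (nest_subring R E)" by (rule monoid.units_group[OF monoid_RE])
  have gU: "g \<in> carrier (units_of (nest_subring R E))" using subgroup.subset[OF G] assms by blast
  define h where "h = inv\<^bsub>units_of (nest_subring R E)\<^esub> g"
  have "h \<in> G" unfolding h_def by (rule subgroup.m_inv_closed[OF G assms])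
  moreover have "g \<otimes> h = \<one>" "h \<otimes> g = \<one>"
    using U.r_inv[OF gU] U.l_inv[OF gU] by (simp_all add: h_def units_of_def nest_subring_def)
  ultimately show ?thesis by blast
qed

end

section \<open>Partitions of the nest and their diagonal blocks\<close>

locale nest_partition = nest_group R \<rho> E G for R (structure) and \<rho> E G +
  fixes n :: nat and e :: "nat \<Rightarrow> 'a"
  assumes e_E: "i \<le> n \<Longrightarrow> e i \<in> E" and e_0: "e 0 = \<zero>" and e_n: "e n = \<one>"
    and e_Suc: "i < n \<Longrightarrow> idem_le R (e i) (e (Suc i))"
begin

lemma e_R: "i \<le> n \<Longrightarrow> e i \<in> carrier R"
  and e_idem: "i \<le> n \<Longrightarrow> e i \<in> idempotents R"
  using e_E nest_carrier nest_idem by auto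

lemma e_le:
  assumes "i \<le> j" "j \<le> n" shows "idem_le R (e i) (e j)"
  using assms
proof (induction rule: dec_induct)
  case base
  then show ?case using idem_le_refl e_idem by simp
next
  case (step k)
  then have "idem_le R (e i) (e k)" "idem_le R (e k) (e (Suc k))" using e_Suc by simp_all
  then show ?case by (rule idem_le_trans[OF e_R e_R e_R, rotated 3]) (use step in simp_all)
qed

text \<open>Counted from 0: \<open>d k\<close> is the difference that the definition of
  \<open>envelope\<close> attaches to the index \<open>Suc k\<close>. It may be zero, since
  partition points may repeat.\<close>

definition d :: "nat \<Rightarrow> 'a" where "d k = e (Suc k) \<ominus> e k"

lemma d_R: "k < n \<Longrightarrow> d k \<in> carrier R"
  and d_idem: "k < n \<Longrightarrow> d k \<otimes> d k = d k"
  and e_d: "k < n \<Longrightarrow> e k \<otimes> d k = \<zero>"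
  and d_e: "k < n \<Longrightarrow> d k \<otimes> e k = \<zero>"
  and e_plus_d: "k < n \<Longrightarrow> e k \<oplus> d k = e (Suc k)"
  and eS_d: "k < n \<Longrightarrow> e (Suc k) \<otimes> d k = d k"
  and d_eS: "k < n \<Longrightarrow> d k \<otimes> e (Suc k) = d k"
  using idem_le_diff[OF e_idem e_idem e_Suc, of k] idempotentsD[of "d k"] by (simp_all add: d_def)

lemma d_RE: "k < n \<Longrightarrow> d k \<in> RE"
  using e_E nest_subset_RE RE_diff by (simp add: d_def)

lemma d_orthogonal_less:
  assumes "i < j" "j < n" shows "d i \<otimes> d j = \<zero>" "d j \<otimes> d i = \<zero>"
proof -
  have R: "d i \<in> carrier R" "d j \<in> carrier R" "e j \<in> carrier R" "e (Suc i) \<in> carrier R"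
    using d_R e_R assms by simp_all
  have "idem_le R (e (Suc i)) (e j)" by (rule e_le) (use assms in simp_all)
  note le = idem_leD[OF this]
  have i: "i < n" using assms by simp
  have "d i \<otimes> e j = d i \<otimes> (e (Suc i) \<otimes> e j)" using d_eS[OF i] R by (simp add: m_assoc[symmetric])
  then have "d i \<otimes> e j = d i" using le(1) d_eS[OF i] by simp
  then have "d i \<otimes> d j = d i \<otimes> e j \<otimes> d j" by simp
  then show "d i \<otimes> d j = \<zero>" using e_d[OF assms(2)] R by (simp add: m_assoc)
  have "e j \<otimes> d i = (e j \<otimes> e (Suc i)) \<otimes> d i" using eS_d[OF i] R by (simp add: m_assoc)
  then have "e j \<otimes> d i = d i" using le(2) eS_d[OF i] by simp
  then have "d j \<otimes> d i = d j \<otimes> (e j \<otimes> d i)" by simp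
  then show "d j \<otimes> d i = \<zero>" using d_e[OF assms(2)] R by (simp add: m_assoc[symmetric])
qed

lemma d_orthogonal: "\<lbrakk>i \<noteq> j; i < n; j < n\<rbrakk> \<Longrightarrow> d i \<otimes> d j = \<zero>"
  using d_orthogonal_less[of i j] d_orthogonal_less[of j i] by (cases "i < j") auto

definition block :: "nat \<Rightarrow> 'a \<Rightarrow> 'a" where "block k a = d k \<otimes> a \<otimes> d k"

text \<open>Relative to the decomposition of \<open>\<one>\<close> into the \<open>d k\<close>,
  elements of \<open>RE\<close> are upper block triangular: column \<open>k\<close> has no entries
  below the diagonal.\<close>

lemma RE_eS_d:
  assumes "a \<in> RE" "k < n" shows "e (Suc k) \<otimes> (a \<otimes> d k) = a \<otimes> d k"
proof -
  have R: "a \<in> carrier R" "e (Suc k) \<in> carrier R" "d k \<in> carrier R"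
    using assms RE_carrier e_R d_R by simp_all
  have "a \<otimes> d k = a \<otimes> e (Suc k) \<otimes> d k" using eS_d[OF assms(2)] R by (simp add: m_assoc)
  moreover have "e (Suc k) \<otimes> (a \<otimes> e (Suc k) \<otimes> d k) = e (Suc k) \<otimes> (a \<otimes> e (Suc k)) \<otimes> d k"
    using R by (simp add: m_assoc)
  ultimately show ?thesis using RE_triangular[OF assms(1) e_E, of "Suc k"] assms(2) by simp
qed

text \<open>Triangularity for rows: row \<open>k\<close> has no entries to the left of the
  diagonal.\<close>

lemma d_RE_e:
  assumes "a \<in> RE" "k < n" shows "d k \<otimes> (a \<otimes> e k) = \<zero>"
proof -
  have R: "a \<in> carrier R" "e k \<in> carrier R" "d k \<in> carrier R"
    using assms RE_carrier e_R d_R by simp_all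
  have "d k \<otimes> (a \<otimes> e k) = d k \<otimes> (e k \<otimes> (a \<otimes> e k))" using RE_triangular[OF assms(1) e_E, of k] assms(2) by simp
  also have "\<dots> = d k \<otimes> e k \<otimes> (a \<otimes> e k)" using R by (simp add: m_assoc)
  finally show ?thesis using d_e[OF assms(2)] R by simp
qed

text \<open>As for triangular matrices: \<open>b \<otimes> d k\<close> is the sum of a part in
  \<open>PI (e k)\<close> and a part in \<open>PI (d k)\<close>, and \<open>d k \<otimes> a\<close>
  annihilates the former.\<close>

lemma block_mult:
  assumes a: "a \<in> RE" and b: "b \<in> RE" and k: "k < n"
  shows "block k (a \<otimes> b) = block k a \<otimes> block k b"
proof -
  have R: "a \<in> carrier R" "b \<in> carrier R" "d k \<in> carrier R" "e k \<in> carrier R" "e (Suc k) \<in> carrier R"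
    using a b RE_carrier d_R e_R k by simp_all
  define u where "u = b \<otimes> d k"
  have uR: "u \<in> carrier R" using R by (simp add: u_def)
  have "u = e (Suc k) \<otimes> u" using RE_eS_d[OF b k] by (simp add: u_def)
  then have u: "u = e k \<otimes> u \<oplus> d k \<otimes> u" using e_plus_d[OF k] R uR l_distr[of "e k" "d k" u] by simp
  have "d k \<otimes> (a \<otimes> (e k \<otimes> u)) = d k \<otimes> (a \<otimes> e k) \<otimes> u" using R uR by (simp add: m_assoc)
  then have 0: "d k \<otimes> (a \<otimes> (e k \<otimes> u)) = \<zero>" using d_RE_e[OF a k] uR by simp
  have "block k (a \<otimes> b) = d k \<otimes> (a \<otimes> u)" using R by (simp add: block_def u_def m_assoc)
  also have "a \<otimes> u = a \<otimes> (e k \<otimes> u) \<oplus> a \<otimes> (d k \<otimes> u)"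
    using R uR by (subst u) (simp add: r_distr)
  also have "d k \<otimes> \<dots> = d k \<otimes> (a \<otimes> (d k \<otimes> u))" using 0 R uR by (simp add: r_distr)
  also have "\<dots> = d k \<otimes> a \<otimes> (d k \<otimes> d k) \<otimes> u" using d_idem[OF k] R uR by (simp add: m_assoc)
  also have "\<dots> = block k a \<otimes> block k b" using R by (simp add: block_def u_def m_assoc)
  finally show ?thesis .
qed

lemma block_one: "k < n \<Longrightarrow> block k \<one> = d k"
  using d_R d_idem by (simp add: block_def)

lemma block_R: "\<lbrakk>k < n; a \<in> carrier R\<rbrakk> \<Longrightarrow> block k a \<in> carrier R"
  using d_R by (simp add: block_def)

lemma block_add: "\<lbrakk>k < n; a \<in> carrier R; b \<in> carrier R\<rbrakk> \<Longrightarrow> block k (a \<oplus> b) = block k a \<oplus> block k b"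
  using d_R by (simp add: block_def l_distr r_distr)

lemma d_block: "\<lbrakk>k < n; a \<in> carrier R\<rbrakk> \<Longrightarrow> d k \<otimes> block k a = block k a"
  and block_d: "\<lbrakk>k < n; a \<in> carrier R\<rbrakk> \<Longrightarrow> block k a \<otimes> d k = block k a"
proof -
  assume k: "k < n" and a: "a \<in> carrier R"
  have "d k \<otimes> block k a = d k \<otimes> d k \<otimes> a \<otimes> d k" using d_R[OF k] a by (simp add: block_def m_assoc)
  then show "d k \<otimes> block k a = block k a" using d_idem[OF k] by (simp add: block_def)
  have "block k a \<otimes> d k = d k \<otimes> a \<otimes> (d k \<otimes> d k)" using d_R[OF k] a by (simp add: block_def m_assoc)
  then show "block k a \<otimes> d k = block k a" using d_idem[OF k] by (simp add: block_def)
qed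

lemma block_block: "\<lbrakk>k < n; a \<in> carrier R\<rbrakk> \<Longrightarrow> block k (block k a) = block k a"
  by (simp add: block_def[of k "block k a"] d_block block_d)

lemma block_complement:
  assumes "k < n" shows "block k (\<one> \<ominus> d k) = \<zero>"
proof -
  have "d k \<otimes> (\<one> \<ominus> d k) = \<zero>" using assms d_R d_idem by (simp add: minus_eq r_distr r_minus r_neg)
  then show ?thesis using d_R[OF assms] by (simp add: block_def)
qed

section \<open>The group of a partition and its generators\<close>

text \<open>The envelope is the directed union of these sets over all partitions. Invertibility is
  not built into the definition; it is the content of \<open>H_inverse\<close>.\<close>

definition H :: "'a set" where "H = {a \<in> RE. \<forall>k<n. \<exists>g\<in>G. block k a = block k g}"

lemma H_RE: "a \<in> H \<Longrightarrow> a \<in> RE"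
  and H_R: "a \<in> H \<Longrightarrow> a \<in> carrier R"
  by (auto simp: H_def RE_carrier)

lemma H_one: "\<one> \<in> H"
  using RE_one G_one by (auto simp: H_def)

lemma H_mult:
  assumes "a \<in> H" "b \<in> H" shows "a \<otimes> b \<in> H"
  unfolding H_def
proof (intro CollectI conjI allI impI)
  show "a \<otimes> b \<in> RE" using assms H_RE RE_mult by simp
  fix k assume k: "k < n"
  obtain g h where "g \<in> G" "h \<in> G" "block k a = block k g" "block k b = block k h"
    using assms k unfolding H_def by blast
  then have "block k (a \<otimes> b) = block k (g \<otimes> h)" "g \<otimes> h \<in> G"
    using block_mult[OF H_RE H_RE k] block_mult[OF G_RE G_RE k] assms G_mult by simp_all
  then show "\<exists>g\<in>G. block k (a \<otimes> b) = block k g" by blast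
qed

definition diag :: "nat \<Rightarrow> 'a \<Rightarrow> 'a" where "diag k g = (\<one> \<ominus> d k) \<oplus> block k g"

lemma diag_R: "\<lbrakk>k < n; g \<in> G\<rbrakk> \<Longrightarrow> diag k g \<in> carrier R"
  using d_R block_R G_carrier by (simp add: diag_def)

lemma block_comp:
  assumes "k < n" "a \<in> carrier R"
  shows "block k a \<otimes> (\<one> \<ominus> d k) = \<zero>" "(\<one> \<ominus> d k) \<otimes> block k a = \<zero>" "(\<one> \<ominus> d k) \<otimes> (\<one> \<ominus> d k) = \<one> \<ominus> d k"
proof -
  have R: "d k \<in> carrier R" "block k a \<in> carrier R" using assms d_R block_R by simp_all
  show "block k a \<otimes> (\<one> \<ominus> d k) = \<zero>" "(\<one> \<ominus> d k) \<otimes> block k a = \<zero>"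
    using block_d[OF assms] d_block[OF assms] R by (simp_all add: minus_eq l_distr r_distr l_minus r_minus r_neg)
  have "d k \<in> idempotents R" using R d_idem[OF assms(1)] by (simp add: idempotents_def)
  then show "(\<one> \<ominus> d k) \<otimes> (\<one> \<ominus> d k) = \<one> \<ominus> d k"
    using idempotent_complement(1) idempotentsD by blast
qed

lemma diag_mult:
  assumes k: "k < n" and g: "g \<in> G" and h: "h \<in> G"
  shows "diag k (g \<otimes> h) = diag k g \<otimes> diag k h"
proof -
  have R: "d k \<in> carrier R" "block k g \<in> carrier R" "block k h \<in> carrier R" "g \<in> carrier R" "h \<in> carrier R"
    using d_R block_R G_carrier k g h by simp_all
  have cR: "\<one> \<ominus> d k \<in> carrier R" using R by simp
  have "diag k g \<otimes> diag k h = ((\<one> \<ominus> d k) \<otimes> (\<one> \<ominus> d k) \<oplus> (\<one> \<ominus> d k) \<otimes> block k h)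
      \<oplus> (block k g \<otimes> (\<one> \<ominus> d k) \<oplus> block k g \<otimes> block k h)"
    unfolding diag_def l_distr[OF cR R(2) a_closed[OF cR R(3)]] r_distr[OF cR R(3) cR] r_distr[OF cR R(3) R(2)] ..
  also have "\<dots> = (\<one> \<ominus> d k) \<oplus> block k g \<otimes> block k h"
    using block_comp[OF k R(4)] block_comp[OF k R(5)] R cR by simp
  finally show ?thesis using block_mult[OF G_RE[OF g] G_RE[OF h] k] by (simp add: diag_def)
qed

lemma diag_one: "k < n \<Longrightarrow> diag k \<one> = \<one>"
  using d_R[of k] by (simp add: diag_def block_one minus_eq a_assoc l_neg)

lemma diag_H:
  assumes k: "k < n" and g: "g \<in> G" shows "diag k g \<in> H"
  unfolding H_def
proof (intro CollectI conjI allI impI)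
  show "diag k g \<in> RE"
    unfolding diag_def block_def by (intro RE_add RE_diff RE_mult RE_one d_RE G_RE k g)
  fix i assume i: "i < n"
  have R: "d k \<in> carrier R" "d i \<in> carrier R" "block k g \<in> carrier R" "g \<in> carrier R"
    using d_R block_R G_carrier k g i by simp_all
  show "\<exists>h\<in>G. block i (diag k g) = block i h"
  proof (cases "i = k")
    case True
    have "block k (diag k g) = block k g"
      using R by (simp add: diag_def block_add[OF k] block_complement[OF k] block_block[OF k])
    then show ?thesis using True g by blast
  next
    case False
    have "d i \<otimes> block k g = \<zero>"
      using d_orthogonal[OF False i k] R by (simp add: block_def m_assoc[symmetric])
    moreover have "d i \<otimes> (\<one> \<ominus> d k) = d i" using d_orthogonal[OF False i k] R by (simp add: minus_eq r_distr r_minus)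
    ultimately have "block i (diag k g) = block i \<one>"
      using R by (simp add: block_def[of i] diag_def r_distr)
    then show ?thesis using G_one by blast
  qed
qed

definition unip :: "nat \<Rightarrow> 'a \<Rightarrow> 'a" where "unip k x = \<one> \<oplus> e k \<otimes> x \<otimes> d k"

text \<open>Membership in \<open>RE\<close> has to be tested on all of \<open>E\<close>, not just on
  the partition points. An element \<open>f\<close> below \<open>e k\<close> satisfies
  \<open>d k \<otimes> f = \<zero>\<close>, and one above it satisfies
  \<open>f \<otimes> e k = e k\<close>.\<close>

lemma upper_RE:
  assumes k: "k < n" and x: "x \<in> carrier R" shows "e k \<otimes> x \<otimes> d k \<in> RE"
proof (rule RE_I)
  have R: "e k \<in> carrier R" "d k \<in> carrier R" using e_R d_R k by simp_all
  show "e k \<otimes> x \<otimes> d k \<in> carrier R" using R x by simp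
  fix f assume f: "f \<in> E"
  note fR = nest_carrier[OF f]
  have ek: "e k \<in> E" using e_E k by simp
  from nest_chain[OF f ek] show "f \<otimes> (e k \<otimes> x \<otimes> d k \<otimes> f) = e k \<otimes> x \<otimes> d k \<otimes> f"
  proof
    assume fe: "idem_le R f (e k)"
    have "d k \<otimes> f = d k \<otimes> e k \<otimes> f" using idem_leD[OF fe] R fR by (simp add: m_assoc)
    then have "d k \<otimes> f = \<zero>" using d_e[OF k] fR by simp
    then show ?thesis using R x fR by (simp add: m_assoc)
  next
    assume "idem_le R (e k) f"
    then show ?thesis using idem_leD[of "e k" f] R x fR by (simp add: m_assoc[symmetric])
  qed
qed

lemma unip_R: "\<lbrakk>k < n; x \<in> carrier R\<rbrakk> \<Longrightarrow> unip k x \<in> carrier R"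
  using e_R d_R by (simp add: unip_def)

lemma unip_H:
  assumes k: "k < n" and x: "x \<in> carrier R" shows "unip k x \<in> H"
  unfolding H_def
proof (intro CollectI conjI allI impI)
  show "unip k x \<in> RE" unfolding unip_def by (intro RE_add RE_one upper_RE k x)
  fix i assume i: "i < n"
  have R: "e k \<in> carrier R" "d k \<in> carrier R" "d i \<in> carrier R" using e_R d_R k i by simp_all
  have "block i (e k \<otimes> x \<otimes> d k) = \<zero>"
  proof (cases "i = k")
    case True
    have "block k (e k \<otimes> x \<otimes> d k) = d k \<otimes> e k \<otimes> (x \<otimes> d k \<otimes> d k)" using R x by (simp add: block_def m_assoc)
    then show ?thesis using True d_e[OF k] R x by simp
  next
    case False
    have "block i (e k \<otimes> x \<otimes> d k) = d i \<otimes> (e k \<otimes> x) \<otimes> (d k \<otimes> d i)" using R x by (simp add: block_def m_assoc)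
    then show ?thesis using d_orthogonal[of k i] False i k R x by simp
  qed
  then have "block i (unip k x) = block i \<one>"
    using block_add[OF i] block_R[OF i] R x by (simp add: unip_def)
  then show "\<exists>g\<in>G. block i (unip k x) = block i g" using G_one by blast
qed

text \<open>The off-diagonal parts multiply to zero because of
  \<open>d k \<otimes> e k = \<zero>\<close>; hence \<open>unip k\<close> turns sums into products
  and has a commutative image.\<close>

lemma unip_mult:
  assumes k: "k < n" and x: "x \<in> carrier R" and y: "y \<in> carrier R"
  shows "unip k x \<otimes> unip k y = unip k (x \<oplus> y)"
proof -
  have R: "e k \<in> carrier R" "d k \<in> carrier R" using e_R d_R k by simp_all
  define u v where "u = e k \<otimes> x \<otimes> d k" and "v = e k \<otimes> y \<otimes> d k"
  have uv: "u \<in> carrier R" "v \<in> carrier R" using R x y by (simp_all add: u_def v_def)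
  have "u \<otimes> v = e k \<otimes> x \<otimes> (d k \<otimes> e k) \<otimes> (y \<otimes> d k)" using R x y by (simp add: u_def v_def m_assoc)
  then have "u \<otimes> v = \<zero>" using d_e[OF k] R x y by simp
  then have "(\<one> \<oplus> u) \<otimes> (\<one> \<oplus> v) = \<one> \<oplus> (u \<oplus> v)" using uv by (simp add: l_distr r_distr a_ac)
  moreover have "u \<oplus> v = e k \<otimes> (x \<oplus> y) \<otimes> d k" using R x y by (simp add: u_def v_def l_distr r_distr)
  ultimately show ?thesis by (simp add: unip_def u_def v_def)
qed

lemma unip_zero: "k < n \<Longrightarrow> unip k \<zero> = \<one>"
  using e_R d_R by (simp add: unip_def)

section \<open>Stabilisers and factorisation\<close>

text \<open>The elements acting as the identity on \<open>PI (e k)\<close>. Together with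
  \<open>ustab\<close> they form a decreasing series \<open>stab 0 = H\<close>,
  \<open>ustab 0\<close>, \<open>stab 1\<close>, and so on down to \<open>stab n = {\<one>}\<close>.
  The diagonal block \<open>k\<close> is removed on the way to \<open>ustab k\<close>, the part
  above it on the way to \<open>stab (Suc k)\<close>.\<close>

definition stab :: "nat \<Rightarrow> 'a set" where "stab k = {a \<in> H. a \<otimes> e k = e k}"

definition ustab :: "nat \<Rightarrow> 'a set" where "ustab k = {a \<in> stab k. block k a = d k}"

lemma stab_n: "stab n \<subseteq> {\<one>}"
  using H_R by (auto simp: stab_def e_n)

lemma stab_0: "stab 0 = H"
  using H_R by (auto simp: stab_def e_0)

lemma unip_e:
  assumes k: "k < n" and x: "x \<in> carrier R"
  shows "unip k x \<otimes> e k = e k" "unip k x \<otimes> d k = d k \<oplus> e k \<otimes> x \<otimes> d k"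
proof -
  have R: "e k \<in> carrier R" "d k \<in> carrier R" using e_R d_R k by simp_all
  have "unip k x \<otimes> e k = e k \<oplus> e k \<otimes> x \<otimes> (d k \<otimes> e k)"
    using R x by (simp add: unip_def l_distr m_assoc)
  then show "unip k x \<otimes> e k = e k" using R x d_e[OF k] by simp
  show "unip k x \<otimes> d k = d k \<oplus> e k \<otimes> x \<otimes> d k"
    using R x d_idem[OF k] by (simp add: unip_def l_distr m_assoc)
qed

text \<open>Elimination in block column \<open>k\<close>: the diagonal block is already
  \<open>d k\<close>, so left multiplication by \<open>u\<close> clears the entries above
  it.\<close>

lemma ustab_factor:
  assumes k: "k < n" and a: "a \<in> ustab k"
  obtains x b where "x \<in> carrier R" "b \<in> stab (Suc k)" "a = unip k x \<otimes> b"
proof -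
  have aH: "a \<in> H" "a \<otimes> e k = e k" "block k a = d k" using a by (auto simp: ustab_def stab_def)
  have R: "a \<in> carrier R" "e k \<in> carrier R" "d k \<in> carrier R" using e_R d_R k aH H_R by simp_all
  define y where "y = e k \<otimes> a \<otimes> d k"
  have yR: "y \<in> carrier R" using R by (simp add: y_def)
  have "a \<otimes> d k = e (Suc k) \<otimes> (a \<otimes> d k)" using RE_eS_d[OF H_RE[OF aH(1)] k] by simp
  also have "\<dots> = e k \<otimes> (a \<otimes> d k) \<oplus> d k \<otimes> (a \<otimes> d k)"
    using e_plus_d[OF k] R l_distr[of "e k" "d k" "a \<otimes> d k"] by simp
  also have "\<dots> = y \<oplus> d k" using aH(3) R by (simp add: y_def block_def m_assoc)
  finally have ad: "a \<otimes> d k = y \<oplus> d k" .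
  \<comment> \<open>Equal to \<open>\<one> \<ominus> y\<close>. As \<open>y\<close> lies in
    \<open>PI (e k)\<close>, where \<open>u\<close> acts trivially, \<open>u\<close> subtracts
    \<open>y\<close> from \<open>d k\<close> and leaves \<open>y\<close> itself unchanged.\<close>
  define u where "u = unip k (\<ominus> a)"
  have uR: "u \<in> carrier R" unfolding u_def by (rule unip_R[OF k]) (use R in simp)
  have u_e: "u \<otimes> e k = e k" and u_d: "u \<otimes> d k = d k \<oplus> \<ominus> y"
    using unip_e[OF k, of "\<ominus> a"] R by (simp_all add: u_def y_def l_minus r_minus)
  have "e k \<otimes> y = y" using R e_idem[of k] k by (simp add: y_def idempotents_def m_assoc[symmetric])
  then have "u \<otimes> y = u \<otimes> e k \<otimes> y" using uR R yR by (simp add: m_assoc)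
  then have u_y: "u \<otimes> y = y" using u_e \<open>e k \<otimes> y = y\<close> by simp
  define b where "b = u \<otimes> a"
  have bH: "b \<in> H" unfolding b_def u_def by (intro H_mult unip_H k aH) (use R in simp)
  have "b \<otimes> e (Suc k) = u \<otimes> (a \<otimes> e k) \<oplus> u \<otimes> (a \<otimes> d k)"
    using uR R by (simp add: b_def m_assoc r_distr flip: e_plus_d[OF k])
  also have "\<dots> = e k \<oplus> (y \<oplus> (d k \<oplus> \<ominus> y))"
    using aH(2) ad u_e u_y u_d uR R yR by (simp add: r_distr)
  also have "\<dots> = e (Suc k)" using R yR e_plus_d[OF k] by (simp add: plus_minus_cancel)
  finally have b: "b \<in> stab (Suc k)" using bH by (simp add: stab_def)
  have "unip k a \<otimes> u = unip k (a \<oplus> \<ominus> a)" unfolding u_def by (rule unip_mult[OF k]) (use R in simp_all)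
  then have "unip k a \<otimes> u = \<one>" using unip_zero[OF k] R by (simp add: r_neg)
  then have "unip k a \<otimes> b = a" using unip_R[OF k R(1)] uR R by (simp add: b_def m_assoc[symmetric])
  then show thesis using that R b by metis
qed

lemma diag_e:
  assumes k: "k < n" and g: "g \<in> G"
  shows "diag k g \<otimes> e k = e k" "block k (diag k g) = block k g"
proof -
  have R: "e k \<in> carrier R" "d k \<in> carrier R" "g \<in> carrier R" "block k g \<in> carrier R"
    using e_R d_R k G_carrier g block_R by simp_all
  have "block k g \<otimes> e k = d k \<otimes> g \<otimes> (d k \<otimes> e k)" using R by (simp add: block_def m_assoc)
  then have "block k g \<otimes> e k = \<zero>" using d_e[OF k] R by simp
  moreover have "(\<one> \<ominus> d k) \<otimes> e k = e k" using R d_e[OF k] by (simp add: minus_eq l_distr l_minus)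
  ultimately show "diag k g \<otimes> e k = e k" using R by (simp add: diag_def l_distr)
  show "block k (diag k g) = block k g"
    using R by (simp add: diag_def block_add[OF k] block_complement[OF k] block_block[OF k])
qed

text \<open>The diagonal block \<open>k\<close> comes from some \<open>g\<close> in \<open>G\<close>
  and is cancelled by the block of the inverse of \<open>g\<close>.\<close>

lemma stab_factor:
  assumes k: "k < n" and a: "a \<in> stab k"
  obtains g c where "g \<in> G" "c \<in> ustab k" "a = diag k g \<otimes> c"
proof -
  have aH: "a \<in> H" "a \<otimes> e k = e k" using a by (auto simp: stab_def)
  have R: "a \<in> carrier R" "e k \<in> carrier R" "d k \<in> carrier R" using e_R d_R k aH H_R by simp_all
  obtain g where g: "g \<in> G" "block k a = block k g" using aH(1) k unfolding H_def by blast
  obtain h where h: "h \<in> G" "g \<otimes> h = \<one>" "h \<otimes> g = \<one>" using G_inverse[OF g(1)] by blast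
  note D = diag_R[OF k g(1)] diag_R[OF k h(1)]
  define c where "c = diag k h \<otimes> a"
  have "c \<in> H" unfolding c_def by (intro H_mult diag_H k h aH)
  moreover have "c \<otimes> e k = e k" using D R aH(2) diag_e(1)[OF k h(1)] by (simp add: c_def m_assoc)
  moreover have "block k c = d k"
  proof -
    have "block k c = block k h \<otimes> block k g"
      unfolding c_def block_mult[OF H_RE[OF diag_H[OF k h(1)]] H_RE[OF aH(1)] k] diag_e(2)[OF k h(1)] g(2) ..
    also have "\<dots> = block k (h \<otimes> g)" by (rule block_mult[OF G_RE[OF h(1)] G_RE[OF g(1)] k, symmetric])
    finally show ?thesis using h(3) block_one[OF k] by simp
  qed
  ultimately have "c \<in> ustab k" by (simp add: ustab_def stab_def)
  moreover have "diag k g \<otimes> diag k h = \<one>"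
    using diag_mult[OF k g(1) h(1)] h(2) diag_one[OF k] by simp
  then have "a = diag k g \<otimes> c" using D R by (simp add: c_def m_assoc[symmetric])
  ultimately show thesis using that g(1) by blast
qed

text \<open>Descending induction along the series of stabilisers writes the elements of
  \<open>H\<close> as products of factors whose inverses are explicit and lie in \<open>H\<close>
  again.\<close>

lemma H_inverse:
  assumes "a \<in> H" shows "\<exists>b\<in>H. a \<otimes> b = \<one> \<and> b \<otimes> a = \<one>"
proof -
  have prod: "\<exists>c\<in>H. (a \<otimes> b) \<otimes> c = \<one> \<and> c \<otimes> (a \<otimes> b) = \<one>"
    if "a \<in> H" "b \<in> H" "a' \<in> H" "a \<otimes> a' = \<one>" "a' \<otimes> a = \<one>" "b' \<in> H" "b \<otimes> b' = \<one>" "b' \<otimes> b = \<one>" for a b a' b'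
  proof -
    have R: "a \<in> carrier R" "b \<in> carrier R" "a' \<in> carrier R" "b' \<in> carrier R" using that H_R by simp_all
    have "(a \<otimes> b) \<otimes> (b' \<otimes> a') = a \<otimes> (b \<otimes> b') \<otimes> a'" "(b' \<otimes> a') \<otimes> (a \<otimes> b) = b' \<otimes> (a' \<otimes> a) \<otimes> b"
      using R by (simp_all add: m_assoc)
    then show ?thesis using that R H_mult by (intro bexI[of _ "b' \<otimes> a'"]) simp_all
  qed
  have "\<forall>a\<in>stab k. \<exists>b\<in>H. a \<otimes> b = \<one> \<and> b \<otimes> a = \<one>" if "k \<le> n" for k
    using that
  proof (induction rule: inc_induct)
    case base
    then show ?case using stab_n H_one by (metis l_one one_closed singletonD subsetD)
  next
    case (step k)
    then have k: "k < n" by simp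
    show ?case
    proof
      fix a assume "a \<in> stab k"
      then obtain g c where g: "g \<in> G" and c: "c \<in> ustab k" and ac: "a = diag k g \<otimes> c" by (rule stab_factor[OF k])
      obtain x b where x: "x \<in> carrier R" and b: "b \<in> stab (Suc k)" and cb: "c = unip k x \<otimes> b"
        by (rule ustab_factor[OF k c])
      obtain b' where b': "b' \<in> H" "b \<otimes> b' = \<one>" "b' \<otimes> b = \<one>" using step.IH b by blast
      have bH: "b \<in> H" and cH: "c \<in> H" using b c by (auto simp: ustab_def stab_def)
      have mx: "\<ominus> x \<in> carrier R" using x by simp
      have "unip k x \<otimes> unip k (\<ominus> x) = \<one>" "unip k (\<ominus> x) \<otimes> unip k x = \<one>"
        using unip_mult[OF k x mx] unip_mult[OF k mx x] unip_zero[OF k] x by (simp_all add: r_neg l_neg)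
      from prod[OF unip_H[OF k x] bH unip_H[OF k mx] this b']
      obtain c' where c': "c' \<in> H" "c \<otimes> c' = \<one>" "c' \<otimes> c = \<one>" unfolding cb by blast
      obtain h where h: "h \<in> G" "g \<otimes> h = \<one>" "h \<otimes> g = \<one>" using G_inverse[OF g] by blast
      have "diag k g \<otimes> diag k h = \<one>" "diag k h \<otimes> diag k g = \<one>"
        using diag_mult[OF k g h(1)] diag_mult[OF k h(1) g] h diag_one[OF k] by simp_all
      from prod[OF diag_H[OF k g] cH diag_H[OF k h(1)] this c']
      show "\<exists>b\<in>H. a \<otimes> b = \<one> \<and> b \<otimes> a = \<one>" unfolding ac .
    qed
  qed
  then show ?thesis using assms stab_0 by blast
qed

end

section \<open>The envelope\<close>

context nest_partition
begin

lemma H_subset_envelope: "H \<subseteq> envelope R E G"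
proof
  fix a assume a: "a \<in> H"
  have "\<forall>i\<le>n. e i \<in> E \<union> {\<zero>, \<one>}" using e_E by blast
  moreover have "\<forall>i<n. idem_le R (e i) (e (Suc i))" using e_Suc by blast
  moreover have "\<forall>i\<in>{1..n}. let D = e i \<ominus> e (i - 1) in D \<otimes> a \<otimes> D \<in> (\<lambda>g. D \<otimes> g \<otimes> D) ` G"
  proof
    fix i assume i: "i \<in> {1..n}"
    then have "i - 1 < n" and Si: "Suc (i - 1) = i" by auto
    then obtain g where g: "g \<in> G" "block (i - 1) a = block (i - 1) g" using a unfolding H_def by blast
    then show "let D = e i \<ominus> e (i - 1) in D \<otimes> a \<otimes> D \<in> (\<lambda>g. D \<otimes> g \<otimes> D) ` G"
      unfolding block_def d_def Si Let_def by blast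
  qed
  ultimately show "a \<in> envelope R E G"
    unfolding envelope_def using a e_0 e_n H_RE[OF a, unfolded RE_def] by blast
qed

lemma sum_rho_d: "(\<Sum>k<n. \<rho> (d k)) = 1"
proof -
  have "\<rho> (d k) = \<rho> (e (Suc k)) - \<rho> (e k)" if "k < n" for k
    unfolding d_def by (rule rho_idem_diff) (use that e_idem e_Suc in simp_all)
  then have "(\<Sum>k<n. \<rho> (d k)) = (\<Sum>k<n. \<rho> (e (Suc k)) - \<rho> (e k))" by simp
  also have "\<dots> = \<rho> (e n) - \<rho> (e 0)" by (rule sum_lessThan_telescope)
  finally show ?thesis by (simp add: e_n e_0 rho_one rho_zero)
qed

end

section \<open>Break points and common partitions\<close>

context nest_group
begin

text \<open>Every interval \<open>[s, t]\<close> without break points in its interior cuts a block out of \<open>a\<close> that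
  agrees with a block of an element of \<open>G\<close>; this property, unlike the partition in the
  definition of the envelope, is monotone in the set of break points.\<close>

definition breakpoints :: "real set \<Rightarrow> 'a \<Rightarrow> bool" where
  "breakpoints F a \<longleftrightarrow> (\<forall>s t. 0 \<le> s \<longrightarrow> s \<le> t \<longrightarrow> t \<le> 1 \<longrightarrow> F \<inter> {s<..<t} = {} \<longrightarrow>
     (\<exists>g\<in>G. (eta t \<ominus> eta s) \<otimes> a \<otimes> (eta t \<ominus> eta s) = (eta t \<ominus> eta s) \<otimes> g \<otimes> (eta t \<ominus> eta s)))"

lemma breakpoints_mono: "\<lbrakk>breakpoints F a; F \<subseteq> F'\<rbrakk> \<Longrightarrow> breakpoints F' a"
  unfolding breakpoints_def by blast

lemma envelope_RE: "a \<in> envelope R E G \<Longrightarrow> a \<in> RE"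
  by (simp add: envelope_def RE_def)

text \<open>The ranks of the partition points serve as break points. An interval with none of them
  in its interior lies inside an interval of the partition, so its block is cut out of a block known
  to come from \<open>G\<close>.\<close>

lemma envelope_breakpoints:
  assumes "a \<in> envelope R E G" shows "\<exists>F. finite F \<and> F \<subseteq> {0..1} \<and> breakpoints F a"
proof -
  have a: "a \<in> carrier R" using envelope_RE[OF assms] RE_carrier by blast
  obtain n e where e: "\<forall>i\<le>n. e i \<in> E \<union> {\<zero>, \<one>}" "e 0 = \<zero>" "e n = \<one>" "\<forall>i<n. idem_le R (e i) (e (Suc i))"
    and bl: "\<forall>i\<in>{1..n}. let D = e i \<ominus> e (i - 1) in D \<otimes> a \<otimes> D \<in> (\<lambda>g. D \<otimes> g \<otimes> D) ` G"
    using assms unfolding envelope_def by blast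
  have eE: "e i \<in> E" if "i \<le> n" for i using e(1)[rule_format, OF that] zero_in_nest one_in_nest by auto
  define F where "F = (\<lambda>i. \<rho> (e i)) ` {..n}"
  have F: "finite F" "F \<subseteq> {0..1}" using rho_nonneg rho_le_one nest_carrier eE by (auto simp: F_def)
  have "breakpoints F a"
    unfolding breakpoints_def
  proof (intro allI impI)
    fix s t :: real assume st: "0 \<le> s" "s \<le> t" "t \<le> 1" "F \<inter> {s<..<t} = {}"
    define D where "D = eta t \<ominus> eta s"
    show "\<exists>g\<in>G. (eta t \<ominus> eta s) \<otimes> a \<otimes> (eta t \<ominus> eta s) = (eta t \<ominus> eta s) \<otimes> g \<otimes> (eta t \<ominus> eta s)"
    proof (cases "t = 0")
      case True
      then have "eta t \<ominus> eta s = \<zero>" using st by (simp add: eta_0 minus_eq r_neg)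
      then show ?thesis using G_one a by (intro bexI[of _ \<one>]) simp_all
    next
      case False
      \<comment> \<open>The first partition point at or beyond \<open>t\<close>. Its predecessor
        \<open>j\<close> has rank below \<open>t\<close> and, as a break point, is not inside the
        open interval, so its rank is at most \<open>s\<close>.\<close>
      define i where "i = (LEAST i. t \<le> \<rho> (e i))"
      have n: "t \<le> \<rho> (e n)" using e(3) st rho_one by simp
      have i: "t \<le> \<rho> (e i)" unfolding i_def by (rule LeastI[of _ n]) (rule n)
      have in': "i \<le> n" unfolding i_def by (rule Least_le) (rule n)
      have i0: "i \<noteq> 0" using i e(2) rho_zero False st by (metis order.antisym order.trans)
      define j where "j = i - 1"
      have ij: "i = Suc j" "j < n" using i0 in' by (auto simp: j_def)
      have "\<not> t \<le> \<rho> (e j)" using not_less_Least[of j "\<lambda>i. t \<le> \<rho> (e i)"] ij by (simp add: i_def)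
      moreover have "\<rho> (e j) \<in> F" using ij by (simp add: F_def)
      ultimately have js: "\<rho> (e j) \<le> s" using st(4) by force
      have E: "eta s \<in> E" "eta t \<in> E" "e j \<in> E" "e i \<in> E" using eta eE ij st by simp_all
      note ER = E[THEN nest_carrier]
      have le: "idem_le R (e j) (eta s)" "idem_le R (eta t) (e i)" "idem_le R (eta s) (e i)" "idem_le R (e j) (eta t)"
        using nest_le_iff E eta js i st by simp_all
      define D' where "D' = e i \<ominus> e j"
      have DR: "D \<in> carrier R" "D' \<in> carrier R" using ER by (simp_all add: D_def D'_def)
      \<comment> \<open>The idempotent \<open>D\<close> lies below \<open>D'\<close>, so compression
        by \<open>D\<close> factors through compression by \<open>D'\<close>.\<close>
      have DD: "D \<otimes> D' = D" "D' \<otimes> D = D"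
      proof -
        note le' = le[THEN idem_leD(1)] le[THEN idem_leD(2)]
        have "D \<otimes> e i = D" "D \<otimes> e j = \<zero>" "e i \<otimes> D = D" "e j \<otimes> D = \<zero>"
          using ER le' by (simp_all add: D_def minus_eq l_distr r_distr l_minus r_minus r_neg)
        then show "D \<otimes> D' = D" "D' \<otimes> D = D"
          using ER DR(1) by (simp_all add: D'_def minus_eq l_distr r_distr l_minus r_minus)
      qed
      have conj: "D \<otimes> x \<otimes> D = D \<otimes> (D' \<otimes> x \<otimes> D') \<otimes> D" if x: "x \<in> carrier R" for x
      proof -
        have "D \<otimes> (D' \<otimes> x \<otimes> D') \<otimes> D = (D \<otimes> D') \<otimes> x \<otimes> (D' \<otimes> D)" using DR x by (simp add: m_assoc)
        then show ?thesis using DD by simp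
      qed
      have "i \<in> {1..n}" using ij by simp
      then obtain g where g: "g \<in> G" "D' \<otimes> a \<otimes> D' = D' \<otimes> g \<otimes> D'"
        using bl unfolding D'_def j_def Let_def by blast
      have "D \<otimes> a \<otimes> D = D \<otimes> g \<otimes> D" using conj[OF a] conj[OF G_carrier[OF g(1)]] g(2) by simp
      then show ?thesis using g(1) unfolding D_def by blast
    qed
  qed
  then show ?thesis using F by blast
qed

text \<open>Sort \<open>F\<close> together with the multiples of \<open>1 / N\<close>; a gap longer
  than \<open>1 / N\<close> would have such a multiple strictly inside.\<close>

lemma fine_partition:
  fixes F :: "real set"
  assumes F: "finite F" "F \<subseteq> {0..1}" and N: "N > (0::nat)"
  obtains n t where "t 0 = 0" "t n = 1" "\<And>i j. \<lbrakk>i \<le> j; j \<le> n\<rbrakk> \<Longrightarrow> t i \<le> t j"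
    "\<And>i. i < n \<Longrightarrow> t (Suc i) - t i \<le> 1 / N" "F \<subseteq> t ` {..n}"
proof -
  define S where "S = F \<union> (\<lambda>i. real i / N) ` {..N}"
  have S: "finite S" "S \<subseteq> {0..1}" "0 \<in> S" "1 \<in> S"
    using F N by (auto simp: S_def image_iff intro!: bexI[of _ 0] bexI[of _ N])
  define xs where "xs = sorted_list_of_set S"
  have xs: "set xs = S" "sorted xs" using S by (simp_all add: xs_def)
  define n where "n = length xs - 1"
  define t where "t i = xs ! i" for i
  have "xs \<noteq> []" using xs(1) S(3) by auto
  then have len: "length xs = Suc n" by (simp add: n_def)
  have mono: "t i \<le> t j" if "i \<le> j" "j \<le> n" for i j
    using sorted_nth_mono[OF xs(2)] that len by (simp add: t_def)
  have tS: "t i \<in> S" if "i \<le> n" for i using xs(1) that len nth_mem[of i xs] by (simp add: t_def)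
  have St: "\<exists>i\<le>n. t i = x" if x: "x \<in> S" for x
    using x xs(1) len by (metis in_set_conv_nth less_Suc_eq_le t_def)
  have t0: "t 0 = 0"
  proof -
    obtain i where "i \<le> n" "t i = 0" using St[OF S(3)] by blast
    then have "t 0 \<le> 0" using mono[of 0 i] by simp
    then show ?thesis using tS[of 0] S(2) by auto
  qed
  have tn: "t n = 1"
  proof -
    obtain i where "i \<le> n" "t i = 1" using St[OF S(4)] by blast
    then have "1 \<le> t n" using mono[of i n] by simp
    then show ?thesis using tS[of n] S(2) by auto
  qed
  have gap: "t (Suc i) - t i \<le> 1 / N" if i: "i < n" for i
  proof (rule ccontr)
    assume big: "\<not> ?thesis"
    have ti: "t i \<in> {0..1}" "t (Suc i) \<in> {0..1}" using tS[of i] tS[of "Suc i"] S(2) i by auto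
    \<comment> \<open>The index of the first multiple of \<open>1 / N\<close> strictly to the right
      of \<open>t i\<close>.\<close>
    define j where "j = Suc (nat \<lfloor>t i * N\<rfloor>)"
    have "0 \<le> t i * N" using ti by simp
    then have "real (nat \<lfloor>t i * N\<rfloor>) = of_int \<lfloor>t i * N\<rfloor>" by simp
    then have "real (nat \<lfloor>t i * N\<rfloor>) \<le> t i * N" "t i * N < real (nat \<lfloor>t i * N\<rfloor>) + 1" by linarith+
    moreover have "real j = 1 + real (nat \<lfloor>t i * N\<rfloor>)" unfolding j_def by (rule of_nat_Suc)
    ultimately have j: "t i * N < real j" "real j \<le> t i * N + 1" by linarith+
    have y1: "t i < real j / N" using j(1) N by (simp add: field_simps)
    have "real j / N \<le> (t i * N + 1) / N" by (rule divide_right_mono[OF j(2)]) simp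
    also have "\<dots> = t i + 1 / N" using N by (simp add: field_simps)
    finally have y2: "real j / N < t (Suc i)" using big by linarith
    then have "real j / N < 1" using ti by auto
    then have "j \<le> N" using N by simp
    then have "real j / N \<in> S" by (auto simp: S_def)
    then obtain m where m: "m \<le> n" "t m = real j / N" using St by metis
    show False
    proof (cases "m \<le> i")
      case True
      then show False using mono[of m i] i y1 m by simp
    next
      case False
      then show False using mono[of "Suc i" m] y2 m by simp
    qed
  qed
  have "F \<subseteq> t ` {..n}"
  proof
    fix x assume "x \<in> F"
    then obtain i where "i \<le> n" "t i = x" using St[of x] by (auto simp: S_def)
    then show "x \<in> t ` {..n}" by auto
  qed
  with t0 tn mono gap show thesis by (rule that)
qed

text \<open>Break point sets may be enlarged, so the union of those of the finitely many elements,
  refined to mesh \<open>1 / N\<close>, serves all of them; \<open>eta\<close> carries it into the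
  nest.\<close>

lemma common_partition:
  assumes K: "finite K" "K \<subseteq> envelope R E G" and N: "N > (0::nat)"
  obtains n e where "nest_partition R \<rho> E G n e" "K \<subseteq> nest_partition.H R E G n e"
    "\<And>k. k < n \<Longrightarrow> \<rho> (nest_partition.d R e k) \<le> 1 / N"
proof -
  have "\<forall>a\<in>K. \<exists>F. finite F \<and> F \<subseteq> {0..1} \<and> breakpoints F a" using K envelope_breakpoints by blast
  then obtain F where F: "\<And>a. a \<in> K \<Longrightarrow> finite (F a) \<and> F a \<subseteq> {0..1} \<and> breakpoints (F a) a" by metis
  define F' where "F' = \<Union>(F ` K)"
  have F': "finite F'" "F' \<subseteq> {0..1}" using F K(1) by (auto simp: F'_def)
  have bp: "breakpoints F' a" if "a \<in> K" for a
    using F[OF that] breakpoints_mono[of "F a" a F'] that by (auto simp: F'_def)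
  obtain n t where t: "t 0 = 0" "t n = 1" "\<And>i j. \<lbrakk>i \<le> j; j \<le> n\<rbrakk> \<Longrightarrow> t i \<le> t j"
    "\<And>i. i < n \<Longrightarrow> t (Suc i) - t i \<le> 1 / N" "F' \<subseteq> t ` {..n}"
    by (rule fine_partition[OF F' N]) (rule that)
  have t01: "0 \<le> t i" "t i \<le> 1" if "i \<le> n" for i using t(3)[of 0 i] t(3)[of i n] t(1,2) that by simp_all
  define e where "e i = eta (t i)" for i
  interpret P: nest_partition R \<rho> E G n e
  proof
    show "e i \<in> E" if "i \<le> n" for i using eta t01[OF that] by (simp add: e_def)
    show "e 0 = \<zero>" "e n = \<one>" by (simp_all add: e_def t eta_0 eta_1)
    show "idem_le R (e i) (e (Suc i))" if "i < n" for i
      unfolding e_def using t01[of i] t01[of "Suc i"] t(3)[of i "Suc i"] that by (intro eta_mono) simp_all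
  qed
  have "K \<subseteq> P.H"
  proof
    fix a assume a: "a \<in> K"
    show "a \<in> P.H"
      unfolding P.H_def
    proof (intro CollectI conjI allI impI)
      show "a \<in> RE" using a K envelope_RE by blast
      fix k assume k: "k < n"
      have "F' \<inter> {t k<..<t (Suc k)} = {}"
      proof (rule ccontr)
        assume "F' \<inter> {t k<..<t (Suc k)} \<noteq> {}"
        then obtain x where x: "x \<in> F'" "t k < x" "x < t (Suc k)" by auto
        then obtain m where m: "m \<le> n" "x = t m" using t(5) by auto
        show False
        proof (cases "m \<le> k")
          case True
          then show False using t(3)[of m k] k x m by simp
        next
          case False
          then show False using t(3)[of "Suc k" m] x m by simp
        qed
      qed
      then show "\<exists>g\<in>G. P.block k a = P.block k g"
        using bp[OF a] t01[of k] t01[of "Suc k"] t(3)[of k "Suc k"] k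
        unfolding breakpoints_def P.block_def P.d_def e_def by simp
    qed
  qed
  moreover have "\<rho> (P.d k) \<le> 1 / N" if k: "k < n" for k
  proof -
    have "\<rho> (P.d k) = \<rho> (e (Suc k)) - \<rho> (e k)"
      unfolding P.d_def by (rule rho_idem_diff) (use k P.e_idem P.e_Suc in simp_all)
    then show ?thesis using t(4)[OF k] eta t01[of k] t01[of "Suc k"] k by (simp add: e_def)
  qed
  ultimately show thesis using that P.nest_partition_axioms by blast
qed

section \<open>The envelope as a group with bi-invariant metric\<close>

definition env_group :: "'a monoid" where
  "env_group = (units_of (nest_subring R E))\<lparr>carrier := envelope R E G\<rparr>"

lemma env_group_simps [simp]:
  "carrier env_group = envelope R E G" "x \<otimes>\<^bsub>env_group\<^esub> y = x \<otimes> y" "\<one>\<^bsub>env_group\<^esub> = \<one>"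
  by (simp_all add: env_group_def units_of_def nest_subring_def)

lemma envelope_carrier: "a \<in> envelope R E G \<Longrightarrow> a \<in> carrier R"
  using envelope_RE RE_carrier by blast

text \<open>Any two elements of the envelope lie in a common \<open>H\<close>, which is closed under
  products and inverses.\<close>

lemma group_env_group: "group env_group"
proof (rule groupI)
  fix a b assume "a \<in> carrier env_group" "b \<in> carrier env_group"
  then have "finite {a, b}" "{a, b} \<subseteq> envelope R E G" by simp_all
  then obtain n e where P: "nest_partition R \<rho> E G n e" "{a, b} \<subseteq> nest_partition.H R E G n e"
    by (rule common_partition[of _ 1]) auto
  interpret P: nest_partition R \<rho> E G n e by (rule P(1))
  show "a \<otimes>\<^bsub>env_group\<^esub> b \<in> carrier env_group" using P.H_mult P(2) P.H_subset_envelope by auto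
next
  have "finite {}" "{} \<subseteq> envelope R E G" by simp_all
  then obtain n e where P: "nest_partition R \<rho> E G n e" "{} \<subseteq> nest_partition.H R E G n e"
    by (rule common_partition[of _ 1]) auto
  interpret P: nest_partition R \<rho> E G n e by (rule P(1))
  show "\<one>\<^bsub>env_group\<^esub> \<in> carrier env_group" using P.H_one P.H_subset_envelope by auto
next
  fix a assume "a \<in> carrier env_group"
  then have "finite {a}" "{a} \<subseteq> envelope R E G" by simp_all
  then obtain n e where P: "nest_partition R \<rho> E G n e" "{a} \<subseteq> nest_partition.H R E G n e"
    by (rule common_partition[of _ 1]) auto
  interpret P: nest_partition R \<rho> E G n e by (rule P(1))
  obtain b where "b \<in> P.H" "b \<otimes> a = \<one>" using P.H_inverse P(2) by blast
  then show "\<exists>y\<in>carrier env_group. y \<otimes>\<^bsub>env_group\<^esub> a = \<one>\<^bsub>env_group\<^esub>"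
    using P.H_subset_envelope by auto
qed (auto simp: m_assoc envelope_carrier)

text \<open>The rank does not grow under multiplication, and multiplying back by \<open>v\<close>
  shows that it does not drop either. This is the source of bi-invariance.\<close>

lemma rho_unit_mult:
  assumes "u \<in> carrier R" "v \<in> carrier R" "x \<in> carrier R"
  shows "v \<otimes> u = \<one> \<Longrightarrow> \<rho> (u \<otimes> x) = \<rho> x" "u \<otimes> v = \<one> \<Longrightarrow> \<rho> (x \<otimes> u) = \<rho> x"
proof -
  assume "v \<otimes> u = \<one>"
  then have "x = v \<otimes> (u \<otimes> x)" using assms by (simp add: m_assoc[symmetric])
  then show "\<rho> (u \<otimes> x) = \<rho> x"
    using rho_mult_right[of v "u \<otimes> x"] rho_mult_right[of u x] assms by simp
next
  assume "u \<otimes> v = \<one>"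
  then have "x = x \<otimes> u \<otimes> v" using assms by (simp add: m_assoc)
  then show "\<rho> (x \<otimes> u) = \<rho> x"
    using rho_mult_left[of "x \<otimes> u" v] rho_mult_left[of x u] assms by simp
qed

lemma env_biinvariant: "biinvariant_metric_group env_group (rank_dist R \<rho>)"
proof -
  interpret EG: group env_group by (rule group_env_group)
  interpret M: Metric_space "carrier R" "rank_dist R \<rho>" by (rule rank_metric)
  have met: "Metric_space (carrier env_group) (rank_dist R \<rho>)"
    by (rule M.subspace) (auto simp: envelope_carrier)
  have inv: "inv\<^bsub>env_group\<^esub> z \<in> carrier R" "inv\<^bsub>env_group\<^esub> z \<otimes> z = \<one>" "z \<otimes> inv\<^bsub>env_group\<^esub> z = \<one>"
    if "z \<in> envelope R E G" for z
    using EG.inv_closed[of z] EG.l_inv[of z] EG.r_inv[of z] that envelope_carrier by simp_all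
  show ?thesis
  proof (intro biinvariant_metric_group.intro biinvariant_metric_group_axioms.intro group_env_group met)
    fix x y z assume xyz: "x \<in> carrier env_group" "y \<in> carrier env_group" "z \<in> carrier env_group"
    then have R: "x \<in> carrier R" "y \<in> carrier R" "z \<in> carrier R" using envelope_carrier by simp_all
    have z: "z \<in> envelope R E G" using xyz by simp
    have "z \<otimes> x \<ominus> z \<otimes> y = z \<otimes> (x \<ominus> y)" using R by (simp add: minus_eq r_distr r_minus)
    then show "rank_dist R \<rho> (z \<otimes>\<^bsub>env_group\<^esub> x) (z \<otimes>\<^bsub>env_group\<^esub> y) = rank_dist R \<rho> x y"
      using rho_unit_mult(1)[OF R(3) inv(1)[OF z], of "x \<ominus> y"] inv[OF z] R by (simp add: rank_dist_def)
    have "x \<otimes> z \<ominus> y \<otimes> z = (x \<ominus> y) \<otimes> z" using R by (simp add: minus_eq l_distr l_minus)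
    then show "rank_dist R \<rho> (x \<otimes>\<^bsub>env_group\<^esub> z) (y \<otimes>\<^bsub>env_group\<^esub> z) = rank_dist R \<rho> x y"
      using rho_unit_mult(2)[OF R(3) inv(1)[OF z], of "x \<ominus> y"] inv[OF z] R by (simp add: rank_dist_def)
  qed
qed

end

sublocale nest_group \<subseteq> Gam: biinvariant_metric_group env_group "rank_dist R \<rho>"
  by (rule env_biinvariant)

text \<open>Connects the metric topology of the locale with the subspace topology in which the
  theorem is stated.\<close>

lemma (in nest_group) env_topology: "Gam.mtopology = subtopology (rank_topology R \<rho>) (envelope R E G)"
proof -
  interpret M: Metric_space "carrier R" "rank_dist R \<rho>" by (rule rank_metric)
  interpret S: Submetric "carrier R" "rank_dist R \<rho>" "envelope R E G"
    by unfold_locales (auto simp: envelope_carrier)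
  show ?thesis using S.mtopology_submetric by (simp add: rank_topology_def)
qed

section \<open>Concentration of the group of a partition\<close>

context nest_partition
begin

lemma H_in_envelope: "a \<in> H \<Longrightarrow> a \<in> envelope R E G"
  using H_subset_envelope by blast

lemma H_inv:
  assumes "a \<in> H" shows "inv\<^bsub>env_group\<^esub> a \<in> H" "inv\<^bsub>env_group\<^esub> a \<otimes> a = \<one>"
proof -
  obtain b where b: "b \<in> H" "a \<otimes> b = \<one>" "b \<otimes> a = \<one>" using H_inverse[OF assms] by blast
  have "inv\<^bsub>env_group\<^esub> a = b"
    by (rule Gam.inv_equality) (use b assms H_in_envelope in simp_all)
  then show "inv\<^bsub>env_group\<^esub> a \<in> H" "inv\<^bsub>env_group\<^esub> a \<otimes> a = \<one>" using b by simp_all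
qed

text \<open>A triangular \<open>a\<close> maps \<open>PI (e k)\<close> into itself, and
  \<open>c\<close> is the identity there.\<close>

lemma stab_conj:
  assumes k: "k \<le> n" and a: "a \<in> H" and c: "c \<in> stab k"
  shows "inv\<^bsub>env_group\<^esub> a \<otimes> c \<otimes> a \<in> stab k"
proof -
  define b where "b = inv\<^bsub>env_group\<^esub> a"
  have b: "b \<in> H" "b \<otimes> a = \<one>" using H_inv[OF a] by (simp_all add: b_def)
  have cH: "c \<in> H" "c \<otimes> e k = e k" using c by (simp_all add: stab_def)
  have R: "a \<in> carrier R" "b \<in> carrier R" "c \<in> carrier R" "e k \<in> carrier R" using a b cH H_R e_R k by simp_all
  have ae: "a \<otimes> e k = e k \<otimes> (a \<otimes> e k)" using RE_triangular[OF H_RE[OF a] e_E[OF k]] by simp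
  have "b \<otimes> c \<otimes> a \<otimes> e k = b \<otimes> (c \<otimes> (a \<otimes> e k))" using R by (simp add: m_assoc)
  also have "c \<otimes> (a \<otimes> e k) = c \<otimes> e k \<otimes> (a \<otimes> e k)" using R by (subst ae) (simp add: m_assoc)
  also have "\<dots> = a \<otimes> e k" unfolding cH(2) by (rule ae[symmetric])
  also have "b \<otimes> (a \<otimes> e k) = e k" using R b(2) by (simp add: m_assoc[symmetric])
  finally have "b \<otimes> c \<otimes> a \<otimes> e k = e k" .
  then show ?thesis using H_mult[OF H_mult[OF b(1) cH(1)] a] by (simp add: stab_def b_def)
qed

text \<open>Diagonal blocks are multiplicative, so a block equal to the unit \<open>d k\<close>
  remains so under conjugation.\<close>

lemma ustab_conj:
  assumes k: "k < n" and a: "a \<in> H" and c: "c \<in> ustab k"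
  shows "inv\<^bsub>env_group\<^esub> a \<otimes> c \<otimes> a \<in> ustab k"
proof -
  define b where "b = inv\<^bsub>env_group\<^esub> a"
  have b: "b \<in> H" "b \<otimes> a = \<one>" using H_inv[OF a] by (simp_all add: b_def)
  have c': "c \<in> stab k" "c \<in> H" "block k c = d k" using c by (simp_all add: ustab_def stab_def)
  note RE = H_RE[OF a] H_RE[OF b(1)] H_RE[OF c'(2)]
  have "block k (b \<otimes> c \<otimes> a) = block k b \<otimes> d k \<otimes> block k a"
    using block_mult[OF RE_mult[OF RE(2,3)] RE(1) k] block_mult[OF RE(2,3) k] c'(3) by simp
  also have "\<dots> = block k b \<otimes> block k a" using block_d[OF k RE_carrier[OF RE(2)]] by simp
  also have "\<dots> = block k (b \<otimes> a)" by (rule block_mult[OF RE(2,1) k, symmetric])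
  finally have "block k (b \<otimes> c \<otimes> a) = d k" using b(2) block_one[OF k] by simp
  then show ?thesis using stab_conj[OF less_imp_le[OF k] a c'(1)] by (simp add: ustab_def b_def)
qed

lemma unip_subgroup:
  assumes k: "k < n" shows "subgroup (unip k ` carrier R) env_group"
proof (rule Gam.subgroupI)
  show "unip k ` carrier R \<subseteq> carrier env_group" using unip_H[OF k] H_in_envelope by auto
  show "unip k ` carrier R \<noteq> {}" by blast
  fix a assume "a \<in> unip k ` carrier R"
  then obtain x where x: "x \<in> carrier R" "a = unip k x" by blast
  have "inv\<^bsub>env_group\<^esub> a = unip k (\<ominus> x)"
  proof (rule Gam.inv_equality)
    show "unip k (\<ominus> x) \<otimes>\<^bsub>env_group\<^esub> a = \<one>\<^bsub>env_group\<^esub>"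
      using unip_mult[OF k _ x(1), of "\<ominus> x"] unip_zero[OF k] x by (simp add: l_neg)
  qed (use x unip_H[OF k] H_in_envelope in simp_all)
  then show "inv\<^bsub>env_group\<^esub> a \<in> unip k ` carrier R" using x by simp
  fix b assume "b \<in> unip k ` carrier R"
  then obtain y where y: "y \<in> carrier R" "b = unip k y" by blast
  show "a \<otimes>\<^bsub>env_group\<^esub> b \<in> unip k ` carrier R" using unip_mult[OF k x(1) y(1)] x y by auto
qed

lemma unip_block:
  assumes k: "k < n" and x: "x \<in> carrier R" shows "block k (unip k x) = d k"
proof -
  have R: "e k \<in> carrier R" "d k \<in> carrier R" using e_R d_R k by simp_all
  have "block k (unip k x) = d k \<otimes> (unip k x \<otimes> d k)"
    using R unip_R[OF k x] by (simp add: block_def m_assoc)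
  also have "\<dots> = d k \<otimes> d k \<oplus> d k \<otimes> e k \<otimes> (x \<otimes> d k)"
    using unip_e(2)[OF k x] R x by (simp add: r_distr m_assoc)
  finally show ?thesis using d_idem[OF k] d_e[OF k] R x by simp
qed

lemma ustab_eq:
  assumes k: "k < n" shows "unip k ` carrier R <#>\<^bsub>env_group\<^esub> stab (Suc k) = ustab k"
proof (intro equalityI subsetI)
  fix a assume "a \<in> unip k ` carrier R <#>\<^bsub>env_group\<^esub> stab (Suc k)"
  then obtain x b where x: "x \<in> carrier R" and b: "b \<in> stab (Suc k)" and a: "a = unip k x \<otimes> b"
    by (auto simp: set_mult_def)
  have bH: "b \<in> H" "b \<otimes> e (Suc k) = e (Suc k)" using b by (simp_all add: stab_def)
  have R: "b \<in> carrier R" "e k \<in> carrier R" "e (Suc k) \<in> carrier R" "d k \<in> carrier R" "unip k x \<in> carrier R"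
    using bH H_R e_R d_R unip_R x k by simp_all
  have ek: "e (Suc k) \<otimes> e k = e k" using idem_leD(2)[OF e_Suc[OF k]] .
  have "b \<otimes> e k = b \<otimes> e (Suc k) \<otimes> e k" using R ek by (simp add: m_assoc)
  then have be: "b \<otimes> e k = e k" using bH(2) ek by simp
  have "b \<otimes> d k = b \<otimes> e (Suc k) \<otimes> d k" using R eS_d[OF k] by (simp add: m_assoc)
  then have "b \<otimes> d k = d k" using bH(2) eS_d[OF k] by simp
  then have bb: "block k b = d k" using R d_idem[OF k] by (simp add: block_def m_assoc)
  have "a \<otimes> e k = e k" using a be unip_e(1)[OF k x] R by (simp add: m_assoc)
  moreover have "block k a = d k"
    using a block_mult[OF H_RE[OF unip_H[OF k x]] H_RE[OF bH(1)] k] unip_block[OF k x] bb d_idem[OF k] by simp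
  ultimately show "a \<in> ustab k" using a H_mult[OF unip_H[OF k x] bH(1)] by (simp add: ustab_def stab_def)
next
  fix a assume "a \<in> ustab k"
  then obtain x b where "x \<in> carrier R" "b \<in> stab (Suc k)" "a = unip k x \<otimes> b" by (rule ustab_factor[OF k])
  then show "a \<in> unip k ` carrier R <#>\<^bsub>env_group\<^esub> stab (Suc k)" by (auto simp: set_mult_def)
qed

lemma stab_eq:
  assumes k: "k < n" shows "diag k ` G <#>\<^bsub>env_group\<^esub> ustab k = stab k"
proof (intro equalityI subsetI)
  fix a assume "a \<in> diag k ` G <#>\<^bsub>env_group\<^esub> ustab k"
  then obtain g c where g: "g \<in> G" and c: "c \<in> ustab k" and a: "a = diag k g \<otimes> c" by (auto simp: set_mult_def)
  have c': "c \<in> H" "c \<otimes> e k = e k" using c by (simp_all add: ustab_def stab_def)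
  have "a \<otimes> e k = e k"
    using a c' diag_e(1)[OF k g] diag_R[OF k g] H_R e_R[OF less_imp_le[OF k]] by (simp add: m_assoc)
  then show "a \<in> stab k" using a H_mult[OF diag_H[OF k g] c'(1)] by (simp add: stab_def)
next
  fix a assume "a \<in> stab k"
  then obtain g c where "g \<in> G" "c \<in> ustab k" "a = diag k g \<otimes> c" by (rule stab_factor[OF k])
  then show "a \<in> diag k ` G <#>\<^bsub>env_group\<^esub> ustab k" by (auto simp: set_mult_def)
qed

lemma unip_dist:
  assumes k: "k < n" and x: "x \<in> carrier R" shows "rank_dist R \<rho> (unip k x) \<one> \<le> \<rho> (d k)"
proof -
  have R: "e k \<in> carrier R" "d k \<in> carrier R" using e_R d_R k by simp_all
  have "unip k x \<ominus> \<one> = e k \<otimes> x \<otimes> d k"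
    using R x a_comm[of \<one> "e k \<otimes> x \<otimes> d k"] by (simp add: unip_def minus_eq a_assoc r_neg)
  then show ?thesis using rho_mult_right[of "e k \<otimes> x" "d k"] R x unip_R[OF k x] by (simp add: rank_dist_def)
qed

lemma diag_dist:
  assumes k: "k < n" and g: "g \<in> G" and h: "h \<in> G"
  shows "rank_dist R \<rho> (diag k g) (diag k h) = \<rho> (d k \<otimes> (g \<ominus> h) \<otimes> d k)"
proof -
  have R: "d k \<in> carrier R" "g \<in> carrier R" "h \<in> carrier R" "block k g \<in> carrier R" "block k h \<in> carrier R"
    using d_R G_carrier block_R k g h by simp_all
  define c where "c = \<one> \<ominus> d k"
  have cR: "c \<in> carrier R" using R by (simp add: c_def)
  have "diag k g \<ominus> diag k h = (c \<oplus> block k g) \<oplus> (\<ominus> c \<oplus> \<ominus> block k h)"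
    using R cR unfolding diag_def c_def[symmetric] by (simp add: minus_eq minus_add)
  also have "\<dots> = block k g \<oplus> \<ominus> block k h"
    using R cR a_comm[of c "block k g"] by (simp add: a_assoc r_neg2)
  also have "\<dots> = d k \<otimes> (g \<ominus> h) \<otimes> d k"
    using R by (simp add: block_def minus_eq l_distr r_distr l_minus r_minus)
  finally show ?thesis using diag_R[OF k g] diag_R[OF k h] by (simp add: rank_dist_def)
qed

text \<open>Both steps of the series, from \<open>stab (Suc k)\<close> to \<open>ustab k\<close> and
  from there to \<open>stab k\<close>, multiply by a group within distance
  \<open>\<rho> (d k)\<close> of \<open>\<one>\<close> that has an invariant mean; each adds
  \<open>(\<rho> (d k))\<^sup>2\<close> to the variance.\<close>

lemma concentrated_stab:
  assumes am: "amenable TYPE('a set set) ((units_of (nest_subring R E))\<lparr>carrier := G\<rparr>)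
      (subtopology (rank_topology R \<rho>) G)"
    and k: "k \<le> n"
  shows "Gam.concentrated (stab k) (\<Sum>i=k..<n. 2 * (\<rho> (d i))\<^sup>2)"
  using k
proof (induction rule: inc_induct)
  case base
  have "\<one> \<in> stab n" using H_one by (simp add: stab_def e_n)
  then have "stab n = {\<one>}" using stab_n by blast
  then show ?case using Gam.concentrated_one by simp
next
  case (step k)
  then have k: "k < n" by simp
  have SkH: "stab j \<subseteq> H" "ustab j \<subseteq> H" for j by (auto simp: ustab_def stab_def)
  have HE: "stab j \<subseteq> carrier env_group" "ustab j \<subseteq> carrier env_group" for j
    using order_trans[OF SkH(1) H_subset_envelope] order_trans[OF SkH(2) H_subset_envelope] by simp_all
  have comm: "a \<otimes>\<^bsub>env_group\<^esub> b = b \<otimes>\<^bsub>env_group\<^esub> a" if "a \<in> unip k ` carrier R" "b \<in> unip k ` carrier R" for a b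
    using that unip_mult[OF k] a_comm by auto
  obtain m where m: "Gam.mean_on (unip k ` carrier R) m" "Gam.left_invariant (unip k ` carrier R) m"
    using Gam.commutative_invariant_mean[OF unip_subgroup[OF k] comm] by blast
  interpret U: subgroup "unip k ` carrier R" env_group by (rule unip_subgroup[OF k])
  have "Gam.concentrated (unip k ` carrier R <#>\<^bsub>env_group\<^esub> stab (Suc k))
      ((\<Sum>i=Suc k..<n. 2 * (\<rho> (d i))\<^sup>2) + (\<rho> (d k))\<^sup>2)"
  proof (rule Gam.concentrated_set_mult[OF U.subset _ HE(1) _ m _ step.IH])
    show "\<one>\<^bsub>env_group\<^esub> \<in> unip k ` carrier R" by (rule U.one_closed)
    show "inv\<^bsub>env_group\<^esub> a \<otimes>\<^bsub>env_group\<^esub> b \<otimes>\<^bsub>env_group\<^esub> a \<in> stab (Suc k)"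
      if "a \<in> unip k ` carrier R" "b \<in> stab (Suc k)" for a b
      using stab_conj[of "Suc k" a b] unip_H[OF k] that k by auto
    show "rank_dist R \<rho> a \<one>\<^bsub>env_group\<^esub> \<le> \<rho> (d k)" if "a \<in> unip k ` carrier R" for a
      using that unip_dist[OF k] by auto
  qed
  then have conc: "Gam.concentrated (ustab k) ((\<Sum>i=Suc k..<n. 2 * (\<rho> (d i))\<^sup>2) + (\<rho> (d k))\<^sup>2)"
    unfolding ustab_eq[OF k] .
  let ?GG = "(units_of (nest_subring R E))\<lparr>carrier := G\<rparr>"
  have hom: "diag k \<in> hom ?GG env_group"
    using diag_mult[OF k] diag_H[OF k] H_in_envelope
    by (intro homI) (simp_all add: units_of_def nest_subring_def)
  interpret M: Metric_space "carrier R" "rank_dist R \<rho>" by (rule rank_metric)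
  have GT: "topspace (subtopology (rank_topology R \<rho>) G) = G"
    using G_carrier by (auto simp: rank_topology_def)
  \<comment> \<open>Amenability of \<open>G\<close> refers to the rank topology, so the transfer of
    means needs continuity: \<open>diag k\<close> is 1-Lipschitz, since compression by
    \<open>d k\<close> does not raise the rank.\<close>
  have cont: "continuous_map (subtopology (rank_topology R \<rho>) G) Gam.mtopology (diag k)"
    unfolding Gam.continuous_map_to_metric GT
  proof (intro ballI allI impI)
    fix g and \<epsilon> :: real assume g: "g \<in> G" and \<epsilon>: "\<epsilon> > 0"
    have "openin (subtopology (rank_topology R \<rho>) G) (M.mball g \<epsilon> \<inter> G)"
      unfolding rank_topology_def by (rule openin_subtopology_Int) simp
    moreover have "g \<in> M.mball g \<epsilon> \<inter> G" using g \<epsilon> G_carrier by simp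
    moreover have "diag k h \<in> Gam.mball (diag k g) \<epsilon>" if "h \<in> M.mball g \<epsilon> \<inter> G" for h
    proof -
      have h: "h \<in> G" "\<rho> (g \<ominus> h) < \<epsilon>" using that G_carrier g by (auto simp: rank_dist_def)
      have R: "d k \<in> carrier R" "g \<ominus> h \<in> carrier R" using d_R[OF k] G_carrier g h by simp_all
      have "\<rho> (d k \<otimes> (g \<ominus> h) \<otimes> d k) \<le> \<rho> (g \<ominus> h)"
        using rho_mult_left[of "d k \<otimes> (g \<ominus> h)" "d k"] rho_mult_right[of "d k" "g \<ominus> h"] R by simp
      then have "rank_dist R \<rho> (diag k g) (diag k h) < \<epsilon>" using diag_dist[OF k g h(1)] h(2) by simp
      then show ?thesis unfolding Gam.in_mball using diag_H[OF k] H_in_envelope g h by simp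
    qed
    ultimately show "\<exists>U. openin (subtopology (rank_topology R \<rho>) G) U \<and> g \<in> U \<and> (\<forall>y\<in>U. diag k y \<in> Gam.mball (diag k g) \<epsilon>)"
      by blast
  qed
  obtain m' where m': "Gam.mean_on (diag k ` G) m'" "Gam.left_invariant (diag k ` G) m'"
    using Gam.amenable_image_invariant_mean[OF am hom cont] by auto
  have "Gam.concentrated (diag k ` G <#>\<^bsub>env_group\<^esub> ustab k)
      ((\<Sum>i=Suc k..<n. 2 * (\<rho> (d i))\<^sup>2) + (\<rho> (d k))\<^sup>2 + (\<rho> (d k))\<^sup>2)"
  proof (rule Gam.concentrated_set_mult[OF _ _ HE(2) _ m' _ conc])
    show "diag k ` G \<subseteq> carrier env_group" using diag_H[OF k] H_in_envelope by auto
    show "\<one>\<^bsub>env_group\<^esub> \<in> diag k ` G" using diag_one[OF k] G_one by (auto intro: image_eqI[of _ _ \<one>])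
    show "inv\<^bsub>env_group\<^esub> a \<otimes>\<^bsub>env_group\<^esub> b \<otimes>\<^bsub>env_group\<^esub> a \<in> ustab k"
      if "a \<in> diag k ` G" "b \<in> ustab k" for a b
      using ustab_conj[OF k, of a b] diag_H[OF k] that by auto
    fix a assume "a \<in> diag k ` G"
    then obtain g where g: "g \<in> G" "a = diag k g" by blast
    have R: "d k \<in> carrier R" "g \<ominus> \<one> \<in> carrier R" using d_R[OF k] G_carrier g by simp_all
    have "rank_dist R \<rho> a \<one> = \<rho> (d k \<otimes> (g \<ominus> \<one>) \<otimes> d k)"
      using diag_dist[OF k g(1) G_one] diag_one[OF k] g(2) by simp
    also have "\<dots> \<le> \<rho> (d k)" using rho_mult_right R by simp
    finally show "rank_dist R \<rho> a \<one>\<^bsub>env_group\<^esub> \<le> \<rho> (d k)" by simp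
  qed
  then show ?case unfolding stab_eq[OF k] using k by (simp add: sum.atLeast_Suc_lessThan algebra_simps)
qed

end

lemma (in nest_group) envelope_extremely_amenable:
  assumes am: "amenable TYPE('a set set) ((units_of (nest_subring R E))\<lparr>carrier := G\<rparr>)
      (subtopology (rank_topology R \<rho>) G)"
  shows "extremely_amenable TYPE('x) env_group Gam.mtopology"
proof (rule Gam.extremely_amenable_of_concentration)
  fix K and \<delta> :: real assume K: "finite K" "K \<subseteq> carrier env_group" and \<delta>: "\<delta> > 0"
  \<comment> \<open>With mesh at most \<open>1 / Suc N\<close> and total rank 1, the sum of the
    \<open>2 * (\<rho> (P.d i))\<^sup>2\<close> is at most
    \<open>2 / Suc N < \<delta>\<close>.\<close>
  obtain N where N: "1 / real (Suc N) < \<delta> / 2" using nat_approx_posE[of "\<delta> / 2"] \<delta> by auto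
  have "K \<subseteq> envelope R E G" using K by simp
  then obtain n e where P: "nest_partition R \<rho> E G n e" "K \<subseteq> nest_partition.H R E G n e"
    and mesh: "\<And>k. k < n \<Longrightarrow> \<rho> (nest_partition.d R e k) \<le> 1 / Suc N"
    by (rule common_partition[OF K(1), of "Suc N"]) auto
  interpret P: nest_partition R \<rho> E G n e by (rule P(1))
  have "Gam.concentrated P.H (\<Sum>i=0..<n. 2 * (\<rho> (P.d i))\<^sup>2)"
    using P.concentrated_stab[OF am, of 0] by (simp add: P.stab_0)
  moreover have "(\<Sum>i=0..<n. 2 * (\<rho> (P.d i))\<^sup>2) \<le> \<delta>"
  proof -
    have "(\<Sum>i=0..<n. 2 * (\<rho> (P.d i))\<^sup>2) \<le> (\<Sum>i=0..<n. 2 / Suc N * \<rho> (P.d i))"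
    proof (rule sum_mono)
      fix i assume "i \<in> {0..<n}"
      then have i: "i < n" by simp
      have "\<rho> (P.d i) * \<rho> (P.d i) \<le> 1 / Suc N * \<rho> (P.d i)"
        by (rule mult_right_mono[OF mesh[OF i] rho_nonneg[OF P.d_R[OF i]]])
      then show "2 * (\<rho> (P.d i))\<^sup>2 \<le> 2 / Suc N * \<rho> (P.d i)" by (simp add: power2_eq_square)
    qed
    also have "\<dots> = 2 / Suc N * (\<Sum>i<n. \<rho> (P.d i))" by (simp only: sum_distrib_left atLeast0LessThan)
    also have "\<dots> = 2 / Suc N" by (simp add: P.sum_rho_d)
    finally show ?thesis using N by simp
  qed
  ultimately show "\<exists>B s. K \<subseteq> B \<and> B \<subseteq> carrier env_group \<and> Gam.concentrated B s \<and> s \<le> \<delta>"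
    using P(2) P.H_subset_envelope by (intro exI[of _ P.H] exI conjI) auto
qed

theorem theorem1p4:
  fixes R :: "('a, 'm) ring_scheme" and \<rho> :: "'a \<Rightarrow> real" and E G :: "'a set"
  assumes "continuous_ring R" and "irreducible_ring R"
    and "rank_function R \<rho>"
    and "rank_topology R \<rho> \<noteq> discrete_topology (carrier R)"
    and "maximal_nest R E"
    and "subgroup G (units_of (nest_subring R E))"
    and "amenable TYPE('a set set)
           ((units_of (nest_subring R E))\<lparr>carrier := G\<rparr>)
           (subtopology (rank_topology R \<rho>) G)"
  shows "extremely_amenable TYPE('x)
           ((units_of (nest_subring R E))\<lparr>carrier := envelope R E G\<rparr>)
           (subtopology (rank_topology R \<rho>) (envelope R E G))"
proof -
  have "ring R" using assms(1) by (simp add: continuous_ring_def regular_ring_def)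
  then interpret ring R .
  interpret nest_group R \<rho> E G
  proof
    show "\<exists>b\<in>carrier R. a \<otimes>\<^bsub>R\<^esub> b \<otimes>\<^bsub>R\<^esub> a = a" if "a \<in> carrier R" for a
      using assms(1) that by (simp add: continuous_ring_def regular_ring_def)
    show "continuous_geometry (right_ideal_lattice R)"
      using assms(1) by (simp add: continuous_ring_def)
  qed (fact assms(2-5) subgroup.subset[OF assms(6)] subgroup.m_closed[OF assms(6)]
      subgroup.one_closed[OF assms(6)] subgroup.m_inv_closed[OF assms(6)])+
  show ?thesis
    using envelope_extremely_amenable[OF assms(7)] 
    unfolding env_topology unfolding env_group_def .
qed

end
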